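(* Let $\dot x=f(x,u)$ be a system with $x$ in a smooth $n$-dimensional manifold $X$, $u\in\mathbb R^m$, $m\le n$, $f$ of class $C^\infty$. Let $\mathbf j=(j_1,\dots,j_m)\in\mathbb N^m$ with $0=j_1\le\dots\le j_{m-1}\le j_m$, $j_m$ finite. (a) If $\mathbf j=(j_1,\dots,j_i,j_{i+1},\dots,j_m)$ and $\mathbf j'=(j_1,\dots,j_i,j'_{i+1},\dots,j'_m)$ for some $(j'_{i+1},\dots,j'_m)$ (with $\mathbf j'$ also nondecreasing), then $\Delta_k^{(\mathbf j)}=\Delta_k^{(\mathbf j')}$ for all $k=0,\dots,\min(j_{i+1},j'_{i+1})-1$. (b) For all $k\ge0$, $$\dim\Gamma_k^{(\mathbf j)}=\begin{cases}\sum_{p=1}^i j_p+(k+1)(m-i)&\text{if } j_i\le k<j_{i+1},\ i=1,\dots,m-1,\\ |\mathbf j|&\text{if }k\ge j_m,\end{cases}$$ $$\dim\Delta_k^{(\mathbf j)}\le\begin{cases}\min\big((k+1)i-\sum_{p=1}^i j_p,\ n+i\big)&\text{if } j_i\le k<j_{i+1},\ i=1,\dots,m-1,\\ \min\big((k+1)m-|\mathbf j|,\ n+m\big)&\text{if }k\ge j_m,\end{cases}$$ and $$G_k^{(\mathbf j)}=\Gamma_k^{(\mathbf j)}\oplus\Delta_k^{(\mathbf j)}.$$ (c) The finite integer $k_\star^{(\mathbf j)}$, which satisfies $k_\star^{(\mathbf j)}\le n+|\mathbf j|$, is such that $\Delta_k^{(\mathbf j)}=\Delta_{k_\star^{(\mathbf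 j)}}^{(\mathbf j)}$ and $\Gamma_k^{(\mathbf j)}=\Gamma_{k_\star^{(\mathbf j)}}^{(\mathbf j)}$ for all $k\ge k_\star^{(\mathbf j)}$. If, in addition, $\dim\Delta_{k_\star^{(\mathbf j)}}^{(\mathbf j)}=m+n$, then $$n+|\mathbf j|\ \ge\ k_\star^{(\mathbf j)}\ \ge\ \max\Big(j_m,\frac{n+|\mathbf j|}{m}\Big).$$
   Context: Notation. $u_i^{(0)}=u_i$, and $u_i^{(k)}$ are independent (jet) coordinates for the $k$-th time derivative of $u_i$. For $\mathbf j\in\mathbb N^m$, $|\mathbf j|=\sum_i j_i$; $X^{(\mathbf j)}=X\times\mathbb R^{m+|\mathbf j|}$ has coordinates $\bar x^{(\mathbf j)}=(x,u_1^{(0)},\dots,u_1^{(j_1)},\dots,u_m^{(0)},\dots,u_m^{(j_m)})$. On $X^{(\mathbf j)}$ let $g_0^{(\mathbf j)}=\sum_{i=1}^n f_i(x,u)\frac{\partial}{\partial x_i}+\sum_{i=1}^m\sum_{k=0}^{j_i-1}u_i^{(k+1)}\frac{\partial}{\partial u_i^{(k)}}$ (inner sum zero if $j_i=0$). $\mathrm{ad}_\eta\gamma=[\eta,\gamma]$, $\mathrm{ad}^{k}_\eta\gamma=[\eta,\mathrm{ad}^{k-1}_\eta\gamma]$, $\mathrm{ad}^0_\eta\gamma=\gamma$; for a distribution $D$, $\mathrm{ad}_\eta D=\{\mathrm{ad}_\eta\gamma:\gamma\in D\}$; $\{\cdots\}$ is the distribution generated by the listed vector fields. $G_0^{(\mathbf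 j)}=\{\frac{\partial}{\partial u_1^{(j_1)}},\dots,\frac{\partial}{\partial u_m^{(j_m)}}\}$, $G_{k+1}^{(\mathbf j)}=G_k^{(\mathbf j)}+\mathrm{ad}_{g_0^{(\mathbf j)}}G_k^{(\mathbf j)}$ for $k\ge 0$. $\Gamma_k^{(\mathbf j)}=\bigoplus_{p=2}^m\{\frac{\partial}{\partial u_p^{(j_p-l)}}\mid l=0,\dots,\min(k,j_p-1)\}$ (empty range if $j_p=0$). $\Delta_k^{(\mathbf j)}=\sum_{p=1}^m\{\mathrm{ad}_{g_0^{(\mathbf j)}}^{\,l-j_p}\frac{\partial}{\partial u_p^{(0)}}\mid l=j_p,\dots,k\}$ (no contribution from $p$ if $k<j_p$). In (a), the generators of $\Delta_k^{(\mathbf j)}$ and $\Delta_k^{(\mathbf j')}$ are compared as vector fields expressed in the common coordinates $x,u_p^{(r)}$. $k_\star^{(\mathbf j)}$ is the finite integer at which the filtration $G_k^{(\mathbf j)}$ becomes stationary, i.e. such that $G_k^{(\mathbf j)}=G_{k_\star^{(\mathbf j)}}^{(\mathbf j)}$ for all $k\ge k_\star^{(\mathbf j)}$; in full generality it depends on the point where it is evaluated.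
   Formalization: The bound k⋆ ≤ n+|j| (both occurrences in (c)) is asserted only at points near which every G_k has constant dimension; without this it is false: n=m=1, j=0, f=1+x²u gives k⋆=3>1 at x=0. All else holds at every point. *)

theory Defs
  imports "HOL-Analysis.Analysis" "HOL-Library.Function_Algebras" "HOL-Library.Set_Algebras"
begin

section \<open>Smooth functions of finitely many real coordinates\<close>

definition partial :: "'c \<Rightarrow> (('c \<Rightarrow> real) \<Rightarrow> real) \<Rightarrow> ('c \<Rightarrow> real) \<Rightarrow> real" where
  "partial b h z = deriv (\<lambda>t. h (z(b := t))) (z b)"

text \<open>Continuity refers to the product topology on \<open>'c \<Rightarrow> real\<close>, which is the Euclidean
  topology when \<open>'c\<close> is finite.\<close>

primrec C_diff :: "nat \<Rightarrow> 'c set \<Rightarrow> ('c \<Rightarrow> real) set \<Rightarrow> (('c \<Rightarrow> real) \<Rightarrow> real) \<Rightarrow> bool" where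
  "C_diff 0 I D h \<longleftrightarrow> continuous_on D h"
| "C_diff (Suc k) I D h \<longleftrightarrow> continuous_on D h \<and>
     (\<forall>b\<in>I. (\<forall>z\<in>D. (\<lambda>t. h (z(b := t))) differentiable (at (z b))) \<and> C_diff k I D (partial b h))"

text \<open>\<open>C\<^sup>\<infinity>\<close> functions on the open set \<open>D\<close> that only involve the coordinates in the (finite) set \<open>I\<close>.
  In this way a function of finitely many coordinates is identified with its pull-back to the
  space of all coordinates.\<close>

definition smooth_fun :: "'c set \<Rightarrow> ('c \<Rightarrow> real) set \<Rightarrow> (('c \<Rightarrow> real) \<Rightarrow> real) \<Rightarrow> bool" where
  "smooth_fun I D h \<longleftrightarrow>
     (\<forall>z\<in>D. \<forall>z'\<in>D. (\<forall>b\<in>I. z b = z' b) \<longrightarrow> h z = h z') \<and> (\<forall>k. C_diff k I D h)"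

section \<open>Smooth manifolds and systems\<close>

text \<open>The manifold \<open>X\<close> is the whole of a Hausdorff second countable type \<open>'x\<close>; its dimension is
  \<open>CARD('n)\<close>.\<close>

type_synonym ('x, 'n) chart = "'x set \<times> ('x \<Rightarrow> 'n \<Rightarrow> real)"

definition smooth_atlas ::
  "('x::{t2_space,second_countable_topology}, 'n::finite) chart set \<Rightarrow> bool" where
  "smooth_atlas A \<longleftrightarrow>
     (\<Union>(U, \<phi>)\<in>A. U) = UNIV \<and>
     (\<forall>(U, \<phi>)\<in>A. open U \<and> open (\<phi> ` U) \<and> homeomorphism U (\<phi> ` U) \<phi> (inv_into U \<phi>)) \<and>
     (\<forall>(U, \<phi>)\<in>A. \<forall>(V, \<psi>)\<in>A. \<forall>i.
        smooth_fun UNIV (\<phi> ` (U \<inter> V)) (\<lambda>y. \<psi> (inv_into U \<phi> y) i))"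

text \<open>\<open>Xc i\<close> is the coordinate \<open>x\<^sub>i\<close> and \<open>Uc p r\<close> is the jet coordinate \<open>u\<^sub>p\<^sup>(\<^sup>r\<^sup>)\<close>, where \<open>p\<close> ranges
  over \<open>1, \<dots>, m\<close>.\<close>

datatype 'n coord = Xc 'n | Uc nat nat

text \<open>The coordinates on the jet manifold \<open>X\<^sup>(\<^sup>j\<^sup>)\<close>. All the jet manifolds are described in the
  common coordinate space \<open>'n coord \<Rightarrow> real\<close>: in a chart, a point of \<open>X\<^sup>(\<^sup>j\<^sup>)\<close> is given by any
  \<open>z\<close> with the prescribed coordinates in \<open>jet_coords m j\<close>; the other coordinates of \<open>z\<close> are
  irrelevant, because functions and vector fields on \<open>X\<^sup>(\<^sup>j\<^sup>)\<close> do not depend on them.\<close>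

definition jet_coords :: "nat \<Rightarrow> (nat \<Rightarrow> nat) \<Rightarrow> 'n coord set" where
  "jet_coords m j = range Xc \<union> {Uc p r | p r. p \<in> {1..m} \<and> r \<le> j p}"

definition jet_dom :: "('x, 'n) chart set \<Rightarrow> ('x, 'n) chart \<Rightarrow> ('n coord \<Rightarrow> real) set" where
  "jet_dom A c = {z. c \<in> A \<and> (\<lambda>i. z (Xc i)) \<in> snd c ` fst c}"

definition jet_point ::
  "('x, 'n) chart \<Rightarrow> ('n coord \<Rightarrow> real) \<Rightarrow> 'x \<times> (nat \<Rightarrow> nat \<Rightarrow> real)" where
  "jet_point c z = (inv_into (fst c) (snd c) (\<lambda>i. z (Xc i)), \<lambda>p r. z (Uc p r))"

definition smooth_jet_funs ::
  "('x, 'n) chart set \<Rightarrow> nat \<Rightarrow> (nat \<Rightarrow> nat) \<Rightarrow> ('x \<times> (nat \<Rightarrow> nat \<Rightarrow> real) \<Rightarrow> real) set" where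
  "smooth_jet_funs A m j =
     {h. \<forall>c\<in>A. smooth_fun (jet_coords m j) (jet_dom A c) (\<lambda>z. h (jet_point c z))}"

text \<open>A system \<open>\<dot>x = f(x,u)\<close>, that is, a smooth map \<open>f\<close> from \<open>X \<times> \<real>\<^sup>m\<close> to \<open>TX\<close> with \<open>f(x,u)\<close> tangent
  at \<open>x\<close>: \<open>f c y u i\<close> is the \<open>i\<close>-th component in the chart \<open>c\<close> at the point with coordinates \<open>y\<close>,
  and the components in two charts are related by the Jacobian matrix of the transition map.
  Smoothness in \<open>(x,u)\<close> is smoothness on the jet manifold with \<open>j = 0\<close>.\<close>

type_synonym ('x, 'n) dynamics =
  "('x, 'n) chart \<Rightarrow> ('n \<Rightarrow> real) \<Rightarrow> (nat \<Rightarrow> real) \<Rightarrow> 'n \<Rightarrow> real"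

definition control_system ::
  "('x, 'n::finite) chart set \<Rightarrow> nat \<Rightarrow> ('x, 'n) dynamics \<Rightarrow> bool" where
  "control_system A m f \<longleftrightarrow>
     (\<forall>c\<in>A. \<forall>i. smooth_fun (jet_coords m (\<lambda>p. 0)) (jet_dom A c)
        (\<lambda>z. f c (\<lambda>k. z (Xc k)) (\<lambda>p. z (Uc p 0)) i)) \<and>
     (\<forall>(U, \<phi>)\<in>A. \<forall>(V, \<psi>)\<in>A. \<forall>x\<in>U \<inter> V. \<forall>u i.
        f (V, \<psi>) (\<psi> x) u i =
          (\<Sum>k\<in>UNIV. partial k (\<lambda>y. \<psi> (inv_into U \<phi> y) i) (\<phi> x) * f (U, \<phi>) (\<phi> x) u k))"

section \<open>Vector fields and distributions on the jet manifolds\<close>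

text \<open>A vector field on a jet manifold is given by its components in every chart of \<open>A\<close>. So that
  equality of vector fields is plain equality, the components are set to \<open>0\<close> outside the domain
  of the chart.\<close>

type_synonym ('x, 'n) vfield = "('x, 'n) chart \<Rightarrow> ('n coord \<Rightarrow> real) \<Rightarrow> 'n coord \<Rightarrow> real"

definition bracket :: "('x, 'n) chart set \<Rightarrow> nat \<Rightarrow> (nat \<Rightarrow> nat)
    \<Rightarrow> ('x, 'n) vfield \<Rightarrow> ('x, 'n) vfield \<Rightarrow> ('x, 'n) vfield" where
  "bracket A m j \<eta> \<gamma> c z a =
     (if z \<in> jet_dom A c \<and> a \<in> jet_coords m j
      then \<Sum>b\<in>jet_coords m j.
             \<eta> c z b * partial b (\<lambda>w. \<gamma> c w a) z - \<gamma> c z b * partial b (\<lambda>w. \<eta> c w a) z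
      else 0)"

definition d_u :: "('x, 'n) chart set \<Rightarrow> nat \<Rightarrow> nat \<Rightarrow> ('x, 'n) vfield" where
  "d_u A p r c z a = (if z \<in> jet_dom A c \<and> a = Uc p r then 1 else 0)"

definition g0 :: "('x, 'n) chart set \<Rightarrow> nat \<Rightarrow> ('x, 'n) dynamics \<Rightarrow> (nat \<Rightarrow> nat)
    \<Rightarrow> ('x, 'n) vfield" where
  "g0 A m f j c z a =
     (if z \<in> jet_dom A c
      then (case a of
              Xc i \<Rightarrow> f c (\<lambda>k. z (Xc k)) (\<lambda>p. z (Uc p 0)) i
            | Uc p k \<Rightarrow> (if p \<in> {1..m} \<and> k < j p then z (Uc p (Suc k)) else 0))
      else 0)"

definition ad_g0 :: "('x, 'n) chart set \<Rightarrow> nat \<Rightarrow> ('x, 'n) dynamics \<Rightarrow> (nat \<Rightarrow> nat)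
    \<Rightarrow> ('x, 'n) vfield \<Rightarrow> ('x, 'n) vfield" where
  "ad_g0 A m f j \<gamma> = bracket A m j (g0 A m f j) \<gamma>"

text \<open>A distribution is a module of vector fields over the ring of smooth functions on the jet
  manifold; \<open>generated\<close> is the module generated by a set of vector fields. Its fibre at a point is the set of
  values of its members there, expressed in a chart. Sums of distributions
  are elementwise sums of sets.\<close>

definition generated :: "('x, 'n) chart set \<Rightarrow> nat \<Rightarrow> (nat \<Rightarrow> nat)
    \<Rightarrow> ('x, 'n) vfield set \<Rightarrow> ('x, 'n) vfield set" where
  "generated A m j S =
     {(\<lambda>c z a. \<Sum>\<gamma>\<in>T. h \<gamma> (jet_point c z) * \<gamma> c z a) | T h.
        finite T \<and> T \<subseteq> S \<and> (\<forall>\<gamma>\<in>T. h \<gamma> \<in> smooth_jet_funs A m j)}"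

definition fibre :: "('x, 'n) vfield set \<Rightarrow> ('x, 'n) chart \<Rightarrow> ('n coord \<Rightarrow> real)
    \<Rightarrow> ('n coord \<Rightarrow> real) set" where
  "fibre D c z = (\<lambda>\<gamma>. \<gamma> c z) ` D"

lemma vector_space_coord:
  "vector_space (\<lambda>(r::real) (v :: 'c \<Rightarrow> real) a. r * v a)"
  by unfold_locales (auto simp: fun_eq_iff algebra_simps)

definition fibre_dim :: "('x, 'n) vfield set \<Rightarrow> ('x, 'n) chart \<Rightarrow> ('n coord \<Rightarrow> real) \<Rightarrow> nat" where
  "fibre_dim D c z = vector_space.dim (\<lambda>(r::real) v a. r * v a) (fibre D c z)"

definition direct_sum :: "('x, 'n) chart set \<Rightarrow> ('x, 'n) vfield set \<Rightarrow> ('x, 'n) vfield set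
    \<Rightarrow> ('x, 'n) vfield set \<Rightarrow> bool" where
  "direct_sum A D E F \<longleftrightarrow>
     D = E + F \<and> (\<forall>c. \<forall>z\<in>jet_dom A c. fibre E c z \<inter> fibre F c z = {0})"

section \<open>The filtrations\<close>

primrec G :: "('x, 'n) chart set \<Rightarrow> nat \<Rightarrow> ('x, 'n) dynamics \<Rightarrow> (nat \<Rightarrow> nat) \<Rightarrow> nat
    \<Rightarrow> ('x, 'n) vfield set" where
  "G A m f j 0 = generated A m j {d_u A p (j p) | p. p \<in> {1..m}}"
| "G A m f j (Suc k) = G A m f j k + ad_g0 A m f j ` G A m f j k"

definition Gam :: "('x, 'n) chart set \<Rightarrow> nat \<Rightarrow> (nat \<Rightarrow> nat) \<Rightarrow> nat \<Rightarrow> ('x, 'n) vfield set" where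
  "Gam A m j k =
     (\<Sum>p\<in>{2..m}. generated A m j {d_u A p (j p - l) | l. 1 \<le> j p \<and> l \<le> min k (j p - 1)})"

definition Delta_gens :: "('x, 'n) chart set \<Rightarrow> nat \<Rightarrow> ('x, 'n) dynamics \<Rightarrow> (nat \<Rightarrow> nat)
    \<Rightarrow> nat \<Rightarrow> nat \<Rightarrow> ('x, 'n) vfield set" where
  "Delta_gens A m f j k p = {(ad_g0 A m f j ^^ (l - j p)) (d_u A p 0) | l. j p \<le> l \<and> l \<le> k}"

text \<open>The generators do not refer to the ring of coefficients, so those of different jet manifolds
  can be compared as vector fields in the common coordinates.\<close>

definition Delta :: "('x, 'n) chart set \<Rightarrow> nat \<Rightarrow> ('x, 'n) dynamics \<Rightarrow> (nat \<Rightarrow> nat) \<Rightarrow> nat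
    \<Rightarrow> ('x, 'n) vfield set" where
  "Delta A m f j k = (\<Sum>p\<in>{1..m}. generated A m j (Delta_gens A m f j k p))"

text \<open>Stationarity of the filtration is evaluated at a point.\<close>

definition stationary_from :: "('x, 'n) chart set \<Rightarrow> nat \<Rightarrow> ('x, 'n) dynamics \<Rightarrow> (nat \<Rightarrow> nat)
    \<Rightarrow> ('x, 'n) chart \<Rightarrow> ('n coord \<Rightarrow> real) \<Rightarrow> nat \<Rightarrow> bool" where
  "stationary_from A m f j c z K \<longleftrightarrow>
     (\<forall>k\<ge>K. fibre (G A m f j k) c z = fibre (G A m f j K) c z)"

definition k_star :: "('x, 'n) chart set \<Rightarrow> nat \<Rightarrow> ('x, 'n) dynamics \<Rightarrow> (nat \<Rightarrow> nat)
    \<Rightarrow> ('x, 'n) chart \<Rightarrow> ('n coord \<Rightarrow> real) \<Rightarrow> nat" where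
  "k_star A m f j c z = (LEAST K. stationary_from A m f j c z K)"

text \<open>Regular points: every \<open>G\<^sub>k\<close> has constant rank near the point, so it is a distribution in the
  sense of a subbundle there. The bound \<open>k\<^sub>\<star> \<le> n + |j|\<close> fails at other points: for
  \<open>n = m = 1\<close>, \<open>j = 0\<close> and \<open>f(x,u) = 1 + x\<^sup>2 u\<close> one has \<open>ad\<^sup>k \<partial>/\<partial>u = - a\<^sub>k \<partial>/\<partial>x\<close> with
  \<open>a\<^sub>1 = x\<^sup>2\<close>, \<open>a\<^sub>2 = 2 x\<close>, \<open>a\<^sub>3 = 2 - 2 x\<^sup>2 u\<close>, so that \<open>k\<^sub>\<star> = 3\<close> where \<open>x = 0\<close>, whereas
  \<open>n + |j| = 1\<close>.\<close>

definition regular_point :: "('x, 'n) chart set \<Rightarrow> nat \<Rightarrow> ('x, 'n) dynamics \<Rightarrow> (nat \<Rightarrow> nat)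
    \<Rightarrow> ('x, 'n) chart \<Rightarrow> ('n coord \<Rightarrow> real) \<Rightarrow> bool" where
  "regular_point A m f j c z \<longleftrightarrow>
     (\<forall>k. \<forall>\<^sub>F w in nhds z. fibre_dim (G A m f j k) c w = fibre_dim (G A m f j k) c z)"

end

theory Submission
  imports Defs
begin

text \<open>
  Up to sign, iterating \<open>ad\<close> of \<open>g\<^sub>0\<close> on the derivation along \<open>u\<^sub>p\<close> of order \<open>j\<^sub>p\<close> first runs down the
  derivations along the lower order jets of \<open>u\<^sub>p\<close> and then continues with the iterated brackets of the
  derivation along \<open>u\<^sub>p\<close> itself. The former span \<open>\<Gamma>\<^sub>k\<close>; the latter span \<open>\<Delta>\<^sub>k\<close>, and apart from the
  derivations along the \<open>u\<^sub>p\<close> they only have components along \<open>X\<close>. This gives the direct sum and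
  all the dimension counts. For \<open>G\<^sub>k\<close> to be the module generated by these fields, the Lie derivative
  along \<open>g\<^sub>0\<close> must preserve the ring of smooth functions on the jet manifold, that is, it must be
  independent of the chart; this is the chain rule for the transition maps.

  For the bound on \<open>k\<^sub>\<star>\<close>, let \<open>G\<^sub>k\<close> and \<open>G\<^sub>k\<^sub>+\<^sub>1\<close> coincide, with constant rank, near a point \<open>z\<close>, and let \<open>\<gamma>\<close> be a
  field in \<open>G\<^sub>k\<^sub>+\<^sub>1\<close>. Subtracting from \<open>\<gamma>\<close> a field of \<open>G\<^sub>k\<close> with the same value at \<open>w\<close>, one gets a field
  \<open>\<delta>\<close> that vanishes at \<open>w\<close> and is a combination of a moving frame of \<open>G\<^sub>k\<close>. The coefficients tend to \<open>0\<close>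
  at \<open>w\<close>, hence the derivatives of \<open>\<delta>\<close> at \<open>w\<close> lie in the span of the frame, and so does \<open>[g\<^sub>0, \<delta>]\<close>.
  Therefore \<open>G\<^sub>k\<^sub>+\<^sub>2\<close> coincides with \<open>G\<^sub>k\<^sub>+\<^sub>1\<close> near \<open>z\<close>, and before stationarity every step raises the dimension.
\<close>

section \<open>Smooth functions of finitely many coordinates\<close>

lemma tendsto_coordinatewise:
  fixes f :: "'a \<Rightarrow> 'c \<Rightarrow> real"
  assumes "\<And>b. ((\<lambda>x. f x b) \<longlongrightarrow> l b) F"
  shows "(f \<longlongrightarrow> l) F"
proof -
  have "limitin (product_topology (\<lambda>i. euclidean) UNIV) f l F"
    using assms by (simp add: limitin_componentwise)
  then show ?thesis by (simp add: euclidean_product_topology)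
qed

lemma continuous_fun_upd:
  fixes z :: "'c \<Rightarrow> real"
  shows "continuous_on UNIV (\<lambda>t. z(b := t))"
proof (rule continuous_on_coordinatewise_then_product)
  show "continuous_on UNIV (\<lambda>t. (z(b := t)) i)" for i
    by (cases "i = b") (auto intro: continuous_intros)
qed

text \<open>The line through z in direction b is continuous and passes through z at parameter
  \<open>z b\<close>, so neighbourhoods of z pull back to neighbourhoods of \<open>z b\<close>. This
  passes from open sets of the coordinate space to \<open>partial\<close>, which only sees such
  lines.\<close>

lemma eventually_fun_upd:
  fixes z :: "'c \<Rightarrow> real"
  assumes "eventually P (nhds z)"
  shows "\<forall>\<^sub>F t in nhds (z b). P (z(b := t))"
proof -
  have "isCont (\<lambda>t. z(b := t)) (z b)"
    using continuous_fun_upd[of z b] by (simp add: continuous_on_eq_continuous_at)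
  then have "filterlim (\<lambda>t. z(b := t)) (nhds (z(b := z b))) (nhds (z b))"
    unfolding isCont_def by (simp only: tendsto_at_iff_tendsto_nhds)
  then show ?thesis using assms by (simp add: filterlim_iff)
qed

lemma eventually_fun_upd_open:
  fixes z :: "'c \<Rightarrow> real"
  assumes "open D" "z \<in> D"
  shows "\<forall>\<^sub>F t in nhds (z b). z(b := t) \<in> D"
  using assms by (intro eventually_fun_upd) (simp add: eventually_nhds_in_open)

section \<open>Functions depending only on a given set of coordinates\<close>

definition depends_on :: "'c set \<Rightarrow> ('c \<Rightarrow> real) set \<Rightarrow> (('c \<Rightarrow> real) \<Rightarrow> real) \<Rightarrow> bool" where
  "depends_on I D h \<longleftrightarrow> (\<forall>z\<in>D. \<forall>z'\<in>D. (\<forall>b\<in>I. z b = z' b) \<longrightarrow> h z = h z')"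

lemma depends_onD:
  "depends_on I D h \<Longrightarrow> z \<in> D \<Longrightarrow> z' \<in> D \<Longrightarrow> (\<And>b. b \<in> I \<Longrightarrow> z b = z' b) \<Longrightarrow> h z = h z'"
  unfolding depends_on_def by blast

lemma smooth_fun_alt: "smooth_fun I D h \<longleftrightarrow> depends_on I D h \<and> (\<forall>k. C_diff k I D h)"
  by (simp add: smooth_fun_def depends_on_def)

lemma partial_cong_local:
  assumes "open D" "z \<in> D" "\<And>w. w \<in> D \<Longrightarrow> g w = h w"
  shows "partial b g z = partial b h z"
  unfolding partial_def
  by (rule deriv_cong_ev)
    (use eventually_fun_upd_open[OF assms(1,2), of b] assms(3) in \<open>auto elim!: eventually_mono\<close>)

lemma depends_on_mono: "depends_on I D h \<Longrightarrow> I \<subseteq> I' \<Longrightarrow> depends_on I' D h"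
  unfolding depends_on_def by (meson subsetD)

lemma depends_on_const [simp]: "depends_on I D (\<lambda>z. a)"
  by (simp add: depends_on_def)

lemma depends_on_cong:
  "(\<And>z. z \<in> D \<Longrightarrow> g z = h z) \<Longrightarrow> depends_on I D g \<longleftrightarrow> depends_on I D h"
  by (auto simp: depends_on_def)

lemma depends_on_proj: "b \<in> I \<Longrightarrow> depends_on I D (\<lambda>z. z b)"
  by (simp add: depends_on_def)

lemma depends_on_add: "depends_on I D g \<Longrightarrow> depends_on I D h \<Longrightarrow> depends_on I D (\<lambda>z. g z + h z)"
  and depends_on_diff: "depends_on I D g \<Longrightarrow> depends_on I D h \<Longrightarrow> depends_on I D (\<lambda>z. g z - h z)"
  and depends_on_mult: "depends_on I D g \<Longrightarrow> depends_on I D h \<Longrightarrow> depends_on I D (\<lambda>z. g z * h z)"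
  unfolding depends_on_def by metis+

lemma depends_on_sum:
  "(\<And>i. i \<in> J \<Longrightarrow> depends_on I D (g i)) \<Longrightarrow> depends_on I D (\<lambda>z. \<Sum>i\<in>J. g i z)"
  unfolding depends_on_def by (intro ballI impI sum.cong refl) blast

text \<open>Near z the line in direction b stays in the open set D, and along it only a coordinate
  outside I changes, so h is locally constant there.\<close>

lemma partial_not_depends:
  assumes "depends_on I D h" "open D" "z \<in> D" "b \<notin> I"
  shows "partial b h z = 0"
proof -
  have "\<forall>\<^sub>F t in nhds (z b). h (z(b := t)) = h z"
    using eventually_fun_upd_open[OF assms(2,3), of b]
  proof eventually_elim
    case (elim t)
    show ?case by (rule depends_onD[OF assms(1) elim assms(3)]) (use assms(4) in auto)
  qed
  then show ?thesis unfolding partial_def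
    by (subst deriv_cong_ev[where g = "\<lambda>t. h z"]) auto
qed

text \<open>For b in I, two points that agree on I have the same parameter on their b-lines, and the
  lines agree on I at every parameter. For b outside I the derivative vanishes.\<close>

lemma depends_on_partial:
  assumes "depends_on I D h" "open D"
  shows "depends_on I D (partial b h)"
proof (cases "b \<in> I")
  case True
  show ?thesis unfolding depends_on_def
  proof (intro ballI impI)
    fix z z' assume z: "z \<in> D" "z' \<in> D" and eq: "\<forall>b\<in>I. z b = z' b"
    have zb: "z b = z' b" using eq True by auto
    have "\<forall>\<^sub>F t in nhds (z b). h (z(b := t)) = h (z'(b := t))"
      using eventually_fun_upd_open[OF assms(2) z(1), of b]
        eventually_fun_upd_open[OF assms(2) z(2), of b, folded zb]
    proof eventually_elim
      case (elim t)
      show ?case by (rule depends_onD[OF assms(1) elim]) (use eq in auto)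
    qed
    then show "partial b h z = partial b h z'"
      unfolding partial_def zb by (intro deriv_cong_ev) auto
  qed
next
  case False
  then show ?thesis
    using partial_not_depends[OF assms(1,2)] by (auto simp: depends_on_def)
qed

section \<open>Differentiation along one coordinate\<close>

definition line_differentiable :: "'c \<Rightarrow> (('c \<Rightarrow> real) \<Rightarrow> real) \<Rightarrow> ('c \<Rightarrow> real) \<Rightarrow> bool" where
  "line_differentiable b h z \<longleftrightarrow> (\<lambda>t. h (z(b := t))) differentiable (at (z b))"

lemma line_differentiable_iff_DERIV:
  "line_differentiable b h z \<longleftrightarrow> ((\<lambda>t. h (z(b := t))) has_real_derivative partial b h z) (at (z b))"
  unfolding line_differentiable_def partial_def
  by (metis DERIV_imp_deriv real_differentiable_def)

lemma partialI:
  assumes "((\<lambda>t. h (z(b := t))) has_real_derivative d) (at (z b))"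
  shows "line_differentiable b h z" "partial b h z = d"
  using assms DERIV_imp_deriv real_differentiable_def
  unfolding line_differentiable_def partial_def by blast+

lemma line_differentiable_cong_local:
  assumes "open D" "z \<in> D" "\<And>w. w \<in> D \<Longrightarrow> g w = h w"
  shows "line_differentiable b g z \<longleftrightarrow> line_differentiable b h z"
proof -
  have "\<forall>\<^sub>F t in nhds (z b). g (z(b := t)) = h (z(b := t))"
    using eventually_fun_upd_open[OF assms(1,2), of b]
    by eventually_elim (use assms in auto)
  moreover have p: "partial b g z = partial b h z" by (rule partial_cong_local[OF assms])
  ultimately show ?thesis
    unfolding line_differentiable_iff_DERIV by (intro DERIV_cong_ev) simp_all
qed

lemma partial_add:
  assumes "line_differentiable b g z" "line_differentiable b h z"
  shows "line_differentiable b (\<lambda>z. g z + h z) z"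
    "partial b (\<lambda>z. g z + h z) z = partial b g z + partial b h z"
  using assms[unfolded line_differentiable_iff_DERIV]
  by (auto intro!: partialI derivative_eq_intros)

lemma partial_mult:
  assumes "line_differentiable b g z" "line_differentiable b h z"
  shows "line_differentiable b (\<lambda>z. g z * h z) z"
    "partial b (\<lambda>z. g z * h z) z = partial b g z * h z + g z * partial b h z"
  using assms[unfolded line_differentiable_iff_DERIV]
  by (auto intro!: partialI derivative_eq_intros)

lemma partial_const [simp]: "partial b (\<lambda>z. a) z = 0" "line_differentiable b (\<lambda>z. a) z"
  by (rule partialI[OF DERIV_const])+

lemma partial_proj: "partial b (\<lambda>z. z a) z = (if a = b then 1 else 0)" "line_differentiable b (\<lambda>z. z a) z"
proof -
  have "((\<lambda>t. (z(b := t)) a) has_real_derivative (if a = b then 1 else 0)) (at (z b))"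
    by (cases "a = b") auto
  from partialI[of "\<lambda>z. z a", OF this]
  show "partial b (\<lambda>z. z a) z = (if a = b then 1 else 0)" "line_differentiable b (\<lambda>z. z a) z"
    by blast+
qed

section \<open>The classes C^k\<close>

lemma C_diff_Suc_iff: "C_diff (Suc k) I D h \<longleftrightarrow> continuous_on D h \<and>
     (\<forall>b\<in>I. (\<forall>z\<in>D. line_differentiable b h z) \<and> C_diff k I D (partial b h))"
  by (simp add: line_differentiable_def)

declare C_diff.simps(2) [simp del]

lemma C_diff_cong:
  assumes "open D" "\<And>z. z \<in> D \<Longrightarrow> g z = h z"
  shows "C_diff k I D g \<longleftrightarrow> C_diff k I D h"
  using assms(2)
proof (induction k arbitrary: g h)
  case 0
  then show ?case by (simp cong: continuous_on_cong)
next
  case (Suc k)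
  have "C_diff k I D (partial b g) \<longleftrightarrow> C_diff k I D (partial b h)" for b
    using Suc.prems by (intro Suc.IH partial_cong_local[OF assms(1)]) auto
  moreover have "continuous_on D g \<longleftrightarrow> continuous_on D h"
    using Suc.prems by (simp cong: continuous_on_cong)
  moreover have "(\<forall>z\<in>D. line_differentiable b g z) \<longleftrightarrow> (\<forall>z\<in>D. line_differentiable b h z)" for b
    using Suc.prems by (intro ball_cong line_differentiable_cong_local[OF assms(1)]) auto
  ultimately show ?case by (simp add: C_diff_Suc_iff)
qed

lemma C_diff_SucD: "C_diff (Suc k) I D h \<Longrightarrow> C_diff k I D h"
proof (induction k arbitrary: h)
  case 0
  then show ?case by (simp add: C_diff_Suc_iff)
next
  case (Suc k)
  then show ?case by (subst C_diff_Suc_iff) (auto simp: C_diff_Suc_iff[of "Suc k"])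
qed

lemma C_diff_const: "C_diff k I D (\<lambda>z. a)"
proof (induction k arbitrary: a)
  case (Suc k)
  have "partial b (\<lambda>z. a) = (\<lambda>z. 0)" for b :: 'a
    by auto
  then show ?case using Suc by (simp add: C_diff_Suc_iff)
qed simp

lemma C_diff_proj: "C_diff k I D (\<lambda>z. z a)"
proof (cases k)
  case 0
  then show ?thesis
    by (simp add: continuous_on_product_then_coordinatewise[OF continuous_on_id])
next
  case (Suc l)
  have "partial b (\<lambda>z. z a) = (\<lambda>z. if a = b then 1 else 0)" for b :: 'a
    by (auto simp: partial_proj)
  then show ?thesis using Suc
    by (simp add: C_diff_Suc_iff C_diff_const partial_proj continuous_on_product_then_coordinatewise[OF continuous_on_id])
qed

lemma C_diff_add:
  assumes "open D" "C_diff k I D g" "C_diff k I D h"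
  shows "C_diff k I D (\<lambda>z. g z + h z)"
  using assms(2,3)
proof (induction k arbitrary: g h)
  case 0
  then show ?case by (auto intro: continuous_intros)
next
  case (Suc k)
  have "C_diff k I D (partial b (\<lambda>z. g z + h z))" if "b \<in> I" for b
    using Suc that
    by (subst C_diff_cong[OF assms(1), where h = "\<lambda>z. partial b g z + partial b h z"])
      (auto simp: C_diff_Suc_iff partial_add)
  then show ?case using Suc.prems
    by (auto simp: C_diff_Suc_iff partial_add intro: continuous_intros)
qed

text \<open>Each term of the product rule keeps one factor undifferentiated. That factor has class k
  + 1 and must be lowered to class k, through \<open>C_diff_SucD\<close>, before the induction
  hypothesis applies.\<close>

lemma C_diff_mult:
  assumes "open D" "C_diff k I D g" "C_diff k I D h"
  shows "C_diff k I D (\<lambda>z. g z * h z)"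
  using assms(2,3)
proof (induction k arbitrary: g h)
  case 0
  then show ?case by (auto intro: continuous_intros)
next
  case (Suc k)
  have "C_diff k I D (partial b (\<lambda>z. g z * h z))" if "b \<in> I" for b
  proof (subst C_diff_cong[OF assms(1), where h = "\<lambda>z. partial b g z * h z + g z * partial b h z"])
    show "C_diff k I D (\<lambda>z. partial b g z * h z + g z * partial b h z)"
      using Suc.prems that C_diff_SucD[OF Suc.prems(1)] C_diff_SucD[OF Suc.prems(2)]
      by (intro C_diff_add[OF assms(1)] Suc.IH) (auto simp: C_diff_Suc_iff)
  qed (use Suc.prems that in \<open>auto simp: C_diff_Suc_iff partial_mult\<close>)
  then show ?case using Suc.prems
    by (auto simp: C_diff_Suc_iff partial_mult intro: continuous_intros)
qed

section \<open>Closure properties of smooth functions\<close>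

lemma smooth_fun_cong:
  assumes "open D" "\<And>z. z \<in> D \<Longrightarrow> g z = h z"
  shows "smooth_fun I D g \<longleftrightarrow> smooth_fun I D h"
proof -
  have "depends_on I D g \<longleftrightarrow> depends_on I D h" by (rule depends_on_cong) (rule assms(2))
  moreover have "C_diff k I D g \<longleftrightarrow> C_diff k I D h" for k
    by (rule C_diff_cong[OF assms(1)]) (rule assms(2))
  ultimately show ?thesis by (simp add: smooth_fun_alt)
qed

lemma smooth_fun_const: "smooth_fun I D (\<lambda>z. a)"
  by (simp add: smooth_fun_alt C_diff_const)

lemma smooth_fun_proj: "b \<in> I \<Longrightarrow> smooth_fun I D (\<lambda>z. z b)"
  by (simp add: smooth_fun_alt C_diff_proj depends_on_proj)

lemma smooth_fun_add:
  "open D \<Longrightarrow> smooth_fun I D g \<Longrightarrow> smooth_fun I D h \<Longrightarrow> smooth_fun I D (\<lambda>z. g z + h z)"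
  by (simp add: smooth_fun_alt C_diff_add depends_on_add)

lemma smooth_fun_mult:
  "open D \<Longrightarrow> smooth_fun I D g \<Longrightarrow> smooth_fun I D h \<Longrightarrow> smooth_fun I D (\<lambda>z. g z * h z)"
  by (simp add: smooth_fun_alt C_diff_mult depends_on_mult)

lemma smooth_fun_diff:
  assumes "open D" "smooth_fun I D g" "smooth_fun I D h"
  shows "smooth_fun I D (\<lambda>z. g z - h z)"
  using smooth_fun_add[OF assms(1,2) smooth_fun_mult[OF assms(1) smooth_fun_const[of I D "-1"] assms(3)]]
  by simp

lemma smooth_fun_sum:
  assumes "open D" "\<And>i. i \<in> J \<Longrightarrow> smooth_fun I D (g i)"
  shows "smooth_fun I D (\<lambda>z. \<Sum>i\<in>J. g i z)"
  using assms(2)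
  by (induction J rule: infinite_finite_induct) (auto simp: smooth_fun_const smooth_fun_add[OF assms(1)])

lemma C_diff_partial:
  assumes "C_diff (Suc k) I D h" "b \<in> I"
  shows "C_diff k I D (partial b h)"
  using assms by (simp add: C_diff_Suc_iff)

text \<open>\<open>C_diff\<close> only controls the derivatives along I. Along any other coordinate
  the derivative is zero on D, since the function does not depend on that coordinate; hence b may be
  arbitrary.\<close>

lemma smooth_fun_partial:
  assumes "open D" "smooth_fun I D h"
  shows "smooth_fun I D (partial b h)"
proof (cases "b \<in> I")
  case True
  then show ?thesis
    using assms by (auto simp: smooth_fun_alt depends_on_partial intro: C_diff_partial)
next
  case False
  have "partial b h z = 0" if "z \<in> D" for z
    by (rule partial_not_depends[OF _ assms(1) that False]) (use assms(2) in \<open>simp add: smooth_fun_alt\<close>)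
  then show ?thesis
    using smooth_fun_cong[OF assms(1), of "partial b h" "\<lambda>z. 0"] by (simp add: smooth_fun_const)
qed

lemma smooth_fun_line_differentiable:
  assumes "open D" "smooth_fun I D h" "z \<in> D"
  shows "line_differentiable b h z"
proof (cases "b \<in> I")
  case True
  then have "C_diff (Suc 0) I D h" using assms(2) unfolding smooth_fun_alt by blast
  then show ?thesis using True assms(3) by (simp add: C_diff_Suc_iff)
next
  case False
  have dep: "depends_on I D h" using assms(2) by (simp add: smooth_fun_alt)
  have "\<forall>\<^sub>F t in nhds (z b). h (z(b := t)) = h z"
    using eventually_fun_upd_open[OF assms(1,3), of b]
  proof eventually_elim
    case (elim t)
    show ?case by (rule depends_onD[OF dep elim assms(3)]) (use False in auto)
  qed
  then have "((\<lambda>t. h (z(b := t))) has_real_derivative 0) (at (z b))"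
    by (subst DERIV_cong_ev[where g = "\<lambda>t. h z"]) auto
  then show ?thesis by (rule partialI)
qed

lemma smooth_fun_continuous_on: "smooth_fun I D h \<Longrightarrow> continuous_on D h"
  by (meson C_diff.simps(1) smooth_fun_alt)

text \<open>The derivatives along the added coordinates vanish. The induction runs over all
  functions smooth for I, because each partial derivative, in an old or a new direction, is again of
  this kind. It serves to pull the dynamics back from X \<times> R^m to the higher jets.\<close>

lemma smooth_fun_mono:
  assumes "open D" "smooth_fun I D h" "I \<subseteq> I'"
  shows "smooth_fun I' D h"
proof -
  have "C_diff k I' D g" if "smooth_fun I D g" for k g
    using that
  proof (induction k arbitrary: g)
    case 0
    then show ?case by (simp add: smooth_fun_continuous_on)
  next
    case (Suc k)
    then show ?case
      by (simp add: C_diff_Suc_iff smooth_fun_continuous_on smooth_fun_partial[OF assms(1)]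
          smooth_fun_line_differentiable[OF assms(1)])
  qed
  then show ?thesis
    using assms depends_on_mono[of I D h I'] by (simp add: smooth_fun_alt)
qed

text \<open>Convergence along this product filter is convergence uniform in the second argument. The
  chain rule uses it for mean value points about which only membership in [0,1] is known.\<close>

lemma eventually_prod_principal_iff:
  "eventually P (F \<times>\<^sub>F principal S) \<longleftrightarrow> (\<forall>\<^sub>F x in F. \<forall>y\<in>S. P (x, y))"
  unfolding eventually_prod_filter eventually_principal
proof (intro iffI; (elim exE conjE)?)
  fix Pf Pg assume "eventually Pf F" "\<forall>y\<in>S. Pg y" "\<forall>x y. Pf x \<longrightarrow> Pg y \<longrightarrow> P (x, y)"
  then show "\<forall>\<^sub>F x in F. \<forall>y\<in>S. P (x, y)" by (auto elim: eventually_mono)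
next
  assume "\<forall>\<^sub>F x in F. \<forall>y\<in>S. P (x, y)"
  then show "\<exists>Pf Pg. eventually Pf F \<and> (\<forall>y\<in>S. Pg y) \<and> (\<forall>x y. Pf x \<longrightarrow> Pg y \<longrightarrow> P (x, y))"
    by (intro exI[where x = "\<lambda>x. \<forall>y\<in>S. P (x, y)"] exI[where x = "\<lambda>y. y \<in> S"]) auto
qed

text \<open>Changing one coordinate at a time reduces the chain rule to the mean value theorem and the
  continuity of the partial derivatives.\<close>

lemma smooth_fun_chain:
  fixes w :: "real \<Rightarrow> 'c \<Rightarrow> real"
  assumes D: "open D" and h: "smooth_fun I D h" and "finite J"
    and w: "\<And>b. b \<in> J \<Longrightarrow> ((\<lambda>t. w t b) has_real_derivative w' b) (at s)"
    and const: "\<And>b t. b \<notin> J \<Longrightarrow> w t b = w s b"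
    and s: "w s \<in> D"
  shows "((\<lambda>t. h (w t)) has_real_derivative (\<Sum>b\<in>J. w' b * partial b h (w s))) (at s)"
  using \<open>finite J\<close> w const s
proof (induction J arbitrary: w rule: finite_induct)
  case empty
  have "w t = w s" for t
    by (rule ext) (rule empty.prems(2), simp)
  then have "h (w t) = h (w s)" for t
    by (rule arg_cong)
  then have "(\<lambda>t. h (w t)) = (\<lambda>t. h (w s))"
    by (rule ext)
  then show ?case by simp
next
  case (insert b J)
  \<comment> \<open>Freezing coordinate b gives a curve moving only in J, to which the induction
    hypothesis applies; the difference \<open>h (w t) - h (v t)\<close> is then a one-variable
    increment.\<close>
  define v where "v t = (w t)(b := w s b)" for t
  have vs: "v s = w s" by (simp add: v_def)
  have IH: "((\<lambda>t. h (v t)) has_real_derivative (\<Sum>b\<in>J. w' b * partial b h (v s))) (at s)"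
  proof (rule insert.IH)
    show "((\<lambda>t. v t b') has_real_derivative w' b') (at s)" if "b' \<in> J" for b'
    proof -
      have "b' \<noteq> b" using that insert.hyps by auto
      then show ?thesis using insert.prems(1)[of b'] that by (simp add: v_def)
    qed
    show "v t b' = v s b'" if "b' \<notin> J" for b' t
      using insert.prems(2)[of b' t] that by (cases "b' = b") (simp_all add: v_def)
  qed (use insert.prems vs in simp)
  \<comment> \<open>For fixed t this is the segment in direction b from \<open>v t\<close> at r = 0
    to \<open>w t\<close> at r = 1.\<close>
  define q where "q t r = (w t)(b := w s b + r * (w t b - w s b))" for t r
  have tw: "((\<lambda>t. w t a) \<longlongrightarrow> w s a) (at s)" for a
  proof (cases "a \<in> insert b J")
    case True
    then show ?thesis using DERIV_isCont[OF insert.prems(1)[OF True]] by (simp add: isCont_def)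
  next
    case False
    then have "(\<lambda>t. w t a) = (\<lambda>t. w s a)" using insert.prems(2) by blast
    then show ?thesis by simp
  qed
  have q: "((\<lambda>x. q (fst x) (snd x)) \<longlongrightarrow> w s) (at s \<times>\<^sub>F principal {0..1})"
  proof (rule tendsto_coordinatewise)
    fix a
    show "((\<lambda>x. q (fst x) (snd x) a) \<longlongrightarrow> w s a) (at s \<times>\<^sub>F principal {0..1})"
    proof (cases "a = b")
      case True
      have "((\<lambda>x. w (fst x) b) \<longlongrightarrow> w s b) (at s \<times>\<^sub>F principal {0..1})"
        by (rule filterlim_compose[OF tw filterlim_fst])
      then have z: "((\<lambda>x. w (fst x) b - w s b) \<longlongrightarrow> 0) (at s \<times>\<^sub>F principal {0..1::real})"
        by (simp add: LIM_zero_iff)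
      have "((\<lambda>x. snd x * (w (fst x) b - w s b)) \<longlongrightarrow> 0) (at s \<times>\<^sub>F principal {0..1})"
      proof (rule Lim_null_comparison[OF _ tendsto_norm_zero[OF z]])
        show "\<forall>\<^sub>F x in at s \<times>\<^sub>F principal {0..1}.
            norm (snd x * (w (fst x) b - w s b)) \<le> norm (w (fst x) b - w s b)"
          unfolding eventually_prod_principal_iff
          by (auto simp: abs_mult intro!: mult_left_le_one_le always_eventually)
      qed
      then show ?thesis using True tendsto_add[OF tendsto_const] by (fastforce simp: q_def)
    next
      case False
      then show ?thesis using filterlim_compose[OF tw filterlim_fst] by (simp add: q_def)
    qed
  qed
  have qD: "\<forall>\<^sub>F t in at s. \<forall>r\<in>{0..1}. q t r \<in> D"
    using topological_tendstoD[OF q D insert.prems(3)]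
    by (simp add: eventually_prod_principal_iff)
  have "continuous_on D (partial b h)"
    by (rule smooth_fun_continuous_on[OF smooth_fun_partial[OF D h]])
  then have lim: "((\<lambda>x. partial b h (q (fst x) (snd x))) \<longlongrightarrow> partial b h (w s)) (at s \<times>\<^sub>F principal {0..1})"
    by (rule continuous_on_tendsto_compose[OF _ q insert.prems(3)])
      (use qD in \<open>simp add: eventually_prod_principal_iff\<close>)
  have mvt: "\<forall>\<^sub>F t in at s. \<exists>r\<in>{0..1}. h (w t) - h (v t) = (w t b - w s b) * partial b h (q t r)"
    using qD
  proof eventually_elim
    case (elim t)
    have d: "((\<lambda>r. h (q t r)) has_real_derivative partial b h (q t r) * (w t b - w s b)) (at r)"
      if "r \<in> {0..1}" for r
    proof -
      have ld: "line_differentiable b h (q t r)"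
        using smooth_fun_line_differentiable[OF D h, of "q t r" b] elim that by simp
      have eq: "(q t r)(b := x) = (w t)(b := x)" for x by (simp add: q_def)
      have "((\<lambda>x. h ((w t)(b := x))) has_real_derivative partial b h (q t r)) (at (w s b + r * (w t b - w s b)))"
        using ld[unfolded line_differentiable_iff_DERIV eq] by (simp add: q_def)
      moreover have "((\<lambda>r. w s b + r * (w t b - w s b)) has_real_derivative w t b - w s b) (at r)"
        by (auto intro!: derivative_eq_intros)
      ultimately show ?thesis
        unfolding q_def by (rule DERIV_chain2[where f = "\<lambda>x. h ((w t)(b := x))"])
    qed
    have "\<exists>r. 0 < r \<and> r < 1 \<and> h (q t 1) - h (q t 0) = (1 - 0) * (partial b h (q t r) * (w t b - w s b))"
      by (rule MVT2) (use d in auto)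
    moreover have "q t 1 = w t" "q t 0 = v t" by (auto simp: q_def v_def)
    ultimately show ?case by (force simp: mult.commute)
  qed
  have quot: "((\<lambda>t. (w t b - w s b) / (t - s)) \<longlongrightarrow> w' b) (at s)"
    using insert.prems(1)[of b] by (simp add: has_field_derivative_iff)
  \<comment> \<open>A mean value point for each t. It need not converge as t tends to s, but
    \<open>lim\<close> is uniform in r and applies to any choice in [0,1].\<close>
  define \<rho> where "\<rho> t =
    (SOME r. r \<in> {0..1} \<and> h (w t) - h (v t) = (w t b - w s b) * partial b h (q t r))" for t
  have \<rho>: "\<forall>\<^sub>F t in at s. \<rho> t \<in> {0..1} \<and> h (w t) - h (v t) = (w t b - w s b) * partial b h (q t (\<rho> t))"
    using mvt
  proof eventually_elim
    case (elim t)
    then show ?case unfolding \<rho>_def Bex_def by (rule someI_ex)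
  qed
  have "((\<lambda>t. partial b h (q t (\<rho> t))) \<longlongrightarrow> partial b h (w s)) (at s)"
  proof -
    have "filterlim (\<lambda>t. (t, \<rho> t)) (at s \<times>\<^sub>F principal {0..1}) (at s)"
      using \<rho> by (intro filterlim_Pair filterlim_ident) (auto simp: filterlim_principal elim: eventually_mono)
    from filterlim_compose[OF lim this] show ?thesis by simp
  qed
  from tendsto_mult[OF quot this]
  have "((\<lambda>t. (h (w t) - h (v t)) / (t - s)) \<longlongrightarrow> w' b * partial b h (w s)) (at s)"
    by (rule Lim_transform_eventually) (use \<rho> in \<open>auto elim: eventually_mono\<close>)
  then have "((\<lambda>t. h (w t) - h (v t)) has_real_derivative w' b * partial b h (w s)) (at s)"
    by (simp add: has_field_derivative_iff vs)
  from DERIV_add[OF this IH] show ?case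
    using insert.hyps by (simp add: vs)
qed

section \<open>Smooth vector fields and modules\<close>

text \<open>The coordinates of a jet in the chart c: over the chart domain, the inverse of
  \<open>jet_point c\<close>.\<close>

definition jet_lift :: "('x, 'n) chart \<Rightarrow> 'x \<times> (nat \<Rightarrow> nat \<Rightarrow> real) \<Rightarrow> 'n coord \<Rightarrow> real" where
  "jet_lift c q a = (case a of Xc i \<Rightarrow> snd c (fst q) i | Uc p r \<Rightarrow> snd q p r)"

lemma jet_lift_simps [simp]:
  "jet_lift c q (Xc i) = snd c (fst q) i" "jet_lift c q (Uc p r) = snd q p r"
  by (simp_all add: jet_lift_def)

text \<open>The components in different charts are separate data here. The charts are tied together
  only by the coefficients of modules, which are functions on the jet manifold itself.\<close>

definition smooth_vfield ::
  "('x, 'n) chart set \<Rightarrow> nat \<Rightarrow> (nat \<Rightarrow> nat) \<Rightarrow> ('x, 'n) vfield \<Rightarrow> bool" where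
  "smooth_vfield A m j \<gamma> \<longleftrightarrow>
     (\<forall>c z a. z \<notin> jet_dom A c \<or> a \<notin> jet_coords m j \<longrightarrow> \<gamma> c z a = 0) \<and>
     (\<forall>c a. smooth_fun (jet_coords m j) (jet_dom A c) (\<lambda>z. \<gamma> c z a))"

definition smul ::
  "('x \<times> (nat \<Rightarrow> nat \<Rightarrow> real) \<Rightarrow> real) \<Rightarrow> ('x, 'n) vfield \<Rightarrow> ('x, 'n) vfield" where
  "smul h \<gamma> = (\<lambda>c z a. h (jet_point c z) * \<gamma> c z a)"

definition lie_in_chart :: "('x, 'n) chart set \<Rightarrow> nat \<Rightarrow> ('x, 'n) dynamics \<Rightarrow> (nat \<Rightarrow> nat)
    \<Rightarrow> ('x, 'n) chart \<Rightarrow> ('x \<times> (nat \<Rightarrow> nat \<Rightarrow> real) \<Rightarrow> real) \<Rightarrow> ('n coord \<Rightarrow> real) \<Rightarrow> real" where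
  "lie_in_chart A m f j c h z =
     (\<Sum>b\<in>jet_coords m j. g0 A m f j c z b * partial b (\<lambda>w. h (jet_point c w)) z)"

text \<open>The Lie derivative along \<open>g0\<close> as a function on the jet manifold. The chart
  around the base point is chosen arbitrarily; \<open>lie_chart_independent\<close> shows that the
  value does not depend on this choice.\<close>

definition lie :: "('x, 'n) chart set \<Rightarrow> nat \<Rightarrow> ('x, 'n) dynamics \<Rightarrow> (nat \<Rightarrow> nat)
    \<Rightarrow> ('x \<times> (nat \<Rightarrow> nat \<Rightarrow> real) \<Rightarrow> real) \<Rightarrow> 'x \<times> (nat \<Rightarrow> nat \<Rightarrow> real) \<Rightarrow> real" where
  "lie A m f j h q =
     (let c = SOME c. c \<in> A \<and> fst q \<in> fst c in lie_in_chart A m f j c h (jet_lift c q))"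

lemma Xc_in_jet_coords [simp]: "Xc i \<in> jet_coords m j"
  by (simp add: jet_coords_def)

lemma Uc_in_jet_coords [simp]: "Uc p r \<in> jet_coords m j \<longleftrightarrow> p \<in> {1..m} \<and> r \<le> j p"
  by (auto simp: jet_coords_def)

lemma jet_coords_alt: "jet_coords m j = range Xc \<union> (\<lambda>(p, r). Uc p r) ` (SIGMA p:{1..m}. {..j p})"
  by (force simp: jet_coords_def)

lemma finite_jet_coords [simp]: "finite (jet_coords m j :: 'n::finite coord set)"
  unfolding jet_coords_alt by (intro finite_UnI finite_imageI finite_SigmaI) auto

lemma sum_jet_coords:
  "(\<Sum>b\<in>jet_coords m j. F b) =
     (\<Sum>i\<in>UNIV. F (Xc (i :: 'n::finite))) + (\<Sum>p\<in>{1..m}. \<Sum>r\<in>{..j p}. F (Uc p r))"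
proof -
  have "(\<Sum>b\<in>jet_coords m j. F b) =
      sum F (range Xc) + sum F ((\<lambda>(p, r). Uc p r) ` (SIGMA p:{1..m}. {..j p}))"
    unfolding jet_coords_alt by (rule sum.union_disjoint) auto
  also have "sum F (range Xc) = (\<Sum>i\<in>UNIV. F (Xc i))"
    by (subst sum.reindex) (auto simp: inj_on_def)
  also have "sum F ((\<lambda>(p, r). Uc p r) ` (SIGMA p:{1..m}. {..j p})) =
      (\<Sum>(p, r)\<in>(SIGMA p:{1..m}. {..j p}). F (Uc p r))"
    by (subst sum.reindex) (auto simp: inj_on_def split_def)
  also have "\<dots> = (\<Sum>p\<in>{1..m}. \<Sum>r\<in>{..j p}. F (Uc p r))"
    by (rule sum.Sigma[symmetric]) auto
  finally show ?thesis .
qed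

lemma smooth_fun_empty: "smooth_fun I {} h"
  using smooth_fun_cong[of "{}" h "\<lambda>z. 0" I] by (simp add: smooth_fun_const)

section \<open>Charts, transition maps and the Lie derivative along \<open>g0\<close>\<close>

locale jet_system =
  fixes A :: "('x::{t2_space,second_countable_topology}, 'n::finite) chart set"
    and m :: nat
    and f :: "('x, 'n) dynamics"
  assumes atlas: "smooth_atlas A"
    and system: "control_system A m f"
begin

lemma chart_homeomorphism:
  "c \<in> A \<Longrightarrow> homeomorphism (fst c) (snd c ` fst c) (snd c) (inv_into (fst c) (snd c))"
  using atlas unfolding smooth_atlas_def by (cases c) auto

lemma open_chart_image: "c \<in> A \<Longrightarrow> open (snd c ` fst c)"
  using atlas unfolding smooth_atlas_def by (cases c) auto

lemma open_chart: "c \<in> A \<Longrightarrow> open (fst c)"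
  using atlas unfolding smooth_atlas_def by (cases c) auto

lemma smooth_transition:
  "c \<in> A \<Longrightarrow> d \<in> A \<Longrightarrow>
    smooth_fun UNIV (snd c ` (fst c \<inter> fst d)) (\<lambda>y. snd d (inv_into (fst c) (snd c) y) i)"
  using atlas unfolding smooth_atlas_def by (cases c; cases d) force

lemma chart_cover: "\<exists>c\<in>A. x \<in> fst c"
proof -
  have "x \<in> (\<Union>(U, \<phi>)\<in>A. U)" using atlas unfolding smooth_atlas_def by simp
  then show ?thesis by force
qed

lemma inv_chart: "c \<in> A \<Longrightarrow> x \<in> fst c \<Longrightarrow> inv_into (fst c) (snd c) (snd c x) = x"
  using chart_homeomorphism unfolding homeomorphism_def by blast

lemma open_transition_domain:
  assumes "c \<in> A" "d \<in> A"
  shows "open (snd c ` (fst c \<inter> fst d))"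
proof -
  have "openin (top_of_set (fst c)) (fst c \<inter> fst d)"
    using open_chart[OF assms(2)] by (simp add: openin_open_Int)
  from homeomorphism_imp_open_map[OF chart_homeomorphism[OF assms(1)] this]
  show ?thesis using open_chart_image[OF assms(1)] by (rule openin_open_trans)
qed

lemma dynamics_transition:
  assumes "c \<in> A" "d \<in> A" "x \<in> fst c \<inter> fst d"
  shows "f d (snd d x) u i =
    (\<Sum>k\<in>UNIV. partial k (\<lambda>y. snd d (inv_into (fst c) (snd c) y) i) (snd c x) * f c (snd c x) u k)"
proof -
  obtain U \<phi> V \<psi> where eq: "c = (U, \<phi>)" "d = (V, \<psi>)" by (cases c; cases d)
  have "\<forall>(U, \<phi>)\<in>A. \<forall>(V, \<psi>)\<in>A. \<forall>x\<in>U \<inter> V. \<forall>u i. f (V, \<psi>) (\<psi> x) u i =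
      (\<Sum>k\<in>UNIV. partial k (\<lambda>y. \<psi> (inv_into U \<phi> y) i) (\<phi> x) * f (U, \<phi>) (\<phi> x) u k)"
    using system unfolding control_system_def by (rule conjunct2)
  from bspec[OF this assms(1), unfolded eq, simplified, THEN bspec, OF assms(2)[unfolded eq]]
  show ?thesis using assms(3) by (simp add: eq)
qed

lemma continuous_on_Xc: "continuous_on UNIV (\<lambda>z i. z (Xc i) :: real)"
  by (intro continuous_on_coordinatewise_then_product continuous_on_product_coordinates)

lemma open_jet_dom [simp]: "open (jet_dom A c)"
proof (cases "c \<in> A")
  case True
  then have "jet_dom A c = (\<lambda>z i. z (Xc i)) -` (snd c ` fst c)"
    by (auto simp: jet_dom_def)
  then show ?thesis
    using open_vimage[OF open_chart_image[OF True] continuous_on_Xc] by simp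
next
  case False
  then show ?thesis by (simp add: jet_dom_def)
qed

lemma jet_domD: "z \<in> jet_dom A c \<Longrightarrow> c \<in> A"
  by (simp add: jet_dom_def)

lemma jet_dom_empty: "c \<notin> A \<Longrightarrow> jet_dom A c = {}"
  by (simp add: jet_dom_def)

lemma fst_jet_point: "z \<in> jet_dom A c \<Longrightarrow> fst (jet_point c z) \<in> fst c"
  by (auto simp: jet_dom_def jet_point_def intro: inv_into_into)

lemma chart_jet_point: "z \<in> jet_dom A c \<Longrightarrow> snd c (fst (jet_point c z)) i = z (Xc i)"
  by (auto simp: jet_dom_def jet_point_def f_inv_into_f)

lemma jet_point_lift: "c \<in> A \<Longrightarrow> fst q \<in> fst c \<Longrightarrow> jet_point c (jet_lift c q) = q"
  by (cases q) (simp add: jet_point_def inv_chart)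

lemma jet_lift_in_dom: "c \<in> A \<Longrightarrow> fst q \<in> fst c \<Longrightarrow> jet_lift c q \<in> jet_dom A c"
  by (simp add: jet_dom_def)

lemma smooth_g0: "smooth_fun (jet_coords m j) (jet_dom A c) (\<lambda>z. g0 A m f j c z a)"
proof (cases "c \<in> A")
  case True
  show ?thesis
  proof (cases a)
    case (Xc i)
    have "jet_coords m (\<lambda>p. 0) \<subseteq> (jet_coords m j :: 'n coord set)"
      by (auto simp: jet_coords_def)
    moreover have "smooth_fun (jet_coords m (\<lambda>p. 0)) (jet_dom A c)
        (\<lambda>z. f c (\<lambda>k. z (Xc k)) (\<lambda>p. z (Uc p 0)) i)"
      using system True unfolding control_system_def by blast
    ultimately have "smooth_fun (jet_coords m j) (jet_dom A c)
        (\<lambda>z. f c (\<lambda>k. z (Xc k)) (\<lambda>p. z (Uc p 0)) i)"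
      by (rule smooth_fun_mono[OF open_jet_dom, rotated])
    then show ?thesis
      by (subst smooth_fun_cong[OF open_jet_dom]) (auto simp: Xc g0_def)
  next
    case (Uc p k)
    show ?thesis
    proof (cases "p \<in> {1..m} \<and> k < j p")
      case True
      then have "smooth_fun (jet_coords m j) (jet_dom A c) (\<lambda>z. z (Uc p (Suc k)))"
        by (intro smooth_fun_proj) auto
      then show ?thesis using True
        by (subst smooth_fun_cong[OF open_jet_dom]) (auto simp: Uc g0_def)
    next
      case False
      then show ?thesis
        by (subst smooth_fun_cong[OF open_jet_dom, where h = "\<lambda>z. 0"])
          (auto simp: Uc g0_def smooth_fun_const)
    qed
  qed
next
  case False
  then show ?thesis by (simp add: jet_dom_empty smooth_fun_empty)
qed

lemma smooth_jet_funsD: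
  "h \<in> smooth_jet_funs A m j \<Longrightarrow>
    smooth_fun (jet_coords m j) (jet_dom A c) (\<lambda>z. h (jet_point c z))"
  by (cases "c \<in> A") (auto simp: smooth_jet_funs_def jet_dom_empty smooth_fun_empty)

lemma smooth_jet_funs_const: "(\<lambda>q. r) \<in> smooth_jet_funs A m j"
  by (simp add: smooth_jet_funs_def smooth_fun_const)

lemma smooth_jet_funs_add:
  "g \<in> smooth_jet_funs A m j \<Longrightarrow> h \<in> smooth_jet_funs A m j \<Longrightarrow>
    (\<lambda>q. g q + h q) \<in> smooth_jet_funs A m j"
  by (simp add: smooth_jet_funs_def smooth_fun_add)

lemma smooth_jet_funs_mult:
  "g \<in> smooth_jet_funs A m j \<Longrightarrow> h \<in> smooth_jet_funs A m j \<Longrightarrow>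
    (\<lambda>q. g q * h q) \<in> smooth_jet_funs A m j"
  by (simp add: smooth_jet_funs_def smooth_fun_mult)

text \<open>In chart c the function is H composed with the transition map. By the chain rule its
  x-derivatives acquire the Jacobian of that map, while its u-derivatives are unchanged. The
  x-components of \<open>g0\<close> transform by the same Jacobian, so the two sums agree after
  exchanging the order of summation.\<close>

lemma lie_chart_independent:
  assumes h: "h \<in> smooth_jet_funs A m j" and d: "d \<in> A"
    and z: "z \<in> jet_dom A c" and zd: "fst (jet_point c z) \<in> fst d"
  shows "lie_in_chart A m f j c h z = lie_in_chart A m f j d h (jet_lift d (jet_point c z))"
proof -
  have c: "c \<in> A" using z by (rule jet_domD)
  define \<theta> where "\<theta> w = jet_lift d (jet_point c w)" for w
  define H where "H w = h (jet_point d w)" for w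
  define \<tau> where "\<tau> i y = snd d (inv_into (fst c) (snd c) y) i" for i and y :: "'n \<Rightarrow> real"
  define W where "W = snd c ` (fst c \<inter> fst d)"
  \<comment> \<open>The points whose base point lies in both charts. On this open set
    \<open>h\<close> factors through the transition \<theta>, so derivatives at z can be computed
    from the factorization.\<close>
  define N where "N = (\<lambda>w i. w (Xc i)) -` W"
  define x where "x = (\<lambda>i. z (Xc i))"
  have openW: "open W" unfolding W_def using c d by (rule open_transition_domain)
  have openN: "open N" unfolding N_def by (rule open_vimage[OF openW continuous_on_Xc])
  have \<theta>_Xc: "\<theta> w (Xc i) = \<tau> i (\<lambda>i. w (Xc i))" and \<theta>_Uc: "\<theta> w (Uc p r) = w (Uc p r)" for w i p r
    by (simp_all add: \<theta>_def \<tau>_def jet_point_def)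
  have xW: "x \<in> W"
  proof -
    have "x = snd c (fst (jet_point c z))"
      using chart_jet_point[OF z] by (auto simp: x_def)
    then show ?thesis using zd fst_jet_point[OF z] by (simp add: W_def)
  qed
  then have zN: "z \<in> N" by (simp add: N_def x_def)
  have hH: "h (jet_point c w) = H (\<theta> w)" if "w \<in> N" for w
  proof -
    from that obtain y where y: "y \<in> fst c" "y \<in> fst d" "(\<lambda>i. w (Xc i)) = snd c y"
      by (auto simp: N_def W_def)
    then have "fst (jet_point c w) = y" by (simp add: jet_point_def inv_chart c)
    then show ?thesis using y d by (simp add: H_def \<theta>_def jet_point_lift)
  qed
  have smoothH: "smooth_fun (jet_coords m j) (jet_dom A d) H"
    unfolding H_def using h by (rule smooth_jet_funsD)
  have \<theta>z: "\<theta> z \<in> jet_dom A d" unfolding \<theta>_def using d zd by (rule jet_lift_in_dom)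
  have partial_U: "partial (Uc p r) (\<lambda>w. h (jet_point c w)) z = partial (Uc p r) H (\<theta> z)" for p r
  proof -
    have "partial (Uc p r) (\<lambda>w. h (jet_point c w)) z = partial (Uc p r) (\<lambda>w. H (\<theta> w)) z"
      using hH by (rule partial_cong_local[OF openN zN])
    moreover have "\<theta> (z(Uc p r := t)) = (\<theta> z)(Uc p r := t)" for t
    proof
      fix a show "\<theta> (z(Uc p r := t)) a = ((\<theta> z)(Uc p r := t)) a"
        by (cases a) (auto simp: \<theta>_Xc \<theta>_Uc)
    qed
    ultimately show ?thesis by (simp add: partial_def \<theta>_Uc)
  qed
  have partial_X: "partial (Xc k) (\<lambda>w. h (jet_point c w)) z =
      (\<Sum>i\<in>UNIV. partial k (\<tau> i) x * partial (Xc i) H (\<theta> z))" for k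
  proof -
    have "partial (Xc k) (\<lambda>w. h (jet_point c w)) z = partial (Xc k) (\<lambda>w. H (\<theta> w)) z"
      using hH by (rule partial_cong_local[OF openN zN])
    \<comment> \<open>Moving one x-coordinate in chart c may move every x-coordinate in chart d but
      no u-coordinate; hence the chain rule is applied with the moving coordinates
      \<open>range Xc\<close>.\<close>
    moreover have "((\<lambda>t. H (\<theta> (z(Xc k := t)))) has_real_derivative
        (\<Sum>b\<in>range Xc. (case b of Xc i \<Rightarrow> partial k (\<tau> i) x | Uc p r \<Rightarrow> 0)
           * partial b H (\<theta> (z(Xc k := z (Xc k)))))) (at (z (Xc k)))"
    proof (rule smooth_fun_chain[OF open_jet_dom smoothH])
      fix b :: "'n coord" assume "b \<in> range Xc"
      then obtain i where b: "b = Xc i" by auto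
      have "smooth_fun UNIV W (\<tau> i)"
        unfolding W_def \<tau>_def using c d by (rule smooth_transition)
      then have "line_differentiable k (\<tau> i) x"
        by (rule smooth_fun_line_differentiable[OF openW _ xW])
      moreover have "(\<lambda>ka. (z(Xc k := t)) (Xc ka)) = x(k := t)" for t
        by (auto simp: x_def)
      ultimately show "((\<lambda>t. \<theta> (z(Xc k := t)) b) has_real_derivative
          (case b of Xc i \<Rightarrow> partial k (\<tau> i) x | Uc p r \<Rightarrow> 0)) (at (z (Xc k)))"
        unfolding b \<theta>_Xc line_differentiable_iff_DERIV by (simp add: x_def)
    next
      fix b :: "'n coord" and t assume "b \<notin> range Xc"
      then show "\<theta> (z(Xc k := t)) b = \<theta> (z(Xc k := z (Xc k))) b"
        by (cases b) (auto simp: \<theta>_Uc)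
    qed (use \<theta>z in auto)
    ultimately show ?thesis
      by (simp add: partial_def[of "Xc k" "\<lambda>w. H (\<theta> w)"] DERIV_imp_deriv sum.reindex inj_on_def)
  qed
  have fd: "f d (\<lambda>i. \<theta> z (Xc i)) u i = (\<Sum>k\<in>UNIV. partial k (\<tau> i) x * f c x u k)" for u i
  proof -
    let ?y = "fst (jet_point c z)"
    have y: "?y \<in> fst c \<inter> fst d" using zd fst_jet_point[OF z] by blast
    have x: "snd c ?y = x" using chart_jet_point[OF z] by (auto simp: x_def)
    have "f d (snd d ?y) u i = (\<Sum>k\<in>UNIV. partial k (\<tau> i) (snd c ?y) * f c (snd c ?y) u k)"
      unfolding \<tau>_def using c d y by (rule dynamics_transition)
    then show ?thesis unfolding x by (simp add: \<theta>_def)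
  qed
  have g0_U: "g0 A m f j d (\<theta> z) (Uc p r) = g0 A m f j c z (Uc p r)" for p r
    using z \<theta>z by (simp add: g0_def \<theta>_Uc)
  have "(\<Sum>k\<in>UNIV. g0 A m f j c z (Xc k) * partial (Xc k) (\<lambda>w. h (jet_point c w)) z) =
      (\<Sum>k\<in>UNIV. \<Sum>i\<in>UNIV. f c x (\<lambda>p. z (Uc p 0)) k * (partial k (\<tau> i) x * partial (Xc i) H (\<theta> z)))"
    using z by (simp add: partial_X g0_def x_def sum_distrib_left)
  also have "\<dots> = (\<Sum>i\<in>UNIV. (\<Sum>k\<in>UNIV. partial k (\<tau> i) x * f c x (\<lambda>p. z (Uc p 0)) k)
      * partial (Xc i) H (\<theta> z))"
    by (subst sum.swap) (simp add: sum_distrib_right sum_distrib_left mult_ac)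
  also have "\<dots> = (\<Sum>i\<in>UNIV. g0 A m f j d (\<theta> z) (Xc i) * partial (Xc i) H (\<theta> z))"
    using \<theta>z by (simp add: g0_def fd \<theta>_Uc)
  finally show ?thesis
    unfolding lie_in_chart_def sum_jet_coords by (simp add: partial_U g0_U H_def[symmetric] \<theta>_def[symmetric])
qed

lemma lie_jet_point:
  assumes "h \<in> smooth_jet_funs A m j" "z \<in> jet_dom A c"
  shows "lie A m f j h (jet_point c z) = lie_in_chart A m f j c h z"
proof -
  define d where "d = (SOME d. d \<in> A \<and> fst (jet_point c z) \<in> fst d)"
  have "d \<in> A \<and> fst (jet_point c z) \<in> fst d"
    unfolding d_def by (rule someI_ex) (use chart_cover in blast)
  then show ?thesis
    using lie_chart_independent[OF assms(1) _ assms(2), of d]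
    by (simp add: lie_def d_def[symmetric] Let_def)
qed

lemma smooth_lie:
  assumes "h \<in> smooth_jet_funs A m j"
  shows "lie A m f j h \<in> smooth_jet_funs A m j"
  unfolding smooth_jet_funs_def
proof (intro CollectI ballI)
  fix c assume "c \<in> A"
  have "smooth_fun (jet_coords m j) (jet_dom A c) (lie_in_chart A m f j c h)"
    unfolding lie_in_chart_def
    by (intro smooth_fun_sum smooth_fun_mult smooth_g0 smooth_fun_partial open_jet_dom
        smooth_jet_funsD assms)
  then show "smooth_fun (jet_coords m j) (jet_dom A c) (\<lambda>z. lie A m f j h (jet_point c z))"
    by (subst smooth_fun_cong[OF open_jet_dom]) (auto simp: lie_jet_point[OF assms])
qed

section \<open>Smooth vector fields and the bracket with \<open>g0\<close>\<close>

lemma smooth_vfieldD: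
  assumes "smooth_vfield A m j \<gamma>"
  shows "smooth_fun (jet_coords m j) (jet_dom A c) (\<lambda>z. \<gamma> c z a)"
    "z \<notin> jet_dom A c \<Longrightarrow> \<gamma> c z a = 0" "a \<notin> jet_coords m j \<Longrightarrow> \<gamma> c z a = 0"
    "z \<in> jet_dom A c \<Longrightarrow> line_differentiable b (\<lambda>z. \<gamma> c z a) z"
proof -
  show s: "smooth_fun (jet_coords m j) (jet_dom A c) (\<lambda>z. \<gamma> c z a)" for c a
    using assms unfolding smooth_vfield_def by blast
  show "z \<notin> jet_dom A c \<Longrightarrow> \<gamma> c z a = 0" "a \<notin> jet_coords m j \<Longrightarrow> \<gamma> c z a = 0"
    using assms unfolding smooth_vfield_def by blast+
  show "z \<in> jet_dom A c \<Longrightarrow> line_differentiable b (\<lambda>z. \<gamma> c z a) z"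
    by (rule smooth_fun_line_differentiable[OF open_jet_dom s])
qed

lemma smooth_vfield_zero: "smooth_vfield A m j 0"
  by (simp add: smooth_vfield_def smooth_fun_const)

lemma smooth_vfield_add:
  "smooth_vfield A m j \<gamma> \<Longrightarrow> smooth_vfield A m j \<gamma>' \<Longrightarrow> smooth_vfield A m j (\<gamma> + \<gamma>')"
  by (simp add: smooth_vfield_def smooth_fun_add)

lemma smooth_vfield_smul:
  "h \<in> smooth_jet_funs A m j \<Longrightarrow> smooth_vfield A m j \<gamma> \<Longrightarrow> smooth_vfield A m j (smul h \<gamma>)"
  by (auto simp: smooth_vfield_def smul_def intro!: smooth_fun_mult smooth_jet_funsD)

lemma smooth_vfield_d_u:
  assumes "p \<in> {1..m}" "r \<le> j p"
  shows "smooth_vfield A m j (d_u A p r)"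
proof -
  have "smooth_fun (jet_coords m j) (jet_dom A c) (\<lambda>z. d_u A p r c z a)" for c a
    by (subst smooth_fun_cong[OF open_jet_dom, where h = "\<lambda>z. if a = Uc p r then 1 else 0"])
      (auto simp: d_u_def smooth_fun_const)
  then show ?thesis using assms by (auto simp: smooth_vfield_def d_u_def)
qed

lemma ad_apply:
  "z \<in> jet_dom A c \<Longrightarrow> a \<in> jet_coords m j \<Longrightarrow> ad_g0 A m f j \<gamma> c z a =
     (\<Sum>b\<in>jet_coords m j. g0 A m f j c z b * partial b (\<lambda>w. \<gamma> c w a) z
        - \<gamma> c z b * partial b (\<lambda>w. g0 A m f j c w a) z)"
  by (simp add: ad_g0_def bracket_def)

lemma ad_outside:
  "z \<notin> jet_dom A c \<or> a \<notin> jet_coords m j \<Longrightarrow> ad_g0 A m f j \<gamma> c z a = 0"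
  by (auto simp: ad_g0_def bracket_def)

lemma smooth_vfield_ad:
  assumes "smooth_vfield A m j \<gamma>"
  shows "smooth_vfield A m j (ad_g0 A m f j \<gamma>)"
proof -
  have "smooth_fun (jet_coords m j) (jet_dom A c) (\<lambda>z. ad_g0 A m f j \<gamma> c z a)" for c a
  proof (cases "a \<in> jet_coords m j")
    case True
    have "smooth_fun (jet_coords m j) (jet_dom A c) (\<lambda>z.
       \<Sum>b\<in>jet_coords m j. g0 A m f j c z b * partial b (\<lambda>w. \<gamma> c w a) z
        - \<gamma> c z b * partial b (\<lambda>w. g0 A m f j c w a) z)"
      by (intro smooth_fun_sum smooth_fun_diff smooth_fun_mult smooth_g0 smooth_fun_partial
          open_jet_dom smooth_vfieldD(1)[OF assms])
    then show ?thesis using True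
      by (subst smooth_fun_cong[OF open_jet_dom]) (auto simp: ad_apply)
  next
    case False
    then show ?thesis by (simp add: ad_outside smooth_fun_const)
  qed
  then show ?thesis by (auto simp: smooth_vfield_def ad_outside)
qed

lemma ad_zero: "ad_g0 A m f j 0 = 0"
  by (intro ext) (simp add: ad_g0_def bracket_def)

lemma ad_add:
  assumes "smooth_vfield A m j \<gamma>" "smooth_vfield A m j \<gamma>'"
  shows "ad_g0 A m f j (\<gamma> + \<gamma>') = ad_g0 A m f j \<gamma> + ad_g0 A m f j \<gamma>'"
proof (intro ext)
  fix c z a
  show "ad_g0 A m f j (\<gamma> + \<gamma>') c z a = (ad_g0 A m f j \<gamma> + ad_g0 A m f j \<gamma>') c z a"
  proof (cases "z \<in> jet_dom A c \<and> a \<in> jet_coords m j")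
    case True
    then show ?thesis
      by (simp add: ad_apply partial_add smooth_vfieldD(4)[OF assms(1)] smooth_vfieldD(4)[OF assms(2)]
          sum.distrib[symmetric] algebra_simps)
  next
    case False
    then show ?thesis by (auto simp: ad_outside)
  qed
qed

text \<open>Leibniz rule: the derivatives that fall on the coefficient add up to its Lie derivative.
  Since that is again a smooth function on the jet manifold, the extra term stays in any module
  containing \<gamma>.\<close>

lemma ad_smul:
  assumes "h \<in> smooth_jet_funs A m j" "smooth_vfield A m j \<gamma>"
  shows "ad_g0 A m f j (smul h \<gamma>) = smul h (ad_g0 A m f j \<gamma>) + smul (lie A m f j h) \<gamma>"
proof (intro ext)
  fix c z a
  show "ad_g0 A m f j (smul h \<gamma>) c z a =
    (smul h (ad_g0 A m f j \<gamma>) + smul (lie A m f j h) \<gamma>) c z a"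
  proof (cases "z \<in> jet_dom A c \<and> a \<in> jet_coords m j")
    case True
    then have ld: "line_differentiable b (\<lambda>z. h (jet_point c z)) z" for b
      using smooth_fun_line_differentiable[OF open_jet_dom smooth_jet_funsD[OF assms(1)]] by blast
    show ?thesis using True
      by (simp add: ad_apply smul_def partial_mult ld smooth_vfieldD(4)[OF assms(2)]
          lie_jet_point[OF assms(1)] lie_in_chart_def sum_distrib_left sum_distrib_right
          sum.distrib[symmetric] algebra_simps)
  next
    case False
    then show ?thesis by (auto simp: ad_outside smul_def smooth_vfieldD[OF assms(2)])
  qed
qed

section \<open>Modules over the smooth functions on the jet manifold\<close>

lemma generated_zero: "0 \<in> generated A m j S"
  unfolding generated_def by (intro CollectI exI[of _ "{}"]) (auto simp: fun_eq_iff)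

lemma generated_base: "\<gamma> \<in> S \<Longrightarrow> \<gamma> \<in> generated A m j S"
  unfolding generated_def
  by (intro CollectI exI[of _ "{\<gamma>}"] exI[of _ "\<lambda>\<gamma> q. 1"]) (auto simp: smooth_jet_funs_const)

lemma generated_smul:
  assumes "h \<in> smooth_jet_funs A m j" "\<gamma> \<in> generated A m j S"
  shows "smul h \<gamma> \<in> generated A m j S"
proof -
  from assms(2) obtain T g where T: "finite T" "T \<subseteq> S" "\<forall>\<gamma>\<in>T. g \<gamma> \<in> smooth_jet_funs A m j"
    and \<gamma>: "\<gamma> = (\<lambda>c z a. \<Sum>\<gamma>\<in>T. g \<gamma> (jet_point c z) * \<gamma> c z a)"
    unfolding generated_def by blast
  have "smul h \<gamma> = (\<lambda>c z a. \<Sum>\<gamma>\<in>T. (\<lambda>q. h q * g \<gamma> q) (jet_point c z) * \<gamma> c z a)"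
    by (simp add: smul_def \<gamma> sum_distrib_left mult_ac)
  moreover have "\<forall>\<gamma>\<in>T. (\<lambda>q. h q * g \<gamma> q) \<in> smooth_jet_funs A m j"
    using T assms(1) by (auto intro: smooth_jet_funs_mult)
  ultimately show ?thesis
    unfolding generated_def using T(1,2)
    by (intro CollectI exI[of _ T] exI[of _ "\<lambda>\<gamma> q. h q * g \<gamma> q"]) auto
qed

lemma generated_add:
  assumes "\<gamma>1 \<in> generated A m j S" "\<gamma>2 \<in> generated A m j S"
  shows "\<gamma>1 + \<gamma>2 \<in> generated A m j S"
proof -
  from assms(1) obtain T1 g1 where T1: "finite T1" "T1 \<subseteq> S" "\<forall>\<gamma>\<in>T1. g1 \<gamma> \<in> smooth_jet_funs A m j"
    and \<gamma>1: "\<gamma>1 = (\<lambda>c z a. \<Sum>\<gamma>\<in>T1. g1 \<gamma> (jet_point c z) * \<gamma> c z a)"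
    unfolding generated_def by blast
  from assms(2) obtain T2 g2 where T2: "finite T2" "T2 \<subseteq> S" "\<forall>\<gamma>\<in>T2. g2 \<gamma> \<in> smooth_jet_funs A m j"
    and \<gamma>2: "\<gamma>2 = (\<lambda>c z a. \<Sum>\<gamma>\<in>T2. g2 \<gamma> (jet_point c z) * \<gamma> c z a)"
    unfolding generated_def by blast
  define k1 where "k1 \<gamma> = (if \<gamma> \<in> T1 then g1 \<gamma> else (\<lambda>q. 0))" for \<gamma>
  define k2 where "k2 \<gamma> = (if \<gamma> \<in> T2 then g2 \<gamma> else (\<lambda>q. 0))" for \<gamma>
  have "\<gamma>1 c z a = (\<Sum>\<gamma>\<in>T1 \<union> T2. k1 \<gamma> (jet_point c z) * \<gamma> c z a)" for c z a
    unfolding \<gamma>1 using T1(1) T2(1)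
    by (intro sum.mono_neutral_cong_left) (auto simp: k1_def)
  moreover have "\<gamma>2 c z a = (\<Sum>\<gamma>\<in>T1 \<union> T2. k2 \<gamma> (jet_point c z) * \<gamma> c z a)" for c z a
    unfolding \<gamma>2 using T1(1) T2(1)
    by (intro sum.mono_neutral_cong_left) (auto simp: k2_def)
  ultimately have "\<gamma>1 + \<gamma>2 =
      (\<lambda>c z a. \<Sum>\<gamma>\<in>T1 \<union> T2. (\<lambda>q. k1 \<gamma> q + k2 \<gamma> q) (jet_point c z) * \<gamma> c z a)"
    by (intro ext) (simp add: sum.distrib distrib_right)
  moreover have "(\<lambda>q. k1 \<gamma> q + k2 \<gamma> q) \<in> smooth_jet_funs A m j" for \<gamma>
    using T1(3) T2(3)
    by (intro smooth_jet_funs_add) (auto simp: k1_def k2_def smooth_jet_funs_const)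
  ultimately show ?thesis
    unfolding generated_def using T1(1,2) T2(1,2)
    by (intro CollectI exI[of _ "T1 \<union> T2"] exI[of _ "\<lambda>\<gamma> q. k1 \<gamma> q + k2 \<gamma> q"]) auto
qed

text \<open>The induction principle for generated modules: every member is a finite sum of smooth
  multiples of generators.\<close>

lemma generated_least:
  assumes "S \<subseteq> M" "0 \<in> M" "\<And>\<gamma> \<gamma>'. \<gamma> \<in> M \<Longrightarrow> \<gamma>' \<in> M \<Longrightarrow> \<gamma> + \<gamma>' \<in> M"
    and "\<And>h \<gamma>. h \<in> smooth_jet_funs A m j \<Longrightarrow> \<gamma> \<in> M \<Longrightarrow> smul h \<gamma> \<in> M"
  shows "generated A m j S \<subseteq> M"
proof
  fix \<gamma> assume "\<gamma> \<in> generated A m j S"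
  then obtain T h where T: "finite T" "T \<subseteq> S" "\<forall>\<gamma>\<in>T. h \<gamma> \<in> smooth_jet_funs A m j"
    and \<gamma>: "\<gamma> = (\<lambda>c z a. \<Sum>\<gamma>\<in>T. h \<gamma> (jet_point c z) * \<gamma> c z a)"
    unfolding generated_def by blast
  have "(\<Sum>\<gamma>\<in>T. smul (h \<gamma>) \<gamma>) \<in> M"
    using T by (induction T rule: finite_induct) (use assms in auto)
  moreover have "\<gamma> = (\<Sum>\<gamma>\<in>T. smul (h \<gamma>) \<gamma>)"
    unfolding \<gamma> using T(1) by (induction T rule: finite_induct) (auto simp: fun_eq_iff smul_def)
  ultimately show "\<gamma> \<in> M" by simp
qed

lemma generated_minimal: "S \<subseteq> generated A m j S' \<Longrightarrow> generated A m j S \<subseteq> generated A m j S'"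
  by (rule generated_least) (auto intro: generated_zero generated_add generated_smul)

lemma generated_mono: "S \<subseteq> S' \<Longrightarrow> generated A m j S \<subseteq> generated A m j S'"
  by (rule generated_minimal) (auto intro: generated_base)

lemma smul_add: "smul h (\<gamma> + \<gamma>') = smul h \<gamma> + smul h \<gamma>'"
  by (simp add: fun_eq_iff smul_def algebra_simps)

lemma generated_Un: "generated A m j (S \<union> S') = generated A m j S + generated A m j S'"
proof
  show "generated A m j (S \<union> S') \<subseteq> generated A m j S + generated A m j S'"
  proof (rule generated_least)
    show "S \<union> S' \<subseteq> generated A m j S + generated A m j S'"
    proof
      fix \<gamma> assume "\<gamma> \<in> S \<union> S'"
      then show "\<gamma> \<in> generated A m j S + generated A m j S'"
        using set_plus_intro[OF generated_base generated_zero, of \<gamma> S j j S']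
          set_plus_intro[OF generated_zero generated_base, of \<gamma> S' j S j] by auto
    qed
    show "0 \<in> generated A m j S + generated A m j S'"
      using set_plus_intro[OF generated_zero generated_zero, of j S j S'] by simp
  next
    fix \<gamma> \<gamma>' assume "\<gamma> \<in> generated A m j S + generated A m j S'" "\<gamma>' \<in> generated A m j S + generated A m j S'"
    then obtain a b a' b' where *: "a \<in> generated A m j S" "b \<in> generated A m j S'" "\<gamma> = a + b"
      "a' \<in> generated A m j S" "b' \<in> generated A m j S'" "\<gamma>' = a' + b'"
      by (auto elim!: set_plus_elim)
    have "\<gamma> + \<gamma>' = (a + a') + (b + b')" by (simp add: * algebra_simps)
    then show "\<gamma> + \<gamma>' \<in> generated A m j S + generated A m j S'"
      using * by (simp only:) (intro set_plus_intro generated_add)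
  next
    fix h \<gamma> assume "h \<in> smooth_jet_funs A m j" "\<gamma> \<in> generated A m j S + generated A m j S'"
    then show "smul h \<gamma> \<in> generated A m j S + generated A m j S'"
      by (auto elim!: set_plus_elim simp: smul_add intro!: set_plus_intro generated_smul)
  qed
  show "generated A m j S + generated A m j S' \<subseteq> generated A m j (S \<union> S')"
    using generated_mono[of S "S \<union> S'"] generated_mono[of S' "S \<union> S'"]
    by (auto elim!: set_plus_elim intro!: generated_add)
qed

lemma generated_empty: "generated A m j {} = 0"
  by (auto simp: generated_def fun_eq_iff)

lemma generated_UN:
  assumes "finite P"
  shows "(\<Sum>p\<in>P. generated A m j (S p)) = generated A m j (\<Union>p\<in>P. S p)"
  using assms
  by (induction P rule: finite_induct) (simp_all add: generated_empty generated_Un)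

lemma smooth_vfield_generated:
  assumes "\<And>\<gamma>. \<gamma> \<in> S \<Longrightarrow> smooth_vfield A m j \<gamma>" "\<gamma> \<in> generated A m j S"
  shows "smooth_vfield A m j \<gamma>"
proof -
  have "generated A m j S \<subseteq> {\<gamma>. smooth_vfield A m j \<gamma>}"
    by (rule generated_least)
      (auto intro: assms smooth_vfield_zero smooth_vfield_add smooth_vfield_smul)
  then show ?thesis using assms(2) by blast
qed

text \<open>This reduces the recursion for \<open>G\<close> to generators. The map
  \<open>ad_g0\<close> is not linear over functions, so already the module property of the left side
  needs an argument: h (a + ad b) = (h a - (L h) b) + ad (h b), where L is the Lie derivative along
  \<open>g0\<close>.\<close>

lemma generated_plus_ad:
  assumes S: "\<And>\<gamma>. \<gamma> \<in> S \<Longrightarrow> smooth_vfield A m j \<gamma>"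
  shows "generated A m j S + ad_g0 A m f j ` generated A m j S =
    generated A m j (S \<union> ad_g0 A m f j ` S)" (is "?L = ?R")
proof
  note smooth = smooth_vfield_generated[OF S]
  have sub: "generated A m j S \<subseteq> ?R" by (rule generated_mono) auto
  \<comment> \<open>Membership in the module is carried along in the induction: it supplies the
    smoothness required by \<open>ad_add\<close> and puts the extra Leibniz term of
    \<open>ad_smul\<close> into the right side.\<close>
  have "generated A m j S \<subseteq> {\<gamma> \<in> generated A m j S. ad_g0 A m f j \<gamma> \<in> ?R}"
  proof (rule generated_least)
    fix \<gamma> \<gamma>'
    assume "\<gamma> \<in> {\<gamma> \<in> generated A m j S. ad_g0 A m f j \<gamma> \<in> ?R}"
      "\<gamma>' \<in> {\<gamma> \<in> generated A m j S. ad_g0 A m f j \<gamma> \<in> ?R}"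
    then show "\<gamma> + \<gamma>' \<in> {\<gamma> \<in> generated A m j S. ad_g0 A m f j \<gamma> \<in> ?R}"
      by (auto simp: ad_add smooth intro: generated_add)
  next
    fix h \<gamma>
    assume "h \<in> smooth_jet_funs A m j" "\<gamma> \<in> {\<gamma> \<in> generated A m j S. ad_g0 A m f j \<gamma> \<in> ?R}"
    then show "smul h \<gamma> \<in> {\<gamma> \<in> generated A m j S. ad_g0 A m f j \<gamma> \<in> ?R}"
      using sub by (auto simp: ad_smul smooth intro!: generated_add generated_smul smooth_lie)
  qed (auto simp: ad_zero intro: generated_base generated_zero)
  then show "?L \<subseteq> ?R"
    using sub by (auto elim!: set_plus_elim intro!: generated_add)
  show "?R \<subseteq> ?L"
  proof (rule generated_least)
    have ad0: "0 \<in> ad_g0 A m f j ` generated A m j S"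
      using ad_zero generated_zero by (metis image_eqI)
    show "S \<union> ad_g0 A m f j ` S \<subseteq> ?L"
    proof
      fix \<gamma> assume "\<gamma> \<in> S \<union> ad_g0 A m f j ` S"
      then consider "\<gamma> \<in> S" | "\<gamma> \<in> ad_g0 A m f j ` S" by blast
      then show "\<gamma> \<in> ?L"
      proof cases
        case 1
        then show ?thesis using set_plus_intro[OF generated_base ad0, of \<gamma>] by simp
      next
        case 2
        then have "\<gamma> \<in> ad_g0 A m f j ` generated A m j S" by (auto intro: generated_base)
        then show ?thesis using set_plus_intro[OF generated_zero, of \<gamma>] by fastforce
      qed
    qed
    show "0 \<in> ?L" using set_plus_intro[OF generated_zero ad0] by simp
  next
    fix \<gamma> \<gamma>' assume "\<gamma> \<in> ?L" "\<gamma>' \<in> ?L"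
    then obtain a b a' b' where *: "a \<in> generated A m j S" "b \<in> generated A m j S"
      "\<gamma> = a + ad_g0 A m f j b"
      "a' \<in> generated A m j S" "b' \<in> generated A m j S" "\<gamma>' = a' + ad_g0 A m f j b'"
      by (auto elim!: set_plus_elim)
    then have "\<gamma> + \<gamma>' = (a + a') + ad_g0 A m f j (b + b')"
      by (simp add: ad_add smooth algebra_simps)
    then show "\<gamma> + \<gamma>' \<in> ?L"
      using * by (simp only:) (intro set_plus_intro imageI generated_add)
  next
    fix h \<gamma> assume h: "h \<in> smooth_jet_funs A m j" and "\<gamma> \<in> ?L"
    then obtain a b where *: "a \<in> generated A m j S" "b \<in> generated A m j S"
      "\<gamma> = a + ad_g0 A m f j b"
      by (auto elim!: set_plus_elim)
    \<comment> \<open>The coefficient -L h cancels the extra term that arises when h is moved inside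
      \<open>ad_g0\<close>.\<close>
    define l where "l q = (-1) * lie A m f j h q" for q
    have l: "l \<in> smooth_jet_funs A m j"
      unfolding l_def using h by (intro smooth_jet_funs_mult smooth_jet_funs_const smooth_lie)
    have "smul h \<gamma> = (smul h a + smul l b) + ad_g0 A m f j (smul h b)"
      using * h by (simp add: smul_add ad_smul smooth, simp add: fun_eq_iff smul_def l_def)
    moreover have "smul h a + smul l b \<in> generated A m j S" "smul h b \<in> generated A m j S"
      using * h l by (auto intro: generated_add generated_smul)
    ultimately show "smul h \<gamma> \<in> ?L" by (auto intro: set_plus_intro)
  qed
qed

end

section \<open>Generators and fibres of the filtrations\<close>

interpretation coord: vector_space "\<lambda>(r::real) (v :: 'c \<Rightarrow> real) a. r * v a"
  by (rule vector_space_coord)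

lemma sum_fun_apply: "(\<Sum>i\<in>S. F i) a = (\<Sum>i\<in>S. F i a)" for F :: "'i \<Rightarrow> 'c \<Rightarrow> 'b::comm_monoid_add"
  by (induction S rule: infinite_finite_induct) auto

text \<open>The ambient space may have infinite dimension, so finiteness is taken from the spanning
  set F: a basis of U extends to a finite basis of W, and equal cardinality forces the two bases to
  coincide.\<close>

lemma finite_span_subspaces:
  fixes U W :: "('c \<Rightarrow> real) set"
  assumes "coord.subspace U" "U \<subseteq> W" "W \<subseteq> coord.span F" "finite F"
  shows "coord.dim U \<le> coord.dim W" "coord.dim U = coord.dim W \<Longrightarrow> U = W"
proof -
  obtain B where B: "B \<subseteq> U" "coord.independent B" "U \<subseteq> coord.span B"
    by (rule coord.maximal_independent_subset)
  have "B \<subseteq> W" using B(1) assms(2) by blast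
  then obtain C where C: "B \<subseteq> C" "C \<subseteq> W" "coord.independent C" "W \<subseteq> coord.span C"
    by (rule coord.maximal_independent_subset_extend[OF _ B(2)])
  have finC: "finite C"
    using coord.independent_span_bound[OF assms(4) C(3)] C(2) assms(3) by blast
  have dims: "coord.dim U = card B" "coord.dim W = card C"
    using coord.basis_card_eq_dim[OF B(1,3,2)] coord.basis_card_eq_dim[OF C(2,4,3)] by auto
  then show "coord.dim U \<le> coord.dim W" using card_mono[OF finC C(1)] by simp
  assume "coord.dim U = coord.dim W"
  then have "B = C" using dims card_subset_eq[OF finC C(1)] by simp
  then have "W \<subseteq> U" using C(4) coord.span_minimal[OF B(1) assms(1)] by blast
  then show "U = W" using assms(2) by blast
qed

definition unit_vec :: "'c \<Rightarrow> 'c \<Rightarrow> real" where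
  "unit_vec a = (\<lambda>b. if b = a then 1 else 0)"

lemma inj_unit_vec: "inj_on unit_vec B"
  by (auto simp: inj_on_def unit_vec_def fun_eq_iff split: if_splits)

lemma unit_vec_expansion:
  assumes "finite B" "\<And>a. a \<notin> B \<Longrightarrow> v a = 0"
  shows "v = (\<Sum>b\<in>B. (\<lambda>a. v b * unit_vec b a))"
proof
  fix a
  have "(\<Sum>b\<in>B. v b * unit_vec b a) = (\<Sum>b\<in>B. if b = a then v b else 0)"
    by (intro sum.cong) (auto simp: unit_vec_def)
  then show "v a = (\<Sum>b\<in>B. (\<lambda>a. v b * unit_vec b a)) a"
    using assms by (simp add: sum_fun_apply)
qed

lemma span_unit_vec:
  assumes "finite B" "\<And>a. a \<notin> B \<Longrightarrow> v a = 0"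
  shows "v \<in> coord.span (unit_vec ` B)"
proof -
  have "(\<Sum>b\<in>B. (\<lambda>a. v b * unit_vec b a)) \<in> coord.span (unit_vec ` B)"
    by (intro coord.span_sum coord.span_scale coord.span_base) auto
  moreover have "v = (\<Sum>b\<in>B. (\<lambda>a. v b * unit_vec b a))"
    using assms by (rule unit_vec_expansion)
  ultimately show ?thesis by (rule ssubst[rotated])
qed

lemma independent_unit_vec:
  assumes "finite B"
  shows "coord.independent (unit_vec ` B)"
proof (rule coord.independent_if_scalars_zero)
  fix c :: "('a \<Rightarrow> real) \<Rightarrow> real" and x
  assume 0: "(\<Sum>x\<in>unit_vec ` B. (\<lambda>a. c x * x a)) = 0" and "x \<in> unit_vec ` B"
  then obtain b where b: "b \<in> B" "x = unit_vec b" by auto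
  have "(\<Sum>d\<in>B. c (unit_vec d) * unit_vec d b) = 0"
    using fun_cong[OF 0, of b] by (simp add: sum.reindex[OF inj_unit_vec] sum_fun_apply)
  moreover have "(\<Sum>d\<in>B. c (unit_vec d) * unit_vec d b) = (\<Sum>d\<in>B. if d = b then c (unit_vec d) else 0)"
    by (intro sum.cong) (auto simp: unit_vec_def)
  ultimately show "c x = 0" using assms b by simp
qed (use assms in simp)

lemma dim_span_unit_vec: "finite B \<Longrightarrow> coord.dim (coord.span (unit_vec ` B)) = card B"
  by (simp add: coord.dim_eq_card_independent[OF independent_unit_vec] card_image[OF inj_unit_vec])

lemma span_support:
  assumes "v \<in> coord.span S" "\<And>w. w \<in> S \<Longrightarrow> w a = 0"
  shows "v a = 0"
proof -
  have "coord.subspace {w. w a = 0}"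
    unfolding coord.subspace_def by auto
  then have "coord.span S \<subseteq> {w. w a = 0}"
    using assms(2) by (intro coord.span_minimal) auto
  then show ?thesis using assms(1) by blast
qed

text \<open>The generators of \<open>G\<^sub>k\<close> (up to sign \<open>tower p l\<close> is \<open>ad\<^sup>l\<close> of the derivation along the
  coordinate of index \<open>(p, j\<^sub>p)\<close>): the part \<open>l < j\<^sub>p\<close> yields \<open>\<Gamma>\<^sub>k\<close>, the rest \<open>\<Delta>\<^sub>k\<close>.\<close>

definition tower :: "('x, 'n) chart set \<Rightarrow> nat \<Rightarrow> ('x, 'n) dynamics \<Rightarrow> (nat \<Rightarrow> nat)
    \<Rightarrow> nat \<Rightarrow> nat \<Rightarrow> ('x, 'n) vfield" where
  "tower A m f j p l =
     (if l < j p then d_u A p (j p - l) else (ad_g0 A m f j ^^ (l - j p)) (d_u A p 0))"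

text \<open>The condition \<open>l < j p\<close> encodes the range min(k, j_p - 1) together with its
  emptiness for j_p = 0. Beginning at p = 1 rather than 2 agrees with \<open>Gam\<close> because the
  results assume \<open>j 1 = 0\<close>.\<close>

definition Gam_gens :: "('x, 'n) chart set \<Rightarrow> nat \<Rightarrow> (nat \<Rightarrow> nat) \<Rightarrow> nat \<Rightarrow> ('x, 'n) vfield set" where
  "Gam_gens A m j k = {d_u A p (j p - l) | p l. p \<in> {1..m} \<and> l \<le> k \<and> l < j p}"

definition G_gens :: "('x, 'n) chart set \<Rightarrow> nat \<Rightarrow> ('x, 'n) dynamics \<Rightarrow> (nat \<Rightarrow> nat) \<Rightarrow> nat
    \<Rightarrow> ('x, 'n) vfield set" where
  "G_gens A m f j k = {tower A m f j p l | p l. p \<in> {1..m} \<and> l \<le> k}"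

lemma G_gensI: "p \<in> {1..m} \<Longrightarrow> l \<le> k \<Longrightarrow> tower A m f j p l \<in> G_gens A m f j k"
  unfolding G_gens_def by blast

lemma G_gens_alt:
  "G_gens A m f j k = Gam_gens A m j k \<union> (\<Union>p\<in>{1..m}. Delta_gens A m f j k p)"
proof (intro equalityI subsetI)
  fix \<gamma> assume "\<gamma> \<in> G_gens A m f j k"
  then obtain p l where "p \<in> {1..m}" "l \<le> k" "\<gamma> = tower A m f j p l"
    by (auto simp: G_gens_def)
  then show "\<gamma> \<in> Gam_gens A m j k \<union> (\<Union>p\<in>{1..m}. Delta_gens A m f j k p)"
    by (cases "l < j p") (fastforce simp: tower_def Gam_gens_def Delta_gens_def)+
next
  fix \<gamma> assume "\<gamma> \<in> Gam_gens A m j k \<union> (\<Union>p\<in>{1..m}. Delta_gens A m f j k p)"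
  then obtain p l where "p \<in> {1..m}" "l \<le> k" "\<gamma> = tower A m f j p l"
  proof (elim UnE UN_E)
    assume "\<gamma> \<in> Gam_gens A m j k"
    then obtain p l where "p \<in> {1..m}" "l \<le> k" "l < j p" "\<gamma> = d_u A p (j p - l)"
      by (auto simp: Gam_gens_def)
    then show thesis by (intro that[of p l]) (auto simp: tower_def)
  next
    fix p assume p: "p \<in> {1..m}" and "\<gamma> \<in> Delta_gens A m f j k p"
    then obtain l where "l \<le> k" "j p \<le> l" "\<gamma> = (ad_g0 A m f j ^^ (l - j p)) (d_u A p 0)"
      by (auto simp: Delta_gens_def)
    then show thesis using p by (intro that[of p l]) (auto simp: tower_def)
  qed
  then show "\<gamma> \<in> G_gens A m f j k" by (auto simp: G_gens_def)
qed

lemma G_gens_mono: "k \<le> k' \<Longrightarrow> G_gens A m f j k \<subseteq> G_gens A m f j k'"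
  and Gam_gens_mono: "k \<le> k' \<Longrightarrow> Gam_gens A m j k \<subseteq> Gam_gens A m j k'"
  and Delta_gens_mono: "k \<le> k' \<Longrightarrow> Delta_gens A m f j k p \<subseteq> Delta_gens A m f j k' p"
  unfolding G_gens_def Gam_gens_def Delta_gens_def by fastforce+

lemma finite_G_gens: "finite (G_gens A m f j k)"
proof -
  have "G_gens A m f j k = (\<lambda>(p, l). tower A m f j p l) ` ({1..m} \<times> {..k})"
    unfolding G_gens_def by (auto simp: image_iff) blast
  then show ?thesis by simp
qed

section \<open>Brackets of \<open>g0\<close> with coordinate derivations, and generators of the
  filtrations\<close>

context jet_system
begin

lemma d_u_unit_vec: "z \<in> jet_dom A c \<Longrightarrow> d_u A p r c z = unit_vec (Uc p r)"
  by (auto simp: d_u_def unit_vec_def)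

lemma partial_locally_const:
  assumes "z \<in> jet_dom A c" "\<And>w. w \<in> jet_dom A c \<Longrightarrow> h w = k"
  shows "partial b h z = 0"
  using partial_cong_local[OF open_jet_dom assms(1), of h "\<lambda>w. k" b] assms(2) by simp

lemma partial_d_u: "z \<in> jet_dom A c \<Longrightarrow> partial b (\<lambda>w. d_u A p r c w a) z = 0"
  by (rule partial_locally_const[where k = "if a = Uc p r then 1 else 0"]) (auto simp: d_u_def)

lemma depends_on_g0_Xc:
  "depends_on (jet_coords m (\<lambda>p. 0)) (jet_dom A c) (\<lambda>z. g0 A m f j c z (Xc i))"
proof (cases "c \<in> A")
  case True
  then have "smooth_fun (jet_coords m (\<lambda>p. 0)) (jet_dom A c)
      (\<lambda>z. f c (\<lambda>k. z (Xc k)) (\<lambda>p. z (Uc p 0)) i)"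
    using system unfolding control_system_def by blast
  then have "depends_on (jet_coords m (\<lambda>p. 0)) (jet_dom A c)
      (\<lambda>z. f c (\<lambda>k. z (Xc k)) (\<lambda>p. z (Uc p 0)) i)"
    by (simp add: smooth_fun_alt)
  then show ?thesis by (subst depends_on_cong) (auto simp: g0_def)
next
  case False
  then show ?thesis by (simp add: depends_on_def jet_dom_empty)
qed

lemma partial_g0_Xc:
  assumes "z \<in> jet_dom A c" "b \<notin> jet_coords m (\<lambda>p. 0)"
  shows "partial b (\<lambda>w. g0 A m f j c w (Xc i)) z = 0"
  using partial_not_depends[OF depends_on_g0_Xc open_jet_dom assms] .

lemma partial_g0_Uc:
  assumes "z \<in> jet_dom A c"
  shows "partial b (\<lambda>w. g0 A m f j c w (Uc p r)) z =
    (if p \<in> {1..m} \<and> r < j p \<and> b = Uc p (Suc r) then 1 else 0)"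
proof (cases "p \<in> {1..m} \<and> r < j p")
  case True
  then have "partial b (\<lambda>w. g0 A m f j c w (Uc p r)) z = partial b (\<lambda>w. w (Uc p (Suc r))) z"
    by (intro partial_cong_local[OF open_jet_dom assms]) (auto simp: g0_def)
  then show ?thesis using True by (auto simp: partial_proj)
next
  case False
  then have "partial b (\<lambda>w. g0 A m f j c w (Uc p r)) z = 0"
    by (intro partial_locally_const[OF assms, where k = 0]) (auto simp: g0_def)
  then show ?thesis using False by auto
qed

text \<open>A coordinate derivation has constant components, so the bracket only differentiates
  \<open>g0\<close>. A derivative of order at least 1 does not enter the dynamics; it occurs only as
  the component of \<open>g0\<close> along the derivative one order lower, which gives the sign
  -1.\<close>

lemma ad_d_u:
  assumes p: "p \<in> {1..m}" and r: "Suc r \<le> j p"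
  shows "ad_g0 A m f j (d_u A p (Suc r)) = smul (\<lambda>q. -1) (d_u A p r)"
proof (intro ext)
  fix c z a
  show "ad_g0 A m f j (d_u A p (Suc r)) c z a = smul (\<lambda>q. -1) (d_u A p r) c z a"
  proof (cases "z \<in> jet_dom A c \<and> a \<in> jet_coords m j")
    case True
    then have z: "z \<in> jet_dom A c" by blast
    have "ad_g0 A m f j (d_u A p (Suc r)) c z a =
       (\<Sum>b\<in>jet_coords m j. - (if b = Uc p (Suc r) then partial b (\<lambda>w. g0 A m f j c w a) z else 0))"
      using True unfolding ad_apply[OF True[THEN conjunct1] True[THEN conjunct2]]
      by (intro sum.cong) (simp_all add: partial_d_u, simp add: d_u_def)
    also have "\<dots> = - partial (Uc p (Suc r)) (\<lambda>w. g0 A m f j c w a) z"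
      using p r by (simp add: sum_negf)
    also have "\<dots> = smul (\<lambda>q. -1) (d_u A p r) c z a"
    proof (cases a)
      case (Xc i)
      then show ?thesis using z by (simp add: partial_g0_Xc smul_def d_u_def)
    next
      case (Uc q k)
      then show ?thesis using z p r by (auto simp: partial_g0_Uc smul_def d_u_def)
    qed
    finally show ?thesis .
  next
    case False
    then show ?thesis using p r by (auto simp: ad_outside smul_def d_u_def)
  qed
qed

lemma smooth_vfield_ad_pow:
  "smooth_vfield A m j \<gamma> \<Longrightarrow> smooth_vfield A m j ((ad_g0 A m f j ^^ s) \<gamma>)"
  by (induction s) (auto intro: smooth_vfield_ad)

lemma smooth_tower: "p \<in> {1..m} \<Longrightarrow> smooth_vfield A m j (tower A m f j p l)"
  unfolding tower_def by (auto intro!: smooth_vfield_d_u smooth_vfield_ad_pow)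

lemma smooth_G_gens: "\<gamma> \<in> G_gens A m f j k \<Longrightarrow> smooth_vfield A m j \<gamma>"
  by (auto simp: G_gens_def intro!: smooth_tower)

lemma ad_tower:
  assumes "p \<in> {1..m}"
  shows "ad_g0 A m f j (tower A m f j p l) =
    (if l < j p then smul (\<lambda>q. -1) (tower A m f j p (Suc l)) else tower A m f j p (Suc l))"
proof (cases "l < j p")
  case True
  define r where "r = j p - Suc l"
  have r: "j p - l = Suc r" "Suc r \<le> j p" "tower A m f j p (Suc l) = d_u A p r"
    using True by (auto simp: r_def tower_def)
  have "tower A m f j p l = d_u A p (Suc r)" using True r(1) by (simp add: tower_def)
  then show ?thesis using True by (simp add: ad_d_u[of p r j, OF assms r(2)] r(3))
next
  case False
  then show ?thesis by (simp add: tower_def Suc_diff_le)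
qed

lemma G_eq_generated: "G A m f j k = generated A m j (G_gens A m f j k)"
proof (induction k)
  case 0
  have "{d_u A p (j p) | p. p \<in> {1..m}} = G_gens A m f j 0"
    unfolding G_gens_def by (auto simp: tower_def; metis diff_zero le_zero_eq)
  then show ?case by simp
next
  case (Suc k)
  have "G A m f j (Suc k) =
      generated A m j (G_gens A m f j k \<union> ad_g0 A m f j ` G_gens A m f j k)"
    by (simp add: Suc generated_plus_ad[OF smooth_G_gens])
  also have "\<dots> = generated A m j (G_gens A m f j (Suc k))"
  proof (intro equalityI generated_minimal subsetI)
    fix \<gamma> assume "\<gamma> \<in> G_gens A m f j k \<union> ad_g0 A m f j ` G_gens A m f j k"
    then consider "\<gamma> \<in> G_gens A m f j (Suc k)"
      | p l where "p \<in> {1..m}" "l \<le> k" "\<gamma> = ad_g0 A m f j (tower A m f j p l)"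
      using G_gens_mono[of k "Suc k" A m f j] unfolding G_gens_def by fastforce
    then show "\<gamma> \<in> generated A m j (G_gens A m f j (Suc k))"
    proof cases
      case 1
      then show ?thesis by (rule generated_base)
    next
      case 2
      have "tower A m f j p (Suc l) \<in> generated A m j (G_gens A m f j (Suc k))"
        using 2 by (intro generated_base G_gensI) auto
      then show ?thesis
        using 2 by (auto simp: ad_tower intro!: generated_smul smooth_jet_funs_const)
    qed
  next
    fix \<gamma> assume "\<gamma> \<in> G_gens A m f j (Suc k)"
    then obtain p l where pl: "p \<in> {1..m}" "l \<le> Suc k" "\<gamma> = tower A m f j p l"
      by (auto simp: G_gens_def)
    let ?M = "generated A m j (G_gens A m f j k \<union> ad_g0 A m f j ` G_gens A m f j k)"
    show "\<gamma> \<in> ?M"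
    proof (cases "l \<le> k")
      case True
      then show ?thesis using pl by (auto intro!: generated_base G_gensI)
    next
      case False
      then have l: "l = Suc k" using pl by simp
      have "ad_g0 A m f j (tower A m f j p k) \<in> ?M"
        using pl by (intro generated_base UnI2 imageI G_gensI) auto
      \<comment> \<open>A second factor -1 undoes the sign from the descent through the jets;
        modules do not see signs.\<close>
      moreover from this have "smul (\<lambda>q. -1) (ad_g0 A m f j (tower A m f j p k)) \<in> ?M"
        by (intro generated_smul smooth_jet_funs_const)
      moreover have "smul (\<lambda>q. -1) (smul (\<lambda>q. -1) \<delta>) = \<delta>" for \<delta> :: "('x, 'n) vfield"
        by (simp add: smul_def)
      ultimately show ?thesis using pl(1,3) l by (auto simp: ad_tower split: if_splits)
    qed
  qed
  finally show ?case .
qed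

lemma Gam_eq_generated:
  assumes "j 1 = 0"
  shows "Gam A m j k = generated A m j (Gam_gens A m j k)"
proof -
  have "(\<Union>p\<in>{2..m}. {d_u A p (j p - l) | l. 1 \<le> j p \<and> l \<le> min k (j p - 1)}) = Gam_gens A m j k"
  proof (intro equalityI subsetI)
    fix \<gamma> assume "\<gamma> \<in> (\<Union>p\<in>{2..m}. {d_u A p (j p - l) | l. 1 \<le> j p \<and> l \<le> min k (j p - 1)})"
    then obtain p l where "p \<in> {2..m}" "1 \<le> j p" "l \<le> min k (j p - 1)" "\<gamma> = d_u A p (j p - l)"
      by auto
    then show "\<gamma> \<in> Gam_gens A m j k"
      unfolding Gam_gens_def by (intro CollectI exI[of _ p] exI[of _ l]) auto
  next
    fix \<gamma> assume "\<gamma> \<in> Gam_gens A m j k"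
    then obtain p l where *: "p \<in> {1..m}" "l \<le> k" "l < j p" "\<gamma> = d_u A p (j p - l)"
      by (auto simp: Gam_gens_def)
    then have "p \<noteq> 1" using assms by (metis not_less_zero)
    then show "\<gamma> \<in> (\<Union>p\<in>{2..m}. {d_u A p (j p - l) | l. 1 \<le> j p \<and> l \<le> min k (j p - 1)})"
      using * by (intro UN_I[of p] CollectI exI[of _ l]) auto
  qed
  then show ?thesis by (simp add: Gam_def generated_UN)
qed

lemma Delta_eq_generated:
  "Delta A m f j k = generated A m j (\<Union>p\<in>{1..m}. Delta_gens A m f j k p)"
  by (simp add: Delta_def generated_UN)

lemma G_eq_Gam_plus_Delta: "j 1 = 0 \<Longrightarrow> G A m f j k = Gam A m j k + Delta A m f j k"
  by (simp add: G_eq_generated Gam_eq_generated Delta_eq_generated G_gens_alt generated_Un)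

section \<open>Fibres and dimensions of the two summands\<close>

lemma fibre_generated: "fibre (generated A m j S) c z = coord.span ((\<lambda>\<gamma>. \<gamma> c z) ` S)"
proof
  show "fibre (generated A m j S) c z \<subseteq> coord.span ((\<lambda>\<gamma>. \<gamma> c z) ` S)"
  proof
    fix v assume "v \<in> fibre (generated A m j S) c z"
    then obtain T h where T: "T \<subseteq> S" "v = (\<lambda>a. \<Sum>\<gamma>\<in>T. h \<gamma> (jet_point c z) * \<gamma> c z a)"
      by (auto simp: fibre_def generated_def)
    then have "v = (\<Sum>\<gamma>\<in>T. (\<lambda>a. h \<gamma> (jet_point c z) * \<gamma> c z a))"
      by (simp add: fun_eq_iff sum_fun_apply)
    also have "\<dots> \<in> coord.span ((\<lambda>\<gamma>. \<gamma> c z) ` S)"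
      using T(1) by (intro coord.span_sum coord.span_scale coord.span_base) auto
    finally show "v \<in> coord.span ((\<lambda>\<gamma>. \<gamma> c z) ` S)" .
  qed
  show "coord.span ((\<lambda>\<gamma>. \<gamma> c z) ` S) \<subseteq> fibre (generated A m j S) c z"
  proof (rule coord.span_minimal)
    show "(\<lambda>\<gamma>. \<gamma> c z) ` S \<subseteq> fibre (generated A m j S) c z"
      by (auto simp: fibre_def intro: generated_base)
    show "coord.subspace (fibre (generated A m j S) c z)"
      unfolding coord.subspace_def
    proof (intro conjI ballI allI)
      have "(0 :: ('x, 'n) vfield) c z = 0" by simp
      then show "0 \<in> fibre (generated A m j S) c z"
        using generated_zero unfolding fibre_def by (metis image_eqI)
    next
      fix v w assume "v \<in> fibre (generated A m j S) c z" "w \<in> fibre (generated A m j S) c z"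
      then obtain \<gamma> \<delta> where *: "\<gamma> \<in> generated A m j S" "\<delta> \<in> generated A m j S" "v = \<gamma> c z" "w = \<delta> c z"
        by (auto simp: fibre_def)
      then have "v + w = (\<gamma> + \<delta>) c z" by simp
      then show "v + w \<in> fibre (generated A m j S) c z"
        using generated_add[OF *(1,2)] unfolding fibre_def by (rule image_eqI)
    next
      fix r :: real and v assume "v \<in> fibre (generated A m j S) c z"
      then obtain \<gamma> where *: "\<gamma> \<in> generated A m j S" "v = \<gamma> c z"
        by (auto simp: fibre_def)
      \<comment> \<open>Constants are smooth functions on the jet manifold, so real scaling of a
        value comes from scaling the field.\<close>
      then have "(\<lambda>a. r * v a) = smul (\<lambda>q. r) \<gamma> c z" by (simp add: smul_def)
      then show "(\<lambda>a. r * v a) \<in> fibre (generated A m j S) c z"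
        using generated_smul[OF smooth_jet_funs_const *(1)] unfolding fibre_def by (rule image_eqI)
    qed
  qed
qed

lemma fibre_Gam:
  assumes "j 1 = 0" "z \<in> jet_dom A c"
  shows "fibre (Gam A m j k) c z =
    coord.span (unit_vec ` {Uc p (j p - l) | p l. p \<in> {1..m} \<and> l \<le> k \<and> l < j p})"
proof -
  have "(\<lambda>\<gamma>. \<gamma> c z) ` Gam_gens A m j k =
      unit_vec ` {Uc p (j p - l) | p l. p \<in> {1..m} \<and> l \<le> k \<and> l < j p}"
    unfolding Gam_gens_def image_Collect by (auto simp: d_u_unit_vec[OF assms(2)]) (metis d_u_unit_vec[OF assms(2)])+
  then show ?thesis by (simp add: Gam_eq_generated[of j, OF assms(1)] fibre_generated)
qed

lemma fibre_dim_Gam: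
  assumes "j 1 = 0" "z \<in> jet_dom A c"
  shows "fibre_dim (Gam A m j k) c z = (\<Sum>p\<in>{1..m}. min (k + 1) (j p))"
proof -
  let ?B = "{Uc p (j p - l) | p l. p \<in> {1..m} \<and> l \<le> k \<and> l < j p} :: 'n coord set"
  have B: "?B = (\<lambda>(p, l). Uc p (j p - l)) ` (SIGMA p:{1..m}. {..<min (k + 1) (j p)})"
    by (force simp: image_iff)
  have fin: "finite ?B" unfolding B by (intro finite_imageI finite_SigmaI) auto
  have "card ?B = card (SIGMA p:{1..m}. {..<min (k + 1) (j p)})"
    unfolding B by (intro card_image) (auto simp: inj_on_def)
  then show ?thesis
    unfolding fibre_dim_def fibre_Gam[of j, OF assms] dim_span_unit_vec[OF fin] by simp
qed

text \<open>The u-components of an iterate are constant, so differentiating them gives zero. The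
  component of \<open>g0\<close> along \<open>Uc q r\<close> varies at most with
  \<open>Uc q (Suc r)\<close>, where an iterate has no component. Hence one bracket already removes
  all u-components.\<close>

lemma ad_pow_support:
  assumes "((ad_g0 A m f j ^^ s) (d_u A p 0)) c z a \<noteq> 0"
  shows "a \<in> range Xc \<or> s = 0 \<and> a = Uc p 0"
  using assms
proof (induction s arbitrary: z a)
  case 0
  then show ?case by (auto simp: d_u_def split: if_splits)
next
  case (Suc s)
  let ?\<gamma> = "(ad_g0 A m f j ^^ s) (d_u A p 0)"
  have "ad_g0 A m f j ?\<gamma> c z (Uc q r) = 0" for q r
  proof (cases "z \<in> jet_dom A c \<and> Uc q r \<in> (jet_coords m j :: 'n coord set)")
    case True
    then have z: "z \<in> jet_dom A c" by blast
    have "partial b (\<lambda>w. ?\<gamma> c w (Uc q r)) z = 0" for b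
    proof (cases "s = 0")
      case True
      then show ?thesis using z by (simp add: partial_d_u)
    next
      case False
      then have "?\<gamma> c w (Uc q r) = 0" for w using Suc.IH[of w "Uc q r"] by auto
      then show ?thesis by simp
    qed
    moreover have "?\<gamma> c z b * partial b (\<lambda>w. g0 A m f j c w (Uc q r)) z = 0" for b
      using Suc.IH[of z b] z by (auto simp: partial_g0_Uc)
    ultimately show ?thesis using True by (auto simp: ad_apply intro!: sum.neutral)
  next
    case False
    then show ?thesis by (simp only: ad_outside de_Morgan_conj)
  qed
  then show ?case using Suc.prems by (cases a) auto
qed

lemma Delta_gens_support:
  assumes "\<gamma> \<in> Delta_gens A m f j k p" "\<gamma> c z a \<noteq> 0"
  shows "a \<in> range Xc \<or> j p \<le> k \<and> a = Uc p 0"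
proof -
  obtain l where "j p \<le> l" "l \<le> k" "\<gamma> = (ad_g0 A m f j ^^ (l - j p)) (d_u A p 0)"
    using assms(1) unfolding Delta_gens_def by blast
  then show ?thesis using ad_pow_support[of "l - j p" j p c z a] assms(2) by auto
qed

lemma fibre_Delta:
  "fibre (Delta A m f j k) c z =
    coord.span ((\<lambda>\<gamma>. \<gamma> c z) ` (\<Union>p\<in>{1..m}. Delta_gens A m f j k p))"
  by (simp add: Delta_eq_generated fibre_generated)

lemma fibre_Delta_support:
  assumes "v \<in> fibre (Delta A m f j k) c z" "0 < r"
  shows "v (Uc p r) = 0"
  using assms(1) unfolding fibre_Delta
proof (rule span_support)
  fix w assume "w \<in> (\<lambda>\<gamma>. \<gamma> c z) ` (\<Union>p\<in>{1..m}. Delta_gens A m f j k p)"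
  then obtain q \<gamma> where "\<gamma> \<in> Delta_gens A m f j k q" "w = \<gamma> c z" by auto
  then show "w (Uc p r) = 0" using Delta_gens_support[of \<gamma> j k q c z "Uc p r"] assms(2) by auto
qed

lemma fibre_Gam_support:
  assumes "j 1 = 0" "z \<in> jet_dom A c" "v \<in> fibre (Gam A m j k) c z" "\<And>p r. 0 < r \<Longrightarrow> a \<noteq> Uc p r"
  shows "v a = 0"
  using assms(3) unfolding fibre_Gam[of j, OF assms(1,2)]
  by (rule span_support) (use assms(4) in \<open>auto simp: unit_vec_def\<close>)

text \<open>The two fibres have disjoint supports: coordinates \<open>Uc p r\<close> with r > 0 for
  \<open>Gam\<close>, the x-coordinates and the \<open>Uc p 0\<close> for
  \<open>Delta\<close>.\<close>

lemma direct_sum_G: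
  assumes "j 1 = 0"
  shows "direct_sum A (G A m f j k) (Gam A m j k) (Delta A m f j k)"
  unfolding direct_sum_def
proof (intro conjI allI ballI)
  show "G A m f j k = Gam A m j k + Delta A m f j k" using assms by (rule G_eq_Gam_plus_Delta)
  fix c z assume z: "z \<in> jet_dom A c"
  have "v = 0" if v: "v \<in> fibre (Gam A m j k) c z" "v \<in> fibre (Delta A m f j k) c z" for v
  proof
    fix a show "v a = 0 a"
    proof (cases "\<exists>p r. 0 < r \<and> a = Uc p r")
      case True
      then show ?thesis using fibre_Delta_support[OF v(2)] by auto
    next
      case False
      then have "v a = 0" by (intro fibre_Gam_support[of j, OF assms z v(1)]) blast
      then show ?thesis by simp
    qed
  qed
  moreover have "0 \<in> fibre (Gam A m j k) c z" "0 \<in> fibre (Delta A m f j k) c z"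
    unfolding fibre_Delta fibre_Gam[of j, OF assms z] by (rule coord.span_zero)+
  ultimately show "fibre (Gam A m j k) c z \<inter> fibre (Delta A m f j k) c z = {0}" by blast
qed

text \<open>Counts generators: l runs from j_p to k, and truncated subtraction gives 0 when k <
  j_p.\<close>

lemma fibre_dim_Delta_le_count:
  "fibre_dim (Delta A m f j k) c z \<le> (\<Sum>p\<in>{1..m}. k + 1 - j p)"
proof -
  let ?I = "SIGMA p:{1..m}. {j p..k}"
  let ?g = "\<lambda>(p, l). (ad_g0 A m f j ^^ (l - j p)) (d_u A p 0) c z"
  have fin: "finite ?I" by (intro finite_SigmaI) auto
  have "(\<lambda>\<gamma>. \<gamma> c z) ` (\<Union>p\<in>{1..m}. Delta_gens A m f j k p) \<subseteq> ?g ` ?I"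
    by (force simp: Delta_gens_def)
  then have "coord.dim (fibre (Delta A m f j k) c z) \<le> card (?g ` ?I)"
    unfolding fibre_Delta by (intro coord.dim_le_card coord.span_mono finite_imageI fin)
  also have "\<dots> \<le> card ?I" using fin by (rule card_image_le)
  also have "\<dots> = (\<Sum>p\<in>{1..m}. k + 1 - j p)" by simp
  finally show ?thesis by (simp add: fibre_dim_def)
qed

text \<open>Counts the coordinates available to the generators: n along X, and \<open>Uc p 0\<close>
  for each p whose tower has reached it by step k.\<close>

lemma fibre_dim_Delta_le_support:
  "fibre_dim (Delta A m f j k) c z \<le> CARD('n) + card {p\<in>{1..m}. j p \<le> k}"
proof -
  let ?B = "range Xc \<union> (\<lambda>p. Uc p 0) ` {p\<in>{1..m}. j p \<le> k} :: 'n coord set"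
  have "w \<in> coord.span (unit_vec ` ?B)"
    if w: "w \<in> (\<lambda>\<gamma>. \<gamma> c z) ` (\<Union>p\<in>{1..m}. Delta_gens A m f j k p)" for w
  proof (rule span_unit_vec)
    fix a assume a: "a \<notin> ?B"
    from w obtain p \<gamma> where p: "p \<in> {1..m}" "\<gamma> \<in> Delta_gens A m f j k p" "w = \<gamma> c z" by auto
    show "w a = 0"
    proof (rule ccontr)
      assume "w a \<noteq> 0"
      then show False using Delta_gens_support[OF p(2), of c z a] p a by auto
    qed
  qed auto
  then have "coord.dim (fibre (Delta A m f j k) c z) \<le> card (unit_vec ` ?B)"
    unfolding fibre_Delta by (intro coord.dim_le_card coord.span_minimal coord.subspace_span) auto
  also have "\<dots> \<le> card ?B" by (intro card_image_le) auto
  also have "\<dots> \<le> card (range Xc :: 'n coord set) + card ((\<lambda>p. Uc p 0) ` {p\<in>{1..m}. j p \<le> k} :: 'n coord set)"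
    by (rule card_Un_le)
  also have "\<dots> \<le> CARD('n) + card {p\<in>{1..m}. j p \<le> k}"
    by (intro add_mono card_image_le) auto
  finally show ?thesis by (simp add: fibre_dim_def)
qed

end

section \<open>Moving frames\<close>

interpretation dual: vector_space_pair "\<lambda>(r::real) (v :: 'c \<Rightarrow> real) a. r * v a" "(*) :: real \<Rightarrow> real \<Rightarrow> real"
  by unfold_locales (simp_all add: distrib_left distrib_right)

text \<open>Prescribe a functional on B and extend it linearly. On vectors supported in I it is
  determined by its values on unit vectors. Writing it as a finite sum over coordinates makes it
  compatible with coordinatewise limits and derivatives.\<close>

lemma exists_coord_functional:
  assumes "coord.independent B" "finite I" "\<And>v a. v \<in> B \<Longrightarrow> a \<notin> I \<Longrightarrow> v a = 0"
  shows "\<exists>k. \<forall>v\<in>B. (\<Sum>a\<in>I. k a * v a) = F v"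
proof -
  obtain g where g: "Vector_Spaces.linear (\<lambda>r v a. r * v a) (*) g" and gF: "\<forall>v\<in>B. g v = F v"
    using dual.linear_independent_extend[OF assms(1)] by blast
  interpret g: Vector_Spaces.linear "\<lambda>r v a. r * v a" "(*)" g by (rule g)
  have "(\<Sum>a\<in>I. g (unit_vec a) * v a) = F v" if "v \<in> B" for v
  proof -
    have "v = (\<Sum>b\<in>I. (\<lambda>a. v b * unit_vec b a))"
      by (rule unit_vec_expansion) (use assms(2,3) that in auto)
    then have "g v = g (\<Sum>b\<in>I. (\<lambda>a. v b * unit_vec b a))"
      by (rule arg_cong)
    also have "\<dots> = (\<Sum>b\<in>I. v b * g (unit_vec b))"
      by (simp add: g.sum g.scale)
    finally have "g v = (\<Sum>b\<in>I. v b * g (unit_vec b))" .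
    then show ?thesis using gF that by (simp add: mult.commute)
  qed
  then show ?thesis by (intro exI[of _ "\<lambda>a. g (unit_vec a)"]) blast
qed

text \<open>With functionals \<open>k\<^sub>i\<close> dual to the vectors \<open>e\<^sub>i\<close> in the limit, the Gram matrix \<open>k\<^sub>i(e\<^sub>j)\<close> tends
  to the identity, which controls the coefficients of a combination by its values under \<open>k\<^sub>i\<close>.\<close>

lemma frame_coefficients_bound:
  fixes e :: "'i \<Rightarrow> 't \<Rightarrow> 'c \<Rightarrow> real"
  assumes "finite J" "finite I"
    and supp: "\<And>i a. i \<in> J \<Longrightarrow> a \<notin> I \<Longrightarrow> e0 i a = 0"
    and lim: "\<And>i a. i \<in> J \<Longrightarrow> ((\<lambda>t. e i t a) \<longlongrightarrow> e0 i a) F"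
    and inj: "inj_on e0 J" and indep: "coord.independent (e0 ` J)"
  obtains k where "\<forall>\<^sub>F t in F. \<forall>b. (\<Sum>i\<in>J. \<bar>b i\<bar>) \<le>
    2 * (\<Sum>i\<in>J. \<bar>\<Sum>a\<in>I. k i a * (\<Sum>j\<in>J. b j * e j t a)\<bar>)"
proof -
  have "\<exists>k. \<forall>v\<in>e0 ` J. (\<Sum>a\<in>I. k a * v a) = (if v = e0 i then 1 else 0)" for i
    using exists_coord_functional[OF indep \<open>finite I\<close>, of "\<lambda>v. if v = e0 i then 1 else 0"] supp
    by blast
  then obtain k where k: "\<And>i v. v \<in> e0 ` J \<Longrightarrow> (\<Sum>a\<in>I. k i a * v a) = (if v = e0 i then 1 else 0)"
    by metis
  define M where "M i j t = (\<Sum>a\<in>I. k i a * e j t a)" for i j t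
  define Id :: "'i \<Rightarrow> 'i \<Rightarrow> real" where "Id i j = (if i = j then 1 else 0)" for i j
  have M: "((\<lambda>t. M i j t) \<longlongrightarrow> Id i j) F" if "i \<in> J" "j \<in> J" for i j
  proof -
    have "(\<Sum>a\<in>I. k i a * e0 j a) = Id i j"
      using k[of "e0 j" i] that inj by (auto simp: Id_def inj_on_def)
    moreover have "((\<lambda>t. M i j t) \<longlongrightarrow> (\<Sum>a\<in>I. k i a * e0 j a)) F"
      unfolding M_def by (intro tendsto_intros lim that)
    ultimately show ?thesis by simp
  qed
  have "((\<lambda>t. \<Sum>i\<in>J. \<Sum>j\<in>J. \<bar>M i j t - Id i j\<bar>) \<longlongrightarrow> (\<Sum>i\<in>J. \<Sum>j\<in>J. \<bar>Id i j - Id i j\<bar>)) F"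
    by (intro tendsto_intros M)
  then have "((\<lambda>t. \<Sum>i\<in>J. \<Sum>j\<in>J. \<bar>M i j t - Id i j\<bar>) \<longlongrightarrow> 0) F"
    by simp
  \<comment> \<open>Below 1/2 the error is at most half the sum of the \<bar>b i\<bar> and can be
    absorbed on the left, whence the factor 2.\<close>
  then have "\<forall>\<^sub>F t in F. (\<Sum>i\<in>J. \<Sum>j\<in>J. \<bar>M i j t - Id i j\<bar>) < 1 / 2"
    by (rule order_tendstoD) simp
  then have "\<forall>\<^sub>F t in F. \<forall>b. (\<Sum>i\<in>J. \<bar>b i\<bar>) \<le>
      2 * (\<Sum>i\<in>J. \<bar>\<Sum>a\<in>I. k i a * (\<Sum>j\<in>J. b j * e j t a)\<bar>)"
  proof eventually_elim
    case (elim t)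
    show ?case
    proof
      fix b :: "'i \<Rightarrow> real"
      let ?\<beta> = "\<Sum>i\<in>J. \<bar>b i\<bar>"
      let ?P = "\<lambda>i. \<Sum>a\<in>I. k i a * (\<Sum>j\<in>J. b j * e j t a)"
      have bound: "\<bar>b i\<bar> \<le> \<bar>?P i\<bar> + (\<Sum>j\<in>J. \<bar>M i j t - Id i j\<bar>) * ?\<beta>" if "i \<in> J" for i
      proof -
        have "?P i = (\<Sum>j\<in>J. b j * M i j t)"
          unfolding M_def sum_distrib_left by (subst sum.swap) (simp add: mult_ac)
        moreover have "(\<Sum>j\<in>J. b j * Id i j) = b i"
        proof -
          have "(\<Sum>j\<in>J. b j * Id i j) = (\<Sum>j\<in>J. if i = j then b j else 0)"
            by (intro sum.cong) (auto simp: Id_def)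
          then show ?thesis using \<open>finite J\<close> that by simp
        qed
        ultimately have "b i = ?P i - (\<Sum>j\<in>J. b j * (M i j t - Id i j))"
          by (simp add: right_diff_distrib sum_subtractf)
        then have "\<bar>b i\<bar> \<le> \<bar>?P i\<bar> + \<bar>\<Sum>j\<in>J. b j * (M i j t - Id i j)\<bar>" by linarith
        also have "\<bar>\<Sum>j\<in>J. b j * (M i j t - Id i j)\<bar> \<le> (\<Sum>j\<in>J. \<bar>M i j t - Id i j\<bar> * ?\<beta>)"
        proof (rule order_trans[OF sum_abs sum_mono])
          fix j assume "j \<in> J"
          then have "\<bar>b j\<bar> \<le> ?\<beta>" using \<open>finite J\<close> by (intro member_le_sum) auto
          then have "\<bar>M i j t - Id i j\<bar> * \<bar>b j\<bar> \<le> \<bar>M i j t - Id i j\<bar> * ?\<beta>"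
            by (rule mult_left_mono) simp
          then show "\<bar>b j * (M i j t - Id i j)\<bar> \<le> \<bar>M i j t - Id i j\<bar> * ?\<beta>"
            by (simp only: abs_mult mult.commute[of "\<bar>b j\<bar>"])
        qed
        finally show ?thesis by (simp add: sum_distrib_right)
      qed
      have "?\<beta> \<le> (\<Sum>i\<in>J. \<bar>?P i\<bar> + (\<Sum>j\<in>J. \<bar>M i j t - Id i j\<bar>) * ?\<beta>)"
        by (intro sum_mono bound)
      also have "\<dots> = (\<Sum>i\<in>J. \<bar>?P i\<bar>) + (\<Sum>i\<in>J. \<Sum>j\<in>J. \<bar>M i j t - Id i j\<bar>) * ?\<beta>"
        by (simp add: sum.distrib sum_distrib_right)
      also have "(\<Sum>i\<in>J. \<Sum>j\<in>J. \<bar>M i j t - Id i j\<bar>) * ?\<beta> \<le> 1 / 2 * ?\<beta>"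
        using elim by (intro mult_right_mono sum_nonneg) auto
      finally show "?\<beta> \<le> 2 * (\<Sum>i\<in>J. \<bar>?P i\<bar>)" by simp
    qed
  qed
  then show thesis by (rule that)
qed

text \<open>Independence is an open condition: by the coefficient bound, a vanishing combination of
  the nearby vectors has vanishing coefficients.\<close>

lemma frame_eventually_independent:
  fixes e :: "'i \<Rightarrow> 't \<Rightarrow> 'c \<Rightarrow> real"
  assumes "finite J" "finite I"
    and supp: "\<And>i a. i \<in> J \<Longrightarrow> a \<notin> I \<Longrightarrow> e0 i a = 0"
    and lim: "\<And>i a. i \<in> J \<Longrightarrow> ((\<lambda>t. e i t a) \<longlongrightarrow> e0 i a) F"
    and inj: "inj_on e0 J" and indep: "coord.independent (e0 ` J)"
  shows "\<forall>\<^sub>F t in F. inj_on (\<lambda>i. e i t) J \<and> coord.independent ((\<lambda>i. e i t) ` J)"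
proof -
  obtain k where "\<forall>\<^sub>F t in F. \<forall>b. (\<Sum>i\<in>J. \<bar>b i\<bar>) \<le>
    2 * (\<Sum>i\<in>J. \<bar>\<Sum>a\<in>I. k i a * (\<Sum>j\<in>J. b j * e j t a)\<bar>)"
    by (rule frame_coefficients_bound[OF assms])
  then show ?thesis
  proof eventually_elim
    case (elim t)
    have zero: "b i = 0" if "\<And>a. (\<Sum>j\<in>J. b j * e j t a) = 0" "i \<in> J" for b i
    proof -
      have "(\<Sum>i\<in>J. \<bar>b i\<bar>) \<le> 0" using elim[rule_format, of b] that(1) by simp
      moreover have "\<bar>b i\<bar> \<le> (\<Sum>i\<in>J. \<bar>b i\<bar>)"
        using \<open>finite J\<close> that(2) by (intro member_le_sum) auto
      ultimately show ?thesis by linarith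
    qed
    have inj': "inj_on (\<lambda>i. e i t) J"
    proof (rule inj_onI, rule ccontr)
      fix i i' assume i: "i \<in> J" "i' \<in> J" "e i t = e i' t" "i \<noteq> i'"
      \<comment> \<open>A coincidence of two frame vectors is a relation with coefficients 1 and
        -1.\<close>
      define b :: "'i \<Rightarrow> real" where "b l = (if l = i then 1 else 0) - (if l = i' then 1 else 0)" for l
      have "(\<Sum>j\<in>J. b j * e j t a) =
          (\<Sum>j\<in>J. if j = i then e j t a else 0) - (\<Sum>j\<in>J. if j = i' then e j t a else 0)" for a
        unfolding sum_subtractf[symmetric] by (intro sum.cong) (auto simp: b_def)
      then have "(\<Sum>j\<in>J. b j * e j t a) = 0" for a
        using \<open>finite J\<close> i by simp
      from zero[OF this i(1)] show False using i(4) by (simp add: b_def)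
    qed
    moreover have "coord.independent ((\<lambda>i. e i t) ` J)"
    proof (rule coord.independent_if_scalars_zero)
      fix c :: "('c \<Rightarrow> real) \<Rightarrow> real" and x
      assume 0: "(\<Sum>x\<in>(\<lambda>i. e i t) ` J. (\<lambda>a. c x * x a)) = 0" and "x \<in> (\<lambda>i. e i t) ` J"
      then obtain i where i: "i \<in> J" "x = e i t" by auto
      have "(\<Sum>j\<in>J. c (e j t) * e j t a) = 0" for a
        using fun_cong[OF 0, of a] by (simp add: sum.reindex[OF inj'] sum_fun_apply)
      from zero[OF this i(1)] show "c x = 0" by (simp add: i(2))
    qed (use \<open>finite J\<close> in simp)
    ultimately show ?case by blast
  qed
qed

text \<open>If a curve vanishing at \<open>s\<close> is a combination of a moving frame, then its coefficients are \<open>o(1)\<close>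
  at \<open>s\<close>, so that functionals killing the frame at \<open>s\<close> are \<open>o(t - s)\<close> along the curve.\<close>

lemma derivative_in_span:
  fixes e :: "'i \<Rightarrow> real \<Rightarrow> 'c \<Rightarrow> real"
  assumes "finite J" "finite I"
    and supp: "\<And>i a. i \<in> J \<Longrightarrow> a \<notin> I \<Longrightarrow> e i s a = 0" and supp': "\<And>a. a \<notin> I \<Longrightarrow> \<delta>' a = 0"
    and de: "\<And>i a. i \<in> J \<Longrightarrow> ((\<lambda>t. e i t a) has_real_derivative e' i a) (at s)"
    and d\<delta>: "\<And>a. ((\<lambda>t. \<delta> t a) has_real_derivative \<delta>' a) (at s)"
    and inj: "inj_on (\<lambda>i. e i s) J" and indep: "coord.independent ((\<lambda>i. e i s) ` J)"
    and comb: "\<forall>\<^sub>F t in at s. \<exists>b. \<forall>a. \<delta> t a = (\<Sum>i\<in>J. b i * e i t a)"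
    and zero: "\<And>a. \<delta> s a = 0"
  shows "\<delta>' \<in> coord.span ((\<lambda>i. e i s) ` J)"
proof (rule ccontr)
  assume no: "\<delta>' \<notin> coord.span ((\<lambda>i. e i s) ` J)"
  have ne: "e i s \<noteq> \<delta>'" if "i \<in> J" for i
    using no coord.span_base[of "e i s" "(\<lambda>i. e i s) ` J"] that by auto
  have "coord.independent (insert \<delta>' ((\<lambda>i. e i s) ` J))"
    using no indep by (rule coord.independent_insertI)
  \<comment> \<open>If \<delta>' were outside the span, some functional would be 1 on \<delta>' and
    0 on the frame at s.\<close>
  from exists_coord_functional[OF this \<open>finite I\<close>, of "\<lambda>v. if v = \<delta>' then 1 else 0"]
  obtain \<nu> where \<nu>: "\<forall>v\<in>insert \<delta>' ((\<lambda>i. e i s) ` J). (\<Sum>a\<in>I. \<nu> a * v a) = (if v = \<delta>' then 1 else 0)"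
    using supp supp' by blast
  have lim_e: "((\<lambda>t. e i t a) \<longlongrightarrow> e i s a) (at s)" if "i \<in> J" for i a
    using DERIV_isCont[OF de[OF that]] by (simp add: isCont_def)
  obtain k where k: "\<forall>\<^sub>F t in at s. \<forall>b. (\<Sum>i\<in>J. \<bar>b i\<bar>) \<le>
      2 * (\<Sum>i\<in>J. \<bar>\<Sum>a\<in>I. k i a * (\<Sum>j\<in>J. b j * e j t a)\<bar>)"
    by (rule frame_coefficients_bound[OF assms(1,2) supp lim_e inj indep])
  define P where "P t = 2 * (\<Sum>i\<in>J. \<bar>\<Sum>a\<in>I. k i a * \<delta> t a\<bar>)" for t
  define L where "L t = (\<Sum>a\<in>I. \<nu> a * \<delta> t a)" for t
  define \<Lambda> where "\<Lambda> i t = (\<Sum>a\<in>I. \<nu> a * e i t a)" for i t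
  have "(\<lambda>t. \<delta> t a) \<midarrow>s\<rightarrow> 0" for a
    using DERIV_isCont[OF d\<delta>[of a]] zero by (simp add: isCont_def)
  then have "(P \<longlongrightarrow> 2 * (\<Sum>i\<in>J. \<bar>\<Sum>a\<in>I. k i a * 0\<bar>)) (at s)"
    unfolding P_def by (intro tendsto_intros)
  then have P: "(P \<longlongrightarrow> 0) (at s)" by simp
  have "(L has_real_derivative (\<Sum>a\<in>I. \<nu> a * \<delta>' a)) (at s)"
    unfolding L_def by (intro DERIV_sum DERIV_cmult d\<delta>)
  then have "(L has_real_derivative 1) (at s)" using \<nu> by simp
  then have L: "((\<lambda>t. L t / (t - s)) \<longlongrightarrow> 1) (at s)"
    using zero by (simp add: has_field_derivative_iff L_def)
  have \<Lambda>: "((\<lambda>t. \<Lambda> i t / (t - s)) \<longlongrightarrow> (\<Sum>a\<in>I. \<nu> a * e' i a)) (at s)" if "i \<in> J" for i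
  proof -
    have "(\<Lambda> i has_real_derivative (\<Sum>a\<in>I. \<nu> a * e' i a)) (at s)"
      unfolding \<Lambda>_def by (intro DERIV_sum DERIV_cmult de that)
    moreover have "\<Lambda> i s = 0" using \<nu> ne that by (simp add: \<Lambda>_def)
    ultimately show ?thesis by (simp add: has_field_derivative_iff)
  qed
  have "((\<lambda>t. P t * (\<Sum>i\<in>J. \<bar>\<Lambda> i t / (t - s)\<bar>)) \<longlongrightarrow> 0 * (\<Sum>i\<in>J. \<bar>\<Sum>a\<in>I. \<nu> a * e' i a\<bar>)) (at s)"
    by (intro tendsto_intros P \<Lambda>)
  then have bound: "((\<lambda>t. P t * (\<Sum>i\<in>J. \<bar>\<Lambda> i t / (t - s)\<bar>)) \<longlongrightarrow> 0) (at s)" by simp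
  \<comment> \<open>The quotient tends to 1 by the choice of \<nu>. It is also bounded by
    coefficients tending to 0 times difference quotients of the frame, which converge; this is the
    contradiction.\<close>
  have "\<forall>\<^sub>F t in at s. norm (L t / (t - s)) \<le> P t * (\<Sum>i\<in>J. \<bar>\<Lambda> i t / (t - s)\<bar>)"
    using k comb
  proof eventually_elim
    case (elim t)
    then obtain b where b: "\<And>a. \<delta> t a = (\<Sum>i\<in>J. b i * e i t a)" by blast
    have "(\<Sum>i\<in>J. \<bar>b i\<bar>) \<le> P t" using elim(1) by (simp add: P_def b)
    have bi: "\<bar>b i\<bar> \<le> P t" if "i \<in> J" for i
    proof -
      have "\<bar>b i\<bar> \<le> (\<Sum>i\<in>J. \<bar>b i\<bar>)" using \<open>finite J\<close> that by (intro member_le_sum) auto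
      then show ?thesis using \<open>(\<Sum>i\<in>J. \<bar>b i\<bar>) \<le> P t\<close> by linarith
    qed
    have "L t = (\<Sum>i\<in>J. b i * \<Lambda> i t)"
      unfolding L_def \<Lambda>_def b sum_distrib_left by (subst sum.swap) (simp add: mult_ac)
    then have "\<bar>L t / (t - s)\<bar> = \<bar>\<Sum>i\<in>J. b i * (\<Lambda> i t / (t - s))\<bar>"
      by (simp add: sum_divide_distrib)
    also have "\<dots> \<le> (\<Sum>i\<in>J. P t * \<bar>\<Lambda> i t / (t - s)\<bar>)"
    proof (rule order_trans[OF sum_abs sum_mono])
      fix i assume "i \<in> J"
      then show "\<bar>b i * (\<Lambda> i t / (t - s))\<bar> \<le> P t * \<bar>\<Lambda> i t / (t - s)\<bar>"
        unfolding abs_mult by (intro mult_right_mono bi) auto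
    qed
    finally show ?case by (simp add: sum_distrib_left)
  qed
  then have "((\<lambda>t. L t / (t - s)) \<longlongrightarrow> 0) (at s)"
    by (rule Lim_null_comparison[OF _ bound])
  from tendsto_unique[OF _ this L] show False by simp
qed

lemma span_image_finite:
  assumes "finite J" "inj_on e J"
  shows "v \<in> coord.span (e ` J) \<longleftrightarrow> (\<exists>b. \<forall>a. v a = (\<Sum>i\<in>J. b i * e i a))"
proof
  assume "v \<in> coord.span (e ` J)"
  then obtain u where "v = (\<Sum>x\<in>e ` J. (\<lambda>a. u x * x a))"
    using assms(1) by (auto simp: coord.span_finite)
  then have "v a = (\<Sum>i\<in>J. u (e i) * e i a)" for a
    by (simp add: sum.reindex[OF assms(2)] sum_fun_apply)
  then show "\<exists>b. \<forall>a. v a = (\<Sum>i\<in>J. b i * e i a)" by (intro exI[of _ "\<lambda>i. u (e i)"]) blast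
next
  assume "\<exists>b. \<forall>a. v a = (\<Sum>i\<in>J. b i * e i a)"
  then obtain b where "\<And>a. v a = (\<Sum>i\<in>J. b i * e i a)" by blast
  then have "v = (\<Sum>i\<in>J. (\<lambda>a. b i * e i a))" by (simp add: fun_eq_iff sum_fun_apply)
  also have "\<dots> \<in> coord.span (e ` J)"
    by (intro coord.span_sum coord.span_scale coord.span_base) auto
  finally show "v \<in> coord.span (e ` J)" .
qed

section \<open>Brackets of fields lying pointwise in a distribution of constant rank\<close>

context jet_system
begin

text \<open>The field \<gamma> is only known to lie pointwise in the span of S, without smooth
  coefficients, so the Leibniz rule does not apply to it directly. It is split into a member
  \<epsilon> of the module, for which it does apply, and a remainder \<delta> vanishing at w0,
  treated by \<open>derivative_in_span\<close>.\<close>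

lemma ad_in_span_of_constant_rank:
  assumes S: "\<And>\<gamma>. \<gamma> \<in> S \<Longrightarrow> smooth_vfield A m j \<gamma>" and "finite S"
    and \<gamma>: "smooth_vfield A m j \<gamma>" and w0: "w0 \<in> jet_dom A c"
    and near: "\<forall>\<^sub>F w in nhds w0. coord.dim ((\<lambda>\<gamma>. \<gamma> c w) ` S) = coord.dim ((\<lambda>\<gamma>. \<gamma> c w0) ` S)
      \<and> \<gamma> c w \<in> coord.span ((\<lambda>\<gamma>. \<gamma> c w) ` S)"
  shows "ad_g0 A m f j \<gamma> c w0 \<in> coord.span ((\<lambda>\<gamma>. \<gamma> c w0) ` (S \<union> ad_g0 A m f j ` S))"
proof -
  let ?V = "\<lambda>w. (\<lambda>\<gamma>. \<gamma> c w) ` S"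
  have "\<gamma> c w0 \<in> fibre (generated A m j S) c w0"
    using eventually_nhds_x_imp_x[OF near] by (simp add: fibre_generated)
  then obtain \<epsilon> where \<epsilon>: "\<epsilon> \<in> generated A m j S" "\<epsilon> c w0 = \<gamma> c w0"
    by (auto simp: fibre_def)
  have smooth_\<epsilon>: "smooth_vfield A m j \<epsilon>" using smooth_vfield_generated[OF S \<epsilon>(1)] .
  define \<delta> where "\<delta> = \<gamma> + smul (\<lambda>q. -1) \<epsilon>"
  have smooth_\<delta>: "smooth_vfield A m j \<delta>"
    unfolding \<delta>_def by (intro smooth_vfield_add smooth_vfield_smul smooth_jet_funs_const \<gamma> smooth_\<epsilon>)
  have \<delta>_apply: "\<delta> c w a = \<gamma> c w a - \<epsilon> c w a" for w a
    by (simp add: \<delta>_def smul_def)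
  have \<gamma>_eq: "\<gamma> = \<delta> + \<epsilon>" by (simp add: \<delta>_def smul_def fun_eq_iff)
  have \<delta>_zero: "\<delta> c w0 a = 0" for a by (simp add: \<delta>_apply \<epsilon>(2))
  have \<delta>_span: "\<delta> c w \<in> coord.span (?V w)" if "\<gamma> c w \<in> coord.span (?V w)" for w
  proof -
    have "\<epsilon> c w \<in> fibre (generated A m j S) c w" using \<epsilon>(1) by (auto simp: fibre_def)
    then have "\<epsilon> c w \<in> coord.span (?V w)" by (simp add: fibre_generated)
    from coord.span_diff[OF that this] show ?thesis
      by (simp add: \<delta>_def smul_def plus_fun_def fun_diff_def)
  qed
  obtain B where B: "B \<subseteq> ?V w0" "coord.independent B" "?V w0 \<subseteq> coord.span B"
      "card B = coord.dim (?V w0)"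
    by (rule coord.basis_exists)
  \<comment> \<open>Fields of S whose values at w0 form a basis; near w0 they are the moving
    frame.\<close>
  obtain J where J: "J \<subseteq> S" "inj_on (\<lambda>\<gamma>. \<gamma> c w0) J" "B = (\<lambda>\<gamma>. \<gamma> c w0) ` J"
    using B(1) by (auto simp: subset_image_inj)
  have "finite J" using J(1) \<open>finite S\<close> by (rule finite_subset)
  have card_J: "card J = coord.dim (?V w0)"
    using B(4) J(2,3) by (simp add: card_image)
  have ad_\<epsilon>: "ad_g0 A m f j \<epsilon> c w0 \<in> coord.span ((\<lambda>\<gamma>. \<gamma> c w0) ` (S \<union> ad_g0 A m f j ` S))"
  proof -
    have "0 + ad_g0 A m f j \<epsilon> \<in> generated A m j S + ad_g0 A m f j ` generated A m j S"
      by (intro set_plus_intro generated_zero imageI \<epsilon>(1))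
    then have "ad_g0 A m f j \<epsilon> \<in> generated A m j (S \<union> ad_g0 A m f j ` S)"
      by (simp add: generated_plus_ad[OF S])
    then have "ad_g0 A m f j \<epsilon> c w0 \<in> fibre (generated A m j (S \<union> ad_g0 A m f j ` S)) c w0"
      unfolding fibre_def by (rule imageI)
    then show ?thesis by (simp only: fibre_generated)
  qed
  have partial_\<delta>: "(\<lambda>a. partial b (\<lambda>w. \<delta> c w a) w0) \<in> coord.span (?V w0)" for b
  proof -
    let ?s = "w0 b" and ?e = "\<lambda>\<eta> t. \<eta> c (w0(b := t))"
    have der: "((\<lambda>t. \<eta> c (w0(b := t)) a) has_real_derivative partial b (\<lambda>w. \<eta> c w a) w0) (at ?s)"
      if "smooth_vfield A m j \<eta>" for \<eta> a
      using smooth_vfieldD(4)[OF that w0, of b a] by (simp add: line_differentiable_iff_DERIV)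
    have J_smooth: "smooth_vfield A m j \<eta>" if "\<eta> \<in> J" for \<eta> using S J(1) that by blast
    have lim: "((\<lambda>t. ?e \<eta> t a) \<longlongrightarrow> \<eta> c w0 a) (at ?s)" if "\<eta> \<in> J" for \<eta> a
      using DERIV_isCont[OF der[OF J_smooth[OF that], of a]] by (simp add: isCont_def)
    have "\<forall>\<^sub>F t in at ?s. inj_on (\<lambda>\<eta>. ?e \<eta> t) J \<and> coord.independent ((\<lambda>\<eta>. ?e \<eta> t) ` J)"
      by (rule frame_eventually_independent[OF \<open>finite J\<close> finite_jet_coords[of m j], of "\<lambda>\<eta>. \<eta> c w0"])
        (use J(2,3) B(2) lim smooth_vfieldD(3)[OF J_smooth] in auto)
    moreover have "\<forall>\<^sub>F t in at ?s. coord.dim (?V (w0(b := t))) = coord.dim (?V w0) \<and>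
        \<gamma> c (w0(b := t)) \<in> coord.span (?V (w0(b := t)))"
      using eventually_fun_upd[OF near, of b] unfolding eventually_at_filter
      by (rule eventually_mono) blast
    ultimately have "\<forall>\<^sub>F t in at ?s. \<exists>u. \<forall>a. \<delta> c (w0(b := t)) a = (\<Sum>\<eta>\<in>J. u \<eta> * ?e \<eta> t a)"
    proof eventually_elim
      case (elim t)
      let ?w = "w0(b := t)"
      have fin: "finite (?V ?w)" using \<open>finite S\<close> by simp
      have sub: "coord.span ((\<lambda>\<eta>. \<eta> c ?w) ` J) \<subseteq> coord.span (?V ?w)"
        using J(1) by (intro coord.span_mono image_mono)
      \<comment> \<open>The frame remains independent, and its size is the rank of S at w0, hence by
        constant rank also at \<open>?w\<close>; so it spans there too.\<close>
      have "coord.dim (coord.span ((\<lambda>\<eta>. \<eta> c ?w) ` J)) = card J"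
        using elim(1) by (simp add: coord.dim_eq_card_independent card_image)
      then have "coord.span ((\<lambda>\<eta>. \<eta> c ?w) ` J) = coord.span (?V ?w)"
        using elim(2) card_J
        by (intro finite_span_subspaces(2)[OF coord.subspace_span sub subset_refl fin]) simp
      then have "\<delta> c ?w \<in> coord.span ((\<lambda>\<eta>. \<eta> c ?w) ` J)"
        using \<delta>_span elim(2) by blast
      then show ?case using span_image_finite[OF \<open>finite J\<close>, of "\<lambda>\<eta>. \<eta> c ?w"] elim(1) by blast
    qed
    then have "(\<lambda>a. partial b (\<lambda>w. \<delta> c w a) w0) \<in> coord.span ((\<lambda>\<eta>. ?e \<eta> ?s) ` J)"
    proof (rule derivative_in_span[OF \<open>finite J\<close> finite_jet_coords[of m j], rotated -2])
      show "((\<lambda>t. ?e \<eta> t a) has_real_derivative partial b (\<lambda>w. \<eta> c w a) w0) (at ?s)" if "\<eta> \<in> J" for \<eta> a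
        using der J_smooth that by blast
      show "((\<lambda>t. \<delta> c (w0(b := t)) a) has_real_derivative partial b (\<lambda>w. \<delta> c w a) w0) (at ?s)" for a
        using der smooth_\<delta> by blast
      show "partial b (\<lambda>w. \<delta> c w a) w0 = 0" if "a \<notin> jet_coords m j" for a
        using smooth_vfieldD(3)[OF smooth_\<delta> that] by simp
      show "?e \<eta> ?s a = 0" if "\<eta> \<in> J" "a \<notin> jet_coords m j" for \<eta> a
        using smooth_vfieldD(3)[OF J_smooth] that by blast
    qed (use J(2,3) B(2) \<delta>_zero in simp_all)
    also have "\<dots> \<subseteq> coord.span (?V w0)"
      using J(1) by (intro coord.span_mono) auto
    finally show ?thesis .
  qed
  \<comment> \<open>Since \<delta> vanishes at w0, the bracket terms that differentiate
    \<open>g0\<close> disappear.\<close>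
  have "ad_g0 A m f j \<delta> c w0 = (\<Sum>b\<in>jet_coords m j. (\<lambda>a. g0 A m f j c w0 b * partial b (\<lambda>w. \<delta> c w a) w0))"
  proof
    fix a
    show "ad_g0 A m f j \<delta> c w0 a =
        (\<Sum>b\<in>jet_coords m j. (\<lambda>a. g0 A m f j c w0 b * partial b (\<lambda>w. \<delta> c w a) w0)) a"
    proof (cases "a \<in> jet_coords m j")
      case True
      then show ?thesis using w0 by (simp add: ad_apply \<delta>_zero sum_fun_apply)
    next
      case False
      then show ?thesis by (simp add: ad_outside smooth_vfieldD(3)[OF smooth_\<delta>] sum_fun_apply)
    qed
  qed
  also have "\<dots> \<in> coord.span (?V w0)"
    by (intro coord.span_sum coord.span_scale partial_\<delta>)
  also have "\<dots> \<subseteq> coord.span ((\<lambda>\<gamma>. \<gamma> c w0) ` (S \<union> ad_g0 A m f j ` S))"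
    by (intro coord.span_mono) auto
  finally have "ad_g0 A m f j \<delta> c w0 + ad_g0 A m f j \<epsilon> c w0 \<in>
      coord.span ((\<lambda>\<gamma>. \<gamma> c w0) ` (S \<union> ad_g0 A m f j ` S))"
    using ad_\<epsilon> by (rule coord.span_add)
  moreover have "ad_g0 A m f j \<gamma> = ad_g0 A m f j \<delta> + ad_g0 A m f j \<epsilon>"
    using ad_add[OF smooth_\<delta> smooth_\<epsilon>] by (simp only: \<gamma>_eq[symmetric])
  ultimately show ?thesis by simp
qed

end

section \<open>Stationarity and truncation of the jets\<close>

context jet_system
begin

lemma finite_gens_at: "finite ((\<lambda>\<gamma>. \<gamma> c z) ` G_gens A m f j k)"
  by (intro finite_imageI finite_G_gens)

lemma fibre_G: "fibre (G A m f j k) c z = coord.span ((\<lambda>\<gamma>. \<gamma> c z) ` G_gens A m f j k)"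
  by (simp add: G_eq_generated fibre_generated)

lemma fibre_G_mono: "k \<le> k' \<Longrightarrow> fibre (G A m f j k) c z \<subseteq> fibre (G A m f j k') c z"
  unfolding fibre_G by (intro coord.span_mono image_mono G_gens_mono)

lemma fibre_dim_G_mono: "k \<le> k' \<Longrightarrow> fibre_dim (G A m f j k) c z \<le> fibre_dim (G A m f j k') c z"
  unfolding fibre_dim_def
  by (rule finite_span_subspaces(1)[OF _ fibre_G_mono _ finite_gens_at[of c z j k']])
    (simp_all add: fibre_G)

lemma fibre_G_eqI:
  assumes "k \<le> k'" "fibre_dim (G A m f j k) c z = fibre_dim (G A m f j k') c z"
  shows "fibre (G A m f j k) c z = fibre (G A m f j k') c z"
  using assms(2) unfolding fibre_dim_def
  by (rule finite_span_subspaces(2)[OF _ fibre_G_mono[OF assms(1)] _ finite_gens_at[of c z j k'], rotated -1])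
    (simp_all add: fibre_G)

lemma card_jet_coords:
  "card (jet_coords m j :: 'n coord set) = CARD('n) + m + (\<Sum>p\<in>{1..m}. j p)"
proof -
  have "card (jet_coords m j :: 'n coord set) = (\<Sum>b\<in>(jet_coords m j :: 'n coord set). 1)" by simp
  also have "\<dots> = CARD('n) + (\<Sum>p\<in>{1..m}. j p + 1)"
    unfolding sum_jet_coords by simp
  finally show ?thesis by (simp add: sum_Suc)
qed

lemma fibre_dim_G_le: "fibre_dim (G A m f j k) c z \<le> CARD('n) + m + (\<Sum>p\<in>{1..m}. j p)"
proof -
  have "w \<in> coord.span (unit_vec ` jet_coords m j)" if "w \<in> (\<lambda>\<gamma>. \<gamma> c z) ` G_gens A m f j k" for w
    using that smooth_vfieldD(3)[OF smooth_G_gens] by (intro span_unit_vec finite_jet_coords) blast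
  then have "coord.dim (fibre (G A m f j k) c z) \<le> card (unit_vec ` (jet_coords m j :: 'n coord set))"
    unfolding fibre_G by (intro coord.dim_le_card coord.span_minimal coord.subspace_span) auto
  also have "\<dots> = CARD('n) + m + (\<Sum>p\<in>{1..m}. j p)"
    by (simp only: card_image[OF inj_unit_vec] card_jet_coords)
  finally show ?thesis by (simp add: fibre_dim_def)
qed

lemma fibre_dim_G_0:
  assumes "z \<in> jet_dom A c"
  shows "fibre_dim (G A m f j 0) c z = m"
proof -
  let ?B = "(\<lambda>p. Uc p (j p)) ` {1..m} :: 'n coord set"
  have "tower A m f j p 0 = d_u A p (j p)" for p by (simp add: tower_def)
  then have "(\<lambda>\<gamma>. \<gamma> c z) ` G_gens A m f j 0 = unit_vec ` ?B"
    using assms unfolding G_gens_def by (auto simp: d_u_unit_vec image_iff)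
      (metis atLeastAtMost_iff d_u_unit_vec)
  moreover have "card ?B = m" by (subst card_image) (auto simp: inj_on_def)
  moreover have "finite ?B" by simp
  ultimately show ?thesis by (simp only: fibre_dim_def fibre_G dim_span_unit_vec)
qed

text \<open>The dimensions are bounded and nondecreasing in k; from an index of maximal dimension
  on, nested fibres of equal dimension coincide.\<close>

lemma stationary_exists: "\<exists>K. stationary_from A m f j c z K"
proof -
  let ?d = "\<lambda>k. fibre_dim (G A m f j k) c z"
  have "\<exists>K. \<forall>k. ?d k \<le> ?d K"
    using ex_has_greatest_nat[of "\<lambda>k. True" 0 ?d "Suc (CARD('n) + m + (\<Sum>p\<in>{1..m}. j p))"]
      fibre_dim_G_le[of j _ c z] by (auto simp: less_Suc_eq_le)
  then obtain K where K: "\<And>k. ?d k \<le> ?d K" by blast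
  have "fibre (G A m f j K) c z = fibre (G A m f j k) c z" if "K \<le> k" for k
    using that K[of k] fibre_dim_G_mono[OF that, of j c z] by (intro fibre_G_eqI) auto
  then show ?thesis unfolding stationary_from_def by blast
qed

lemma stationary_k_star: "stationary_from A m f j c z (k_star A m f j c z)"
  unfolding k_star_def using stationary_exists by (rule LeastI_ex)

text \<open>A vector of the larger \<open>Delta\<close> fibre lies in the common fibre of
  \<open>G\<close>, so it is a + b with a, b from the smaller \<open>Gam\<close> and
  \<open>Delta\<close> fibres. The disjoint supports allow a coordinatewise comparison, which shows
  that it equals b. The argument for \<open>Gam\<close> is symmetric.\<close>

lemma fibre_Delta_Gam_eqI:
  assumes "j 1 = 0" "z \<in> jet_dom A c" "k \<le> k'"
    and eq: "fibre (G A m f j k') c z = fibre (G A m f j k) c z"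
  shows "fibre (Delta A m f j k') c z = fibre (Delta A m f j k) c z"
    and "fibre (Gam A m j k') c z = fibre (Gam A m j k) c z"
proof -
  have G_split: "v \<in> fibre (G A m f j l) c z \<longleftrightarrow>
      (\<exists>a\<in>fibre (Gam A m j l) c z. \<exists>b\<in>fibre (Delta A m f j l) c z. v = a + b)" for v l
  proof -
    have "fibre (G A m f j l) c z = coord.span
        ((\<lambda>\<gamma>. \<gamma> c z) ` Gam_gens A m j l \<union> (\<lambda>\<gamma>. \<gamma> c z) ` (\<Union>p\<in>{1..m}. Delta_gens A m f j l p))"
      by (simp only: fibre_G G_gens_alt image_Un)
    then show ?thesis
      by (auto simp: coord.span_Un fibre_Delta Gam_eq_generated[of j, OF assms(1)] fibre_generated)
  qed
  have zero: "0 \<in> fibre (Gam A m j l) c z" "0 \<in> fibre (Delta A m f j l) c z" for l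
    by (simp_all add: fibre_Delta Gam_eq_generated[of j, OF assms(1)] fibre_generated coord.span_zero)
  have Gam_U: "v a = 0" if "v \<in> fibre (Gam A m j l) c z" "\<not> (\<exists>p r. 0 < r \<and> a = Uc p r)" for v a l
    using fibre_Gam_support[of j, OF assms(1,2) that(1), of a] that(2) by blast
  have Delta_U: "v a = 0" if "v \<in> fibre (Delta A m f j l) c z" "\<exists>p r. 0 < r \<and> a = Uc p r" for v a l
    using fibre_Delta_support[OF that(1)] that(2) by blast
  have "fibre (Delta A m f j k) c z \<subseteq> fibre (Delta A m f j k') c z"
    unfolding fibre_Delta using assms(3)
    by (intro coord.span_mono image_mono UN_mono Delta_gens_mono) auto
  moreover have "fibre (Delta A m f j k') c z \<subseteq> fibre (Delta A m f j k) c z"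
  proof
    fix v assume v: "v \<in> fibre (Delta A m f j k') c z"
    then have "v \<in> fibre (G A m f j k') c z"
      using zero(1)[of k'] by (subst G_split) (metis add_0)
    then obtain a b where ab: "a \<in> fibre (Gam A m j k) c z" "b \<in> fibre (Delta A m f j k) c z" "v = a + b"
      unfolding eq by (subst (asm) G_split) blast
    have "v x = b x" for x
    proof (cases "\<exists>p r. 0 < r \<and> x = Uc p r")
      case True
      then show ?thesis using Delta_U[OF ab(2)] Delta_U[OF v] by simp
    next
      case False
      then show ?thesis using Gam_U[OF ab(1)] by (simp add: ab(3))
    qed
    then have "v = b" by (rule ext)
    then show "v \<in> fibre (Delta A m f j k) c z" using ab(2) by simp
  qed
  ultimately show "fibre (Delta A m f j k') c z = fibre (Delta A m f j k) c z" by blast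
  have "fibre (Gam A m j k) c z \<subseteq> fibre (Gam A m j k') c z"
    unfolding Gam_eq_generated[of j, OF assms(1)] fibre_generated using assms(3)
    by (intro coord.span_mono image_mono Gam_gens_mono)
  moreover have "fibre (Gam A m j k') c z \<subseteq> fibre (Gam A m j k) c z"
  proof
    fix v assume v: "v \<in> fibre (Gam A m j k') c z"
    then have "v \<in> fibre (G A m f j k') c z"
      using zero(2)[of k'] by (subst G_split) (metis add_0_right)
    then obtain a b where ab: "a \<in> fibre (Gam A m j k) c z" "b \<in> fibre (Delta A m f j k) c z" "v = a + b"
      unfolding eq by (subst (asm) G_split) blast
    have "v x = a x" for x
    proof (cases "\<exists>p r. 0 < r \<and> x = Uc p r")
      case True
      then show ?thesis using Delta_U[OF ab(2)] by (simp add: ab(3))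
    next
      case False
      then show ?thesis using Gam_U[OF ab(1)] Gam_U[OF v] by simp
    qed
    then have "v = a" by (rule ext)
    then show "v \<in> fibre (Gam A m j k) c z" using ab(1) by simp
  qed
  ultimately show "fibre (Gam A m j k') c z = fibre (Gam A m j k) c z" by blast
qed

text \<open>Equality at z alone says nothing about brackets. The constant ranks of both
  distributions near z first upgrade it to equality on a neighbourhood; in that form it passes to
  all later steps.\<close>

lemma stationary_from_regular:
  assumes "regular_point A m f j c z" "z \<in> jet_dom A c"
    and "fibre (G A m f j (Suc k)) c z = fibre (G A m f j k) c z"
  shows "stationary_from A m f j c z k"
proof -
  note regular = assms(1)[unfolded regular_point_def, rule_format]
  have step: "\<forall>\<^sub>F w in nhds z. fibre (G A m f j (Suc (k + l))) c w = fibre (G A m f j (k + l)) c w" for l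
  proof (induction l)
    case 0
    have eq: "fibre_dim (G A m f j (Suc k)) c z = fibre_dim (G A m f j k) c z"
      using assms(3) by (simp only: fibre_dim_def)
    have "\<forall>\<^sub>F w in nhds z. fibre_dim (G A m f j k) c w = fibre_dim (G A m f j (Suc k)) c w"
      using regular[of k] regular[of "Suc k"] by eventually_elim (simp only: eq)
    then show ?case
    proof eventually_elim
      case (elim w)
      then show ?case using fibre_G_eqI[of k "Suc k" j c w] by (simp del: G.simps)
    qed
  next
    case (Suc l)
    let ?i = "k + l"
    have "\<forall>\<^sub>F w in nhds z. fibre (G A m f j (Suc ?i)) c w = fibre (G A m f j ?i) c w \<and>
        fibre_dim (G A m f j ?i) c w = fibre_dim (G A m f j ?i) c z"
      using Suc regular[of ?i] by (rule eventually_conj)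
    \<comment> \<open>The bracket at w involves derivatives there, so equality and constant rank are
      needed around each w near z.\<close>
    then have "\<forall>\<^sub>F w in nhds z. \<forall>\<^sub>F w' in nhds w.
        fibre (G A m f j (Suc ?i)) c w' = fibre (G A m f j ?i) c w' \<and>
        fibre_dim (G A m f j ?i) c w' = fibre_dim (G A m f j ?i) c z"
      by (subst eventually_eventually)
    moreover have "\<forall>\<^sub>F w in nhds z. w \<in> jet_dom A c"
      using open_jet_dom assms(2) by (rule eventually_nhds_in_open)
    ultimately show ?case
    proof eventually_elim
      case (elim w)
      have dim_w: "fibre_dim (G A m f j ?i) c w = fibre_dim (G A m f j ?i) c z"
        using eventually_nhds_x_imp_x[OF elim(1)] by blast
      have G_Suc: "fibre (G A m f j (Suc i)) c w =
          coord.span ((\<lambda>\<gamma>. \<gamma> c w) ` (G_gens A m f j i \<union> ad_g0 A m f j ` G_gens A m f j i))" for i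
        by (simp add: G_eq_generated generated_plus_ad[OF smooth_G_gens] fibre_generated)
      have "(\<lambda>\<gamma>. \<gamma> c w) ` (G_gens A m f j (Suc ?i) \<union> ad_g0 A m f j ` G_gens A m f j (Suc ?i))
          \<subseteq> fibre (G A m f j (Suc ?i)) c w"
      proof (clarify)
        fix \<gamma> assume "\<gamma> \<in> G_gens A m f j (Suc ?i) \<union> ad_g0 A m f j ` G_gens A m f j (Suc ?i)"
        then consider "\<gamma> \<in> G_gens A m f j (Suc ?i)"
          | \<delta> where "\<delta> \<in> G_gens A m f j (Suc ?i)" "\<gamma> = ad_g0 A m f j \<delta>" by blast
        then show "\<gamma> c w \<in> fibre (G A m f j (Suc ?i)) c w"
        proof cases
          case 1
          then show ?thesis unfolding fibre_G by (intro coord.span_base imageI)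
        next
          case 2
          have "\<forall>\<^sub>F w' in nhds w. coord.dim ((\<lambda>\<gamma>. \<gamma> c w') ` G_gens A m f j ?i)
                = coord.dim ((\<lambda>\<gamma>. \<gamma> c w) ` G_gens A m f j ?i)
              \<and> \<delta> c w' \<in> coord.span ((\<lambda>\<gamma>. \<gamma> c w') ` G_gens A m f j ?i)"
            using elim(1)
          proof eventually_elim
            case (elim w')
            have "\<delta> c w' \<in> fibre (G A m f j (Suc ?i)) c w'"
              unfolding fibre_G using 2(1) by (intro coord.span_base imageI)
            then show ?case using elim dim_w by (simp add: fibre_dim_def fibre_G)
          qed
          from ad_in_span_of_constant_rank[OF _ finite_G_gens smooth_G_gens[OF 2(1)] elim(2) this]
          show ?thesis unfolding 2(2) G_Suc[of ?i] by (simp only: smooth_G_gens)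
        qed
      qed
      then have "fibre (G A m f j (Suc (Suc ?i))) c w \<subseteq> fibre (G A m f j (Suc ?i)) c w"
        unfolding G_Suc[of "Suc ?i"] by (rule coord.span_minimal) (simp only: fibre_G coord.subspace_span)
      then show ?case using fibre_G_mono[of "Suc ?i" "Suc (Suc ?i)" j c w] by auto
    qed
  qed
  have "fibre (G A m f j (k + l)) c z = fibre (G A m f j k) c z" for l
    by (induction l) (use eventually_nhds_x_imp_x[OF step] in auto)
  then show ?thesis unfolding stationary_from_def by (metis le_add_diff_inverse)
qed

text \<open>The dimension is m at k = 0, grows strictly at every step before \<open>k_star\<close>,
  and never exceeds n + m + |j|; the m cancels.\<close>

lemma k_star_le:
  assumes "regular_point A m f j c z" "z \<in> jet_dom A c"
  shows "k_star A m f j c z \<le> CARD('n) + (\<Sum>p\<in>{1..m}. j p)"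
proof -
  let ?d = "\<lambda>k. fibre_dim (G A m f j k) c z"
  have strict: "?d k < ?d (Suc k)" if "k < k_star A m f j c z" for k
  proof (rule ccontr)
    assume "\<not> ?d k < ?d (Suc k)"
    then have "fibre (G A m f j (Suc k)) c z = fibre (G A m f j k) c z"
      using fibre_dim_G_mono[of k "Suc k" j c z] fibre_G_eqI[of k "Suc k" j c z] by simp
    then have "stationary_from A m f j c z k"
      by (rule stationary_from_regular[OF assms])
    then show False using that unfolding k_star_def by (blast dest: not_less_Least)
  qed
  have "m + k \<le> ?d k" if "k \<le> k_star A m f j c z" for k
    using that
  proof (induction k)
    case 0
    then show ?case using fibre_dim_G_0[OF assms(2)] by simp
  next
    case (Suc k)
    then show ?case using strict[of k] by simp
  qed
  from this[of "k_star A m f j c z"] fibre_dim_G_le[of j "k_star A m f j c z" c z]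
  show ?thesis by simp
qed

section \<open>Orders of the input derivatives in iterated brackets, and truncation\<close>

definition low_order :: "nat \<Rightarrow> 'n coord set" where
  "low_order s = range Xc \<union> {Uc q r | q r. q \<in> {1..m} \<and> r < s}"

lemma low_order_simps [simp]:
  "Xc i \<in> low_order s" "Uc q r \<in> low_order s \<longleftrightarrow> q \<in> {1..m} \<and> r < s"
  by (auto simp: low_order_def)

lemma low_order_mono: "s \<le> s' \<Longrightarrow> low_order s \<subseteq> low_order s'"
  by (auto simp: low_order_def)

text \<open>A u-component of \<open>g0\<close> involves the input derivative one order higher. An
  x-component involves order 0 only, which \<open>low_order (Suc s)\<close> contains even for s =
  0.\<close>

lemma depends_on_g0_low_order:
  assumes "b \<in> low_order s"
  shows "depends_on (low_order (Suc s)) (jet_dom A c) (\<lambda>z. g0 A m f j c z b)"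
proof (cases b)
  case (Xc i)
  have "jet_coords m (\<lambda>p. 0) \<subseteq> low_order (Suc s)" by (auto simp: jet_coords_def)
  from depends_on_mono[OF depends_on_g0_Xc this] show ?thesis by (simp add: Xc)
next
  case (Uc q r)
  have "depends_on (low_order (Suc s)) (jet_dom A c)
      (\<lambda>z. if q \<in> {1..m} \<and> r < j q then z (Uc q (Suc r)) else 0)"
    using assms Uc by (cases "q \<in> {1..m} \<and> r < j q") (auto intro: depends_on_proj)
  then show ?thesis by (subst depends_on_cong) (auto simp: g0_def Uc)
qed

lemma depends_on_partial_g0:
  "depends_on (low_order (Suc s)) (jet_dom A c) (partial b (\<lambda>w. g0 A m f j c w a))"
proof (cases a)
  case (Xc i)
  then show ?thesis
    using depends_on_partial[OF depends_on_g0_low_order open_jet_dom] by simp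
next
  case (Uc q r)
  then show ?thesis
    by (subst depends_on_cong) (auto simp: partial_g0_Uc)
qed

text \<open>Each bracket raises the order by at most one: derivatives of the s-th iterate along
  coordinates outside \<open>low_order s\<close> vanish, so only components of \<open>g0\<close>
  along \<open>low_order s\<close> are multiplied in.\<close>

lemma depends_on_ad_pow:
  "depends_on (low_order s) (jet_dom A c) (\<lambda>z. (ad_g0 A m f j ^^ s) (d_u A p 0) c z a)"
proof (induction s arbitrary: a)
  case 0
  then show ?case
    by (subst depends_on_cong[where h = "\<lambda>z. if a = Uc p 0 then 1 else 0"]) (auto simp: d_u_def)
next
  case (Suc s)
  let ?\<gamma> = "(ad_g0 A m f j ^^ s) (d_u A p 0)"
  have mono: "depends_on (low_order (Suc s)) (jet_dom A c) h"
    if "depends_on (low_order s) (jet_dom A c) h" for h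
    using that by (rule depends_on_mono) (simp add: low_order_mono)
  show ?case
  proof (cases "a \<in> jet_coords m j")
    case True
    have "depends_on (low_order (Suc s)) (jet_dom A c)
        (\<lambda>z. g0 A m f j c z b * partial b (\<lambda>w. ?\<gamma> c w a) z)" for b
    proof (cases "b \<in> low_order s")
      case True
      then show ?thesis
        by (intro depends_on_mult depends_on_g0_low_order mono depends_on_partial Suc.IH open_jet_dom)
    next
      case False
      then have "partial b (\<lambda>w. ?\<gamma> c w a) z = 0" if "z \<in> jet_dom A c" for z
        using partial_not_depends[OF Suc.IH open_jet_dom that] by blast
      then show ?thesis by (subst depends_on_cong[where h = "\<lambda>z. 0"]) auto
    qed
    then have "depends_on (low_order (Suc s)) (jet_dom A c)
       (\<lambda>z. \<Sum>b\<in>jet_coords m j. g0 A m f j c z b * partial b (\<lambda>w. ?\<gamma> c w a) z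
        - ?\<gamma> c z b * partial b (\<lambda>w. g0 A m f j c w a) z)"
      by (intro depends_on_sum depends_on_diff depends_on_mult[OF mono[OF Suc.IH] depends_on_partial_g0])
    then show ?thesis using True by (subst depends_on_cong) (auto simp: ad_apply)
  next
    case False
    then show ?thesis by (simp add: ad_outside)
  qed
qed

text \<open>The iterated brackets of order at most \<open>N\<close> only involve derivatives of the inputs of order
  less than \<open>N\<close>, so they do not see a truncation of the jets at order \<open>N\<close> or above.\<close>

lemma ad_pow_truncation:
  assumes agree: "\<And>q. q \<in> {1..m} \<Longrightarrow> j q = j' q \<or> N \<le> j q \<and> N \<le> j' q" and "s \<le> N"
  shows "(ad_g0 A m f j ^^ s) (d_u A p 0) = (ad_g0 A m f j' ^^ s) (d_u A p 0)"
  using assms(2)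
proof (induction s)
  case (Suc s)
  define \<gamma> where "\<gamma> = (ad_g0 A m f j ^^ s) (d_u A p 0)"
  have \<gamma>': "\<gamma> = (ad_g0 A m f j' ^^ s) (d_u A p 0)" unfolding \<gamma>_def using Suc by simp
  have U: "ad_g0 A m f j \<gamma> c z (Uc q r) = 0" "ad_g0 A m f j' \<gamma> c z (Uc q r) = 0" for c z q r
    using ad_pow_support[of "Suc s" j p c z "Uc q r"] ad_pow_support[of "Suc s" j' p c z "Uc q r"]
    unfolding funpow.simps comp_apply \<gamma>'[symmetric] \<gamma>_def[symmetric] by blast+
  have X: "ad_g0 A m f j \<gamma> c z (Xc i) = ad_g0 A m f j' \<gamma> c z (Xc i)" if z: "z \<in> jet_dom A c" for c z i
  proof -
    let ?t = "\<lambda>j b. g0 A m f j c z b * partial b (\<lambda>w. \<gamma> c w (Xc i)) z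
        - \<gamma> c z b * partial b (\<lambda>w. g0 A m f j c w (Xc i)) z"
    have g0_Xc: "g0 A m f j c w (Xc l) = g0 A m f j' c w (Xc l)" for w l
      by (simp add: g0_def)
    \<comment> \<open>Since s < N \<le> r, the iterate does not depend on this coordinate, and since
      r > 0 it has no component along it.\<close>
    have high: "?t l (Uc q r) = 0" if "N \<le> r" for l q r
    proof -
      have "Uc q r \<notin> low_order s" using that Suc.prems by simp
      then have "partial (Uc q r) (\<lambda>w. \<gamma> c w (Xc i)) z = 0"
        unfolding \<gamma>_def using partial_not_depends[OF depends_on_ad_pow open_jet_dom z] by blast
      moreover have "\<gamma> c z (Uc q r) = 0"
        using ad_pow_support[of s j p c z "Uc q r"] that Suc.prems unfolding \<gamma>_def by auto
      ultimately show ?thesis by simp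
    qed
    have "(\<Sum>r\<in>{..j q}. ?t j (Uc q r)) = (\<Sum>r\<in>{..j' q}. ?t j' (Uc q r))" if q: "q \<in> {1..m}" for q
    proof (cases "j q = j' q")
      case True
      then have "g0 A m f j c z (Uc q r) = g0 A m f j' c z (Uc q r)" for r
        by (simp add: g0_def)
      then show ?thesis by (simp add: True g0_Xc)
    next
      case False
      then have N: "N \<le> j q" "N \<le> j' q" using agree[OF q] by auto
      \<comment> \<open>Both sums reduce to r < N. There r is below both jet orders, so both
        versions of \<open>g0\<close> have the component \<open>z (Uc q (Suc r))\<close>.\<close>
      have "(\<Sum>r\<in>{..j q}. ?t j (Uc q r)) = (\<Sum>r<N. ?t j (Uc q r))"
      proof (rule sum.mono_neutral_right)
        show "\<forall>r\<in>{..j q} - {..<N}. ?t j (Uc q r) = 0" by (intro ballI high) auto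
      qed (use N in auto)
      also have "\<dots> = (\<Sum>r<N. ?t j' (Uc q r))"
        using N by (intro sum.cong refl) (simp add: g0_Xc, simp add: g0_def)
      also have "\<dots> = (\<Sum>r\<in>{..j' q}. ?t j' (Uc q r))"
      proof (rule sum.mono_neutral_left)
        show "\<forall>r\<in>{..j' q} - {..<N}. ?t j' (Uc q r) = 0" by (intro ballI high) auto
      qed (use N in auto)
      finally show ?thesis .
    qed
    then have "(\<Sum>b\<in>jet_coords m j. ?t j b) = (\<Sum>b\<in>jet_coords m j'. ?t j' b)"
      unfolding sum_jet_coords by (simp add: g0_Xc)
    then show ?thesis using z by (simp add: ad_apply)
  qed
  have "ad_g0 A m f j \<gamma> c z a = ad_g0 A m f j' \<gamma> c z a" for c z a
    by (cases "z \<in> jet_dom A c"; cases a) (simp_all add: U X ad_outside)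
  then have "ad_g0 A m f j \<gamma> = ad_g0 A m f j' \<gamma>" by (intro ext)
  then show ?case by (simp add: \<gamma>_def[symmetric] \<gamma>'[symmetric])
qed simp

text \<open>For p \<le> i at most k brackets are taken, and the inputs whose jet orders may differ
  have both orders above k, so truncation at N = k applies. For p > i both generator sets are
  empty.\<close>

lemma Delta_gens_truncation:
  assumes "i < m" "mono_on {1..m} j" "mono_on {1..m} j'" "\<forall>p\<in>{1..i}. j' p = j p"
    and "k < min (j (i + 1)) (j' (i + 1))" and p: "p \<in> {1..m}"
  shows "Delta_gens A m f j k p = Delta_gens A m f j' k p"
proof -
  have high: "k < j q \<and> k < j' q" if "q \<in> {1..m}" "\<not> q \<le> i" for q
  proof -
    have "j (i + 1) \<le> j q" "j' (i + 1) \<le> j' q"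
      using that assms(1) by (auto intro!: mono_onD[OF assms(2)] mono_onD[OF assms(3)])
    then show ?thesis using assms(5) by simp
  qed
  have agree: "j q = j' q \<or> k \<le> j q \<and> k \<le> j' q" if "q \<in> {1..m}" for q
    using high[OF that] assms(4) that by (cases "q \<le> i") auto
  show ?thesis
  proof (cases "p \<le> i")
    case True
    then have "j' p = j p" using assms(4) p by auto
    moreover have "(ad_g0 A m f j ^^ (l - j p)) (d_u A p 0) = (ad_g0 A m f j' ^^ (l - j p)) (d_u A p 0)"
      if "l \<le> k" for l
      using agree that by (intro ad_pow_truncation[where N = k]) auto
    ultimately show ?thesis unfolding Delta_gens_def by (metis (no_types, lifting))
  next
    case False
    then show ?thesis using high[OF p] unfolding Delta_gens_def by auto
  qed
qed

end

section \<open>Dimension formulas by ranges of k, and the lower bound for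
  \<open>k_star\<close>\<close>

lemma sum_split_at:
  fixes F :: "nat \<Rightarrow> nat"
  assumes "i \<le> m"
  shows "(\<Sum>p\<in>{1..m}. F p) = (\<Sum>p=1..i. F p) + (\<Sum>p=i+1..m. F p)"
  using assms by (metis (no_types) le_add1 sum.ub_add_nat add.commute le_add_diff_inverse Suc_eq_plus1 plus_1_eq_Suc)

theorem proposition3p2:
  fixes A :: "('x::{t2_space,second_countable_topology}, 'n::finite) chart set"
    and m :: nat
    and f :: "('x, 'n) dynamics"
    and j :: "nat \<Rightarrow> nat"
  assumes "smooth_atlas A"
    and "control_system A m f"
    and "1 \<le> m" and "m \<le> CARD('n)"
    and "j 1 = 0" and "mono_on {1..m} j"
  shows
    "(\<forall>i j' k. 1 \<le> i \<and> i < m \<and> mono_on {1..m} j' \<and> (\<forall>p\<in>{1..i}. j' p = j p)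
          \<and> k < min (j (i + 1)) (j' (i + 1)) \<longrightarrow>
        (\<forall>p\<in>{1..m}. Delta_gens A m f j k p = Delta_gens A m f j' k p) \<and>
        (\<forall>c. \<forall>z\<in>jet_dom A c. fibre (Delta A m f j k) c z = fibre (Delta A m f j' k) c z))
   \<and> (\<forall>k.
        (\<forall>c. \<forall>z\<in>jet_dom A c.
           (\<forall>i. 1 \<le> i \<and> i < m \<and> j i \<le> k \<and> k < j (i + 1) \<longrightarrow>
              fibre_dim (Gam A m j k) c z = (\<Sum>p=1..i. j p) + (k + 1) * (m - i) \<and>
              int (fibre_dim (Delta A m f j k) c z)
                \<le> min (int ((k + 1) * i) - int (\<Sum>p=1..i. j p)) (int (CARD('n) + i))) \<and>
           (j m \<le> k \<longrightarrow>
              fibre_dim (Gam A m j k) c z = (\<Sum>p=1..m. j p) \<and>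
              int (fibre_dim (Delta A m f j k) c z)
                \<le> min (int ((k + 1) * m) - int (\<Sum>p=1..m. j p)) (int (CARD('n) + m)))) \<and>
        direct_sum A (G A m f j k) (Gam A m j k) (Delta A m f j k))
   \<and> (\<forall>c. \<forall>z\<in>jet_dom A c.
        (\<exists>K. stationary_from A m f j c z K) \<and>
        (regular_point A m f j c z \<longrightarrow> k_star A m f j c z \<le> CARD('n) + (\<Sum>p=1..m. j p)) \<and>
        (\<forall>k\<ge>k_star A m f j c z.
           fibre (Delta A m f j k) c z = fibre (Delta A m f j (k_star A m f j c z)) c z \<and>
           fibre (Gam A m j k) c z = fibre (Gam A m j (k_star A m f j c z)) c z) \<and>
        (fibre_dim (Delta A m f j (k_star A m f j c z)) c z = m + CARD('n) \<longrightarrow>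
           (regular_point A m f j c z \<longrightarrow>
              CARD('n) + (\<Sum>p=1..m. j p) \<ge> k_star A m f j c z) \<and>
           real (k_star A m f j c z)
             \<ge> max (real (j m)) (real (CARD('n) + (\<Sum>p=1..m. j p)) / real m)))"
proof -
  interpret jet_system A m f using assms(1,2) by unfold_locales
  note mono = mono_onD[OF assms(6)]
  \<comment> \<open>One statement covers both ranges of k: for i = m the upper bound on k is vacuous
    and m - i = 0.\<close>
  have dims: "fibre_dim (Gam A m j k) c z = (\<Sum>p=1..i. j p) + (k + 1) * (m - i)"
      "int (fibre_dim (Delta A m f j k) c z)
        \<le> min (int ((k + 1) * i) - int (\<Sum>p=1..i. j p)) (int (CARD('n) + i))"
    if z: "z \<in> jet_dom A c" and i: "1 \<le> i" "i \<le> m" "j i \<le> k" and k: "i < m \<Longrightarrow> k < j (i + 1)"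
    for c z i k
  proof -
    have low: "j p \<le> k" if "p \<in> {1..i}" for p
      using mono[of p i] that i by auto
    have high: "k < j p" if "p \<in> {i+1..m}" for p
      using mono[of "i + 1" p] that i k by fastforce
    have "(\<Sum>p=1..i. min (k + 1) (j p)) = (\<Sum>p=1..i. j p)"
      using low by (intro sum.cong refl) fastforce
    moreover have "(\<Sum>p=i+1..m. min (k + 1) (j p)) = (\<Sum>p=i+1..m. k + 1)"
      using high by (intro sum.cong refl) fastforce
    ultimately show "fibre_dim (Gam A m j k) c z = (\<Sum>p=1..i. j p) + (k + 1) * (m - i)"
      unfolding fibre_dim_Gam[of j, OF assms(5) z] sum_split_at[OF i(2)] by (simp add: mult.commute)
    have "(\<Sum>p=i+1..m. k + 1 - j p) = 0" using high by fastforce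
    then have le: "fibre_dim (Delta A m f j k) c z \<le> (\<Sum>p=1..i. k + 1 - j p)"
      using fibre_dim_Delta_le_count[of j k c z] unfolding sum_split_at[OF i(2)] by simp
    \<comment> \<open>For p \<le> i one has j_p \<le> k, so natural and integer subtraction
      agree.\<close>
    have "int (\<Sum>p=1..i. k + 1 - j p) = (\<Sum>p=1..i. int (k + 1) - int (j p))"
      unfolding of_nat_sum using low by (intro sum.cong refl) fastforce
    then have eq: "int (\<Sum>p=1..i. k + 1 - j p) = int ((k + 1) * i) - int (\<Sum>p=1..i. j p)"
      by (simp add: sum_subtractf algebra_simps)
    have count: "int (fibre_dim (Delta A m f j k) c z) \<le> int ((k + 1) * i) - int (\<Sum>p=1..i. j p)"
      unfolding eq[symmetric] using le by (simp only: of_nat_le_iff)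
    have "{p\<in>{1..m}. j p \<le> k} \<subseteq> {1..i}"
      using high by (auto simp: not_less_eq_eq Suc_le_eq) (metis not_less Suc_leI)
    then have "card {p\<in>{1..m}. j p \<le> k} \<le> i"
      using card_mono[of "{1..i}" "{p\<in>{1..m}. j p \<le> k}"] by simp
    then show "int (fibre_dim (Delta A m f j k) c z)
        \<le> min (int ((k + 1) * i) - int (\<Sum>p=1..i. j p)) (int (CARD('n) + i))"
      using count fibre_dim_Delta_le_support[of j k c z] by simp
  qed
  have k_star_ge: "max (real (j m)) (real (CARD('n) + (\<Sum>p=1..m. j p)) / real m) \<le> real (k_star A m f j c z)"
    if z: "z \<in> jet_dom A c" and full: "fibre_dim (Delta A m f j (k_star A m f j c z)) c z = m + CARD('n)" for c z
  proof -
    let ?K = "k_star A m f j c z"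
    \<comment> \<open>Dimension n + m forces all m directions \<open>Uc p 0\<close> to occur; hence
      every j_p is at most \<open>k_star\<close>, which places \<open>k_star\<close> in the last
      range.\<close>
    have "m \<le> card {p\<in>{1..m}. j p \<le> ?K}"
      using fibre_dim_Delta_le_support[of j ?K c z] full by simp
    then have all: "{p\<in>{1..m}. j p \<le> ?K} = {1..m}"
      by (intro card_seteq) auto
    have "m \<in> {p\<in>{1..m}. j p \<le> ?K}" unfolding all using assms(3) by simp
    then have jm: "j m \<le> ?K" by simp
    \<comment> \<open>The generator count in the last range gives n + m \<le> (K + 1) m - |j|, that
      is, n + |j| \<le> K m.\<close>
    have "int (m + CARD('n)) \<le> int ((?K + 1) * m) - int (\<Sum>p=1..m. j p)"
      using dims(2)[OF z assms(3) order_refl jm] full by simp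
    then have "int (CARD('n) + (\<Sum>p=1..m. j p)) \<le> int (?K * m)"
      by (simp add: algebra_simps)
    then have "CARD('n) + (\<Sum>p=1..m. j p) \<le> ?K * m"
      by (simp only: of_nat_le_iff)
    then have "real (CARD('n) + (\<Sum>p=1..m. j p)) \<le> real ?K * real m"
      by (metis of_nat_le_iff of_nat_mult)
    then show ?thesis using jm assms(3) by (simp add: divide_le_eq)
  qed
  show ?thesis
  proof (intro conjI allI ballI impI; (elim conjE)?)
    fix i j' k p
    assume "i < m" "mono_on {1..m} j'" "\<forall>p\<in>{1..i}. j' p = j p" "k < min (j (i + 1)) (j' (i + 1))" "p \<in> {1..m}"
    then show "Delta_gens A m f j k p = Delta_gens A m f j' k p"
      using Delta_gens_truncation[OF _ assms(6)] by blast
  next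
    fix i j' k c z
    assume "i < m" "mono_on {1..m} j'" "\<forall>p\<in>{1..i}. j' p = j p" "k < min (j (i + 1)) (j' (i + 1))"
    then have "Delta_gens A m f j k p = Delta_gens A m f j' k p" if "p \<in> {1..m}" for p
      using Delta_gens_truncation[OF _ assms(6)] that by blast
    then show "fibre (Delta A m f j k) c z = fibre (Delta A m f j' k) c z"
      unfolding fibre_Delta by simp
  next
    fix k c z i assume "z \<in> jet_dom A c" "1 \<le> i" "i < m" "j i \<le> k" "k < j (i + 1)"
    then show "fibre_dim (Gam A m j k) c z = (\<Sum>p=1..i. j p) + (k + 1) * (m - i)"
      "int (fibre_dim (Delta A m f j k) c z)
        \<le> min (int ((k + 1) * i) - int (\<Sum>p=1..i. j p)) (int (CARD('n) + i))"
      by (intro dims; simp)+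
  next
    fix k c z assume *: "z \<in> jet_dom A c" "j m \<le> k"
    show "fibre_dim (Gam A m j k) c z = (\<Sum>p=1..m. j p)"
      using dims(1)[OF *(1) assms(3) order_refl *(2)] by simp
    show "int (fibre_dim (Delta A m f j k) c z)
        \<le> min (int ((k + 1) * m) - int (\<Sum>p=1..m. j p)) (int (CARD('n) + m))"
      using dims(2)[OF *(1) assms(3) order_refl *(2)] by simp
  next
    show "direct_sum A (G A m f j k) (Gam A m j k) (Delta A m f j k)" for k
      using assms(5) by (rule direct_sum_G)
  next
    show "\<exists>K. stationary_from A m f j c z K" for c z
      by (rule stationary_exists)
  next
    fix k c z assume "z \<in> jet_dom A c" "k \<ge> k_star A m f j c z"
    then show "fibre (Delta A m f j k) c z = fibre (Delta A m f j (k_star A m f j c z)) c z"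
      "fibre (Gam A m j k) c z = fibre (Gam A m j (k_star A m f j c z)) c z"
      using fibre_Delta_Gam_eqI[of j, OF assms(5)] stationary_k_star[of j c z]
      unfolding stationary_from_def by blast+
  qed (rule k_star_le k_star_ge; assumption)+
qed

end
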